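(* There exists $\underline{\rho}_c\in(0,\infty)$ such that for any $0<\rho<\underline{\rho}_c$ there exists a first-order phase transition of the Lyapunov exponent $\lambda$ (that is, for every such $\rho$ there is some $\beta>0$ such that there is a first-order phase transition at $(\rho,\beta)$).
   Context: For $\rho>0,\beta>0$ the Lyapunov exponent is $\lambda(\rho,\beta)=\lim_{n\to\infty}\frac1n\log\mathbb{E}[x_n]$, where $x_{i+1}=a_ix_i$, $x_0>0$ deterministic, $a_i=1+\rho e^{\sigma W(t_i)-\frac12\sigma^2t_i}$, $t_i=i\tau$, $W$ is a standard Brownian motion, and the limit is taken with $\frac12\sigma^2\tau n^2=\beta$ fixed. The limit exists and equals $$\lambda(\rho,\beta)=\sup_{g}\left\{g(1)\log\rho+\beta\int_0^1(g(1)-g(x))^2dx-\int_0^1 I(g'(x))dx\right\},$$ the supremum being over absolutely continuous $g:[0,1]\to[0,1]$ with $g(0)=0$, $0\le g'\le1$ almost everywhere, and $I(x)=x\log x+(1-x)\log(1-x)$ ($0\log0=0$). Definition of phases: a phase is a connected region of the parameter space $\{(\rho,\beta)\}=(0,\infty)^2$, maximal for the condition that $\lambda(\rho,\beta)$ is analytic. There is a $j$th-order phase transition at a boundary point of a phase if at least one $j$th-order partial derivative of $\lambda(\rho,\beta)$ is discontinuous there, while all lower order derivatives (including $\lambda$ itself) are continuous. *)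

theory Defs
  imports "HOL-Probability.Probability"
begin

section \<open>The random multiplicative process\<close>

text \<open>Only the times \<open>t \<ge> 0\<close> are constrained.\<close>

definition standard_brownian_motion :: "'a measure \<Rightarrow> (real \<Rightarrow> 'a \<Rightarrow> real) \<Rightarrow> bool" where
  "standard_brownian_motion M W \<longleftrightarrow>
     prob_space M \<and>
     (\<forall>t\<ge>0. W t \<in> borel_measurable M) \<and>
     (AE \<omega> in M. W 0 \<omega> = 0) \<and>
     (\<forall>s t. 0 \<le> s \<and> s < t \<longrightarrow>
        distributed M lborel (\<lambda>\<omega>. W t \<omega> - W s \<omega>) (normal_density 0 (sqrt (t - s)))) \<and>
     (\<forall>(n::nat) (t :: nat \<Rightarrow> real). 0 \<le> t 0 \<and> (\<forall>i<n. t i < t (Suc i)) \<longrightarrow>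
        prob_space.indep_vars M (\<lambda>_. borel) (\<lambda>i \<omega>. W (t (Suc i)) \<omega> - W (t i) \<omega>) {..<n}) \<and>
     (AE \<omega> in M. continuous_on {0..} (\<lambda>t. W t \<omega>))"

definition mult_factor ::
    "(real \<Rightarrow> 'a \<Rightarrow> real) \<Rightarrow> real \<Rightarrow> real \<Rightarrow> real \<Rightarrow> nat \<Rightarrow> 'a \<Rightarrow> real" where
  "mult_factor W \<rho> \<sigma> \<tau> i \<omega> =
     (let t = real i * \<tau> in 1 + \<rho> * exp (\<sigma> * W t \<omega> - \<sigma>\<^sup>2 * t / 2))"

primrec mult_process ::
    "(real \<Rightarrow> 'a \<Rightarrow> real) \<Rightarrow> real \<Rightarrow> real \<Rightarrow> real \<Rightarrow> real \<Rightarrow> nat \<Rightarrow> 'a \<Rightarrow> real" where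
  "mult_process W x0 \<rho> \<sigma> \<tau> 0 \<omega> = x0"
| "mult_process W x0 \<rho> \<sigma> \<tau> (Suc i) \<omega> =
     mult_factor W \<rho> \<sigma> \<tau> i \<omega> * mult_process W x0 \<rho> \<sigma> \<tau> i \<omega>"

text \<open>The volatility \<open>\<sigma> \<beta> n\<close> and the time step \<open>\<tau> \<beta> n\<close> depend on \<open>\<beta>\<close> and on the number \<open>n\<close> of
  steps. Intended for \<open>\<sigma>\<close>, \<open>\<tau>\<close> with \<open>\<sigma>\<^sup>2 \<tau> n\<^sup>2 / 2 = \<beta>\<close>: the limit is along this constraint.\<close>

definition lyapunov_exponent ::
    "'a measure \<Rightarrow> (real \<Rightarrow> 'a \<Rightarrow> real) \<Rightarrow> real \<Rightarrow> (real \<Rightarrow> nat \<Rightarrow> real) \<Rightarrow> (real \<Rightarrow> nat \<Rightarrow> real) \<Rightarrow>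
     real \<Rightarrow> real \<Rightarrow> real" where
  "lyapunov_exponent M W x0 \<sigma> \<tau> \<rho> \<beta> =
     lim (\<lambda>n. ln (integral\<^sup>L M (mult_process W x0 \<rho> (\<sigma> \<beta> n) (\<tau> \<beta> n) n)) / real n)"


section \<open>Phases and phase transitions\<close>

definition param_space :: "(real \<times> real) set" where
  "param_space = {0<..} \<times> {0<..}"

definition real_analytic_at :: "(real \<times> real \<Rightarrow> real) \<Rightarrow> real \<times> real \<Rightarrow> bool" where
  "real_analytic_at f p \<longleftrightarrow>
     (\<exists>(c :: nat \<times> nat \<Rightarrow> real) r. 0 < r \<and>
        (\<forall>x y. \<bar>x - fst p\<bar> < r \<and> \<bar>y - snd p\<bar> < r \<longrightarrow>
           ((\<lambda>(m, n). c (m, n) * (x - fst p) ^ m * (y - snd p) ^ n) has_sum f (x, y)) UNIV))"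

definition analytic_region :: "(real \<times> real \<Rightarrow> real) \<Rightarrow> (real \<times> real) set \<Rightarrow> bool" where
  "analytic_region f U \<longleftrightarrow>
     U \<noteq> {} \<and> U \<subseteq> param_space \<and> open U \<and> connected U \<and> (\<forall>p\<in>U. real_analytic_at f p)"

definition phase :: "(real \<times> real \<Rightarrow> real) \<Rightarrow> (real \<times> real) set \<Rightarrow> bool" where
  "phase f U \<longleftrightarrow> analytic_region f U \<and> (\<forall>V. analytic_region f V \<and> U \<subseteq> V \<longrightarrow> V = U)"

text \<open>\<open>has_partial vs f p d\<close>: the iterated partial derivative of \<open>f\<close> in the directions \<open>vs\<close>
  (last one taken first) exists at \<open>p\<close> and equals \<open>d\<close>. A relation, since partial derivatives
  need not exist everywhere.\<close>

primrec has_partial ::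
    "(real \<times> real) list \<Rightarrow> (real \<times> real \<Rightarrow> real) \<Rightarrow> real \<times> real \<Rightarrow> real \<Rightarrow> bool" where
  "has_partial [] f p d \<longleftrightarrow> d = f p"
| "has_partial (v # vs) f p d \<longleftrightarrow>
     (\<exists>g. (\<forall>\<^sub>F t in nhds 0. has_partial vs f (p + t *\<^sub>R v) (g t)) \<and>
          (g has_real_derivative d) (at 0))"

definition partial_near ::
    "(real \<times> real) list \<Rightarrow> (real \<times> real \<Rightarrow> real) \<Rightarrow> real \<times> real \<Rightarrow> real \<Rightarrow> bool" where
  "partial_near vs f p L \<longleftrightarrow>
     (\<forall>e>0. \<forall>\<^sub>F q in nhds p. \<forall>d. has_partial vs f q d \<longrightarrow> \<bar>d - L\<bar> < e)"

definition partial_continuous_at ::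
    "(real \<times> real) list \<Rightarrow> (real \<times> real \<Rightarrow> real) \<Rightarrow> real \<times> real \<Rightarrow> bool" where
  "partial_continuous_at vs f p \<longleftrightarrow> (\<exists>L. has_partial vs f p L \<and> partial_near vs f p L)"

text \<open>The values of the partial derivative, at the points where it exists, have no limit at \<open>p\<close>.
  This implies that the derivative is not continuous at \<open>p\<close>, and is meant to be stronger: that it
  merely fails to exist at \<open>p\<close> does not count as a discontinuity. On the boundary of a phase
  there are always points arbitrarily close to \<open>p\<close> at which it exists.\<close>

definition partial_discontinuous_at ::
    "(real \<times> real) list \<Rightarrow> (real \<times> real \<Rightarrow> real) \<Rightarrow> real \<times> real \<Rightarrow> bool" where
  "partial_discontinuous_at vs f p \<longleftrightarrow> (\<nexists>L. partial_near vs f p L)"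

text \<open>\<open>Basis\<close> consists of the two coordinate directions \<open>(1, 0)\<close> and \<open>(0, 1)\<close>.\<close>

definition phase_transition ::
    "nat \<Rightarrow> (real \<times> real \<Rightarrow> real) \<Rightarrow> real \<times> real \<Rightarrow> bool" where
  "phase_transition j f p \<longleftrightarrow>
     p \<in> param_space \<and>
     (\<exists>U. phase f U \<and> p \<in> frontier U) \<and>
     (\<exists>vs. set vs \<subseteq> Basis \<and> length vs = j \<and> partial_discontinuous_at vs f p) \<and>
     (\<forall>vs. set vs \<subseteq> Basis \<and> length vs < j \<longrightarrow> partial_continuous_at vs f p)"

end

theory Submission
  imports Defs "HOL-Real_Asymp.Real_Asymp" "HOL-Library.Diagonal_Subsequence"
begin

text \<open>
Expanding the product, the expectation of \<open>x\<^sub>n\<close> becomes, up to a factor bounded in \<open>n\<close>, the partition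
function of a lattice gas: a configuration is a set \<open>S\<close> of times, every occupied time carries the
activity \<open>\<rho>\<close>, and the correlations of the Brownian motion produce an attraction \<open>exp (\<beta> E(S))\<close>, where \<open>n\<^sup>2 E(S)\<close> is the sum
of the squares of the numbers of occupied times at or after each site (\<open>lyapunov_exponent_eq_pressure\<close>). This
mean-field interaction is a convex function of the occupation, so splitting the system into residue
classes makes the partition function submultiplicative, and the limit, the pressure \<open>\<lambda>(\<rho>, \<beta>)\<close>, exists
(\<open>log_part_tendsto_pressure\<close>). It is convex in \<open>ln \<rho>\<close> and Lipschitz in \<open>ln \<rho>\<close> and \<open>\<beta>\<close>.

For small \<open>\<rho>\<close> the gas has a low-density state. Split the configurations at a density \<open>\<epsilon>\<close> of the order of
\<open>1 / ln (1/\<rho>)\<close>. The sparse ones are described by independent sites in a self-consistent field, up to a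
polynomial factor (\<open>weight_sum_sparse_le\<close>): deviations of the tails from their means cost at least
as much as the attraction gains. The resulting growth rate has slope at most \<open>e \<rho>\<close> in \<open>ln \<rho>\<close>, much less
than \<open>\<epsilon>\<close>. Weights of dense configurations have slope at least \<open>\<epsilon>\<close>. Hence the set where sparse
configurations determine \<open>\<lambda>\<close> contains an open cone, in the direction of decreasing \<open>\<rho>\<close>, below each of
its points (\<open>low_phase_cone\<close>); and outside of it \<open>\<lambda>\<close> grows at rate at least \<open>\<epsilon>\<close> in \<open>ln \<rho>\<close>
(\<open>pressure_growth_outside_low_phase\<close>).

For fixed \<open>\<rho>\<close>, the value \<open>\<beta> = 1\<close> belongs to the low-density phase, and the values above \<open>4 ln (1/\<rho>)\<close>
that the estimates cover do not, because the fully occupied configuration is then more favourable. At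
the supremum \<open>\<beta>\<^sub>c\<close> of the low-density values, \<open>\<partial>\<lambda>/\<partial>\<rho>\<close> is at most \<open>e\<close> in the cone below \<open>(\<rho>, \<beta>\<^sub>c)\<close>, but at least \<open>2 e\<close> at suitable
points arbitrarily close to \<open>(\<rho>, \<beta>\<^sub>c)\<close>: convex functions are differentiable outside a countable set. So the
derivative has no limit, whereas \<open>\<lambda>\<close> is continuous.

It remains to see that \<open>(\<rho>, \<beta>\<^sub>c)\<close> lies on the boundary of a phase. In the cone \<open>\<lambda>\<close> is the limit of the
mean-field values, which are built from \<open>\<rho>\<close> and \<open>\<beta>\<close> by elementary functions. Their double power series
around a given point have absolute sums bounded uniformly in \<open>n\<close>, and this passes to the limit by
compactness (\<open>series_bounded_limit\<close>). So \<open>\<lambda>\<close> is analytic in the cone, the cone is contained in a phase,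
and the jump of the slope keeps \<open>(\<rho>, \<beta>\<^sub>c)\<close> itself out of it.
\<close>

section \<open>The lattice gas of occupied times\<close>

definition tail_count :: "nat set \<Rightarrow> nat \<Rightarrow> nat" where
  "tail_count S l = card {i \<in> S. l \<le> i}"

text \<open>For sets \<open>S\<close> of sites below \<open>n\<close> this is \<open>(\<Sum>i\<in>S. \<Sum>j\<in>S. (min i j + 1)) / n\<^sup>2\<close>: up to lower-order terms it is the
exponent by which the correlations of the Brownian motion favour the product of the exponential
factors at the times in \<open>S\<close>.\<close>

definition energy :: "nat \<Rightarrow> nat set \<Rightarrow> real" where
  "energy n S = (\<Sum>l<n. (real (tail_count S l))\<^sup>2) / (real n)\<^sup>2"

text \<open>A family of configurations is kept as a parameter because sparse and dense configurations are
estimated separately.\<close>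

definition weight_sum :: "nat set set \<Rightarrow> nat \<Rightarrow> real \<Rightarrow> real \<Rightarrow> real" where
  "weight_sum \<S> n \<rho> \<beta> = (\<Sum>S\<in>\<S>. \<rho> ^ card S * exp (\<beta> * energy n S))"

abbreviation part_fun :: "nat \<Rightarrow> real \<Rightarrow> real \<Rightarrow> real" where
  "part_fun n \<equiv> weight_sum (Pow {..<n}) n"

lemma tail_count_eq_sum: "S \<subseteq> {..<n} \<Longrightarrow> tail_count S l = (\<Sum>i<n. if i \<in> S \<and> l \<le> i then 1 else 0)"
proof -
  assume "S \<subseteq> {..<n}"
  then have "{i \<in> S. l \<le> i} = {i \<in> {..<n}. i \<in> S \<and> l \<le> i}" by auto
  then show ?thesis by (simp add: tail_count_def sum.If_cases Int_def)
qed

lemma sum_indicator_tail_count: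
  assumes "finite S"
  shows "(\<Sum>i\<in>S. if l \<le> i then c else 0) = c * real (tail_count S l)"
  using assms by (simp add: tail_count_def sum.If_cases Int_def)

lemma tail_count_le_card: "finite S \<Longrightarrow> tail_count S l \<le> card S"
  by (auto simp: tail_count_def intro!: card_mono)

lemma card_le_of_subset_lessThan: "S \<subseteq> {..<n} \<Longrightarrow> card S \<le> (n::nat)"
  using card_mono[of "{..<n}" S] by simp

lemma energy_nonneg: "0 \<le> energy n S"
  by (simp add: energy_def sum_nonneg)

lemma energy_le_card:
  assumes "S \<subseteq> {..<n}"
  shows "energy n S \<le> card S"
proof (cases "n = 0")
  case True
  then show ?thesis by (simp add: energy_def)
next
  case False
  have fin: "finite S" using assms finite_subset by blast
  have "(\<Sum>l<n. (real (tail_count S l))\<^sup>2) \<le> (\<Sum>l<n. (real (card S))\<^sup>2)"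
    by (intro sum_mono power_mono) (auto simp: tail_count_le_card[OF fin])
  also have "\<dots> = real n * real (card S) * real (card S)" by (simp add: power2_eq_square)
  also have "\<dots> \<le> real n * real (card S) * real n"
    using card_le_of_subset_lessThan[OF assms] by (intro mult_left_mono) auto
  finally show ?thesis using False by (simp add: energy_def field_simps power2_eq_square)
qed

lemma energy_le: "S \<subseteq> {..<n} \<Longrightarrow> energy n S \<le> n"
  using energy_le_card[of S n] card_le_of_subset_lessThan[of S n] by linarith

lemma weight_sum_nonneg: "0 \<le> \<rho> \<Longrightarrow> 0 \<le> weight_sum \<S> n \<rho> \<beta>"
  by (auto simp: weight_sum_def intro!: sum_nonneg mult_nonneg_nonneg)

lemma weight_sum_Un:
  "finite \<S> \<Longrightarrow> finite \<T> \<Longrightarrow> \<S> \<inter> \<T> = {} \<Longrightarrow>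
    weight_sum (\<S> \<union> \<T>) n \<rho> \<beta> = weight_sum \<S> n \<rho> \<beta> + weight_sum \<T> n \<rho> \<beta>"
  by (simp add: weight_sum_def sum.union_disjoint)

lemma weight_sum_mono_set:
  "0 \<le> \<rho> \<Longrightarrow> finite \<T> \<Longrightarrow> \<S> \<subseteq> \<T> \<Longrightarrow> weight_sum \<S> n \<rho> \<beta> \<le> weight_sum \<T> n \<rho> \<beta>"
  unfolding weight_sum_def by (intro sum_mono2) auto

lemma part_fun_ge_1:
  assumes "0 \<le> \<rho>"
  shows "1 \<le> part_fun n \<rho> \<beta>"
proof -
  have "1 = weight_sum {{}} n \<rho> \<beta>" by (simp add: weight_sum_def energy_def tail_count_def)
  also have "\<dots> \<le> part_fun n \<rho> \<beta>" using assms by (intro weight_sum_mono_set) auto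
  finally show ?thesis .
qed

text \<open>Every configuration on \<open>n\<close> sites has energy at most \<open>n\<close>, so \<open>(1/n) ln\<close> of a
  weight sum grows at rate at most one in \<open>\<beta>\<close>.\<close>

lemma weight_sum_shift_beta:
  assumes "\<S> \<subseteq> Pow {..<n}" "0 \<le> \<rho>"
  shows "weight_sum \<S> n \<rho> (\<beta> + t) \<le> exp (real n * \<bar>t\<bar>) * weight_sum \<S> n \<rho> \<beta>"
  unfolding weight_sum_def sum_distrib_left
proof (rule sum_mono)
  fix S assume "S \<in> \<S>"
  then have S: "S \<subseteq> {..<n}" using assms by auto
  have "t * energy n S \<le> \<bar>t\<bar> * n"
    using energy_nonneg[of n S] energy_le[OF S] by (intro mult_mono) auto
  then have "exp ((\<beta> + t) * energy n S) \<le> exp (real n * \<bar>t\<bar>) * exp (\<beta> * energy n S)"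
    by (simp add: exp_add[symmetric] algebra_simps)
  then show "\<rho> ^ card S * exp ((\<beta> + t) * energy n S) \<le> exp (real n * \<bar>t\<bar>) * (\<rho> ^ card S * exp (\<beta> * energy n S))"
    using assms(2) mult_left_mono[of _ _ "\<rho> ^ card S"] by (simp add: mult.left_commute)
qed

lemma weight_sum_mono_rho:
  "0 \<le> \<rho> \<Longrightarrow> \<rho> \<le> \<rho>' \<Longrightarrow> weight_sum \<S> n \<rho> \<beta> \<le> weight_sum \<S> n \<rho>' \<beta>"
  unfolding weight_sum_def by (intro sum_mono mult_right_mono power_mono) auto

lemma part_fun_shift_rho:
  assumes "0 \<le> \<rho>" "0 \<le> s"
  shows "part_fun n (exp s * \<rho>) \<beta> \<le> exp (real n * s) * part_fun n \<rho> \<beta>"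
  unfolding weight_sum_def sum_distrib_left
proof (rule sum_mono)
  fix S assume "S \<in> Pow {..<n}"
  then have "real (card S) * s \<le> real n * s"
    using assms card_le_of_subset_lessThan[of S n] by (intro mult_right_mono) auto
  then have "exp s ^ card S \<le> exp (real n * s)" by (simp add: exp_of_nat_mult[symmetric])
  then show "(exp s * \<rho>) ^ card S * exp (\<beta> * energy n S) \<le> exp (real n * s) * (\<rho> ^ card S * exp (\<beta> * energy n S))"
    using assms by (simp add: power_mult_distrib mult.assoc mult_right_mono)
qed

section \<open>Existence of the limit\<close>

lemma sum_nat_blocks: "(\<Sum>i<m * k. f i) = (\<Sum>a<m. \<Sum>b<k. f (a * k + b))" for f :: "nat \<Rightarrow> 'b::comm_monoid_add"
proof -
  have "(\<Sum>i<m * k. f i) = (\<Sum>a<m. sum f {a * k..<a * k + k})"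
    by (rule sum.nat_group[symmetric])
  also have "\<dots> = (\<Sum>a<m. \<Sum>b<k. f (a * k + b))"
    by (simp add: sum.atLeastLessThan_shift_0 atLeast0LessThan)
  finally show ?thesis .
qed

definition residue_part :: "nat \<Rightarrow> nat set \<Rightarrow> nat \<Rightarrow> nat set" where
  "residue_part k S b = {a. a * k + b \<in> S}"

lemma residue_part_subset:
  assumes "S \<subseteq> {..<m * k}" 
  shows "residue_part k S b \<subseteq> {..<m}"
proof
  fix a assume "a \<in> residue_part k S b"
  then have "a * k + b < m * k" using assms by (auto simp: residue_part_def)
  then have "a * k < m * k" by linarith
  then show "a \<in> {..<m}" by simp
qed

lemma card_eq_sum_indicator:
  assumes "S \<subseteq> {..<n::nat}" 
  shows "card S = (\<Sum>i<n. if i \<in> S then 1 else 0)"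
  using tail_count_eq_sum[OF assms, of 0] by (simp add: tail_count_def)

lemma card_eq_sum_residue_parts:
  assumes "S \<subseteq> {..<m * k}"
  shows "card S = (\<Sum>b<k. card (residue_part k S b))"
proof -
  have "card S = (\<Sum>a<m. \<Sum>b<k. if a * k + b \<in> S then 1 else 0)"
    unfolding card_eq_sum_indicator[OF assms] sum_nat_blocks ..
  also have "\<dots> = (\<Sum>b<k. \<Sum>a<m. if a * k + b \<in> S then 1 else 0)" by (rule sum.swap)
  also have "\<dots> = (\<Sum>b<k. card (residue_part k S b))"
    using card_eq_sum_indicator[OF residue_part_subset[OF assms]] by (simp add: residue_part_def)
  finally show ?thesis .
qed

lemma tail_count_le_sum_residue_parts:
  assumes "S \<subseteq> {..<m * k}" "b' < k"
  shows "tail_count S (a' * k + b') \<le> (\<Sum>b<k. tail_count (residue_part k S b) a')"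
proof -
  have "tail_count S (a' * k + b')
      = (\<Sum>a<m. \<Sum>b<k. if a * k + b \<in> S \<and> a' * k + b' \<le> a * k + b then 1 else 0)"
    unfolding tail_count_eq_sum[OF assms(1)] sum_nat_blocks ..
  also have "\<dots> \<le> (\<Sum>a<m. \<Sum>b<k. if a \<in> residue_part k S b \<and> a' \<le> a then 1 else 0)"
  proof (intro sum_mono)
    fix a b assume "a \<in> {..<m}" "b \<in> {..<k}"
    have "a' \<le> a" if "a' * k + b' \<le> a * k + b"
    proof (rule ccontr)
      assume "\<not> a' \<le> a"
      then have "(a + 1) * k \<le> a' * k" by (intro mult_le_mono1) auto
      then show False using that \<open>b \<in> {..<k}\<close> by auto
    qed
    then show "(if a * k + b \<in> S \<and> a' * k + b' \<le> a * k + b then 1 else 0)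
        \<le> (if a \<in> residue_part k S b \<and> a' \<le> a then 1 else (0::nat))"
      by (auto simp: residue_part_def)
  qed
  also have "\<dots> = (\<Sum>b<k. tail_count (residue_part k S b) a')"
    unfolding tail_count_eq_sum[OF residue_part_subset[OF assms(1)]] by (rule sum.swap)
  finally show ?thesis .
qed

text \<open>Each residue class sees at least the tails of the whole configuration, and by Cauchy-Schwarz
  the square of a sum of \<open>k\<close> tail counts is at most \<open>k\<close> times the sum of their squares. The
  attraction being a convex functional of the tails is what makes the energy subadditive.\<close>

lemma energy_le_sum_residue_parts:
  assumes "S \<subseteq> {..<m * k}" "0 < m" "0 < k"
  shows "energy (m * k) S \<le> (\<Sum>b<k. energy m (residue_part k S b))"
proof -
  define T where "T b a = real (tail_count (residue_part k S b) a)" for b a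
  have "(\<Sum>l<m * k. (real (tail_count S l))\<^sup>2)
      = (\<Sum>a<m. \<Sum>b<k. (real (tail_count S (a * k + b)))\<^sup>2)"
    by (rule sum_nat_blocks)
  also have "\<dots> \<le> (\<Sum>a<m. \<Sum>b<k. (\<Sum>c<k. T c a)\<^sup>2)"
  proof (intro sum_mono power_mono)
    fix a b assume "b \<in> {..<k}"
    then show "real (tail_count S (a * k + b)) \<le> (\<Sum>c<k. T c a)"
      unfolding T_def of_nat_sum[symmetric] of_nat_le_iff
      by (intro tail_count_le_sum_residue_parts[OF assms(1)]) auto
  qed auto
  also have "\<dots> \<le> (\<Sum>a<m. \<Sum>b<k. (\<Sum>c<k. (T c a)\<^sup>2) * real k)"
    by (intro sum_mono order_trans[OF sum_squared_le_sum_of_squares]) auto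
  also have "\<dots> = (real k)\<^sup>2 * (\<Sum>a<m. \<Sum>c<k. (T c a)\<^sup>2)"
    by (simp add: power2_eq_square sum_distrib_left mult_ac)
  also have "\<dots> = (real k)\<^sup>2 * (\<Sum>c<k. \<Sum>a<m. (T c a)\<^sup>2)" by (subst sum.swap) simp
  finally have "energy (m * k) S \<le> (real k)\<^sup>2 * (\<Sum>c<k. \<Sum>a<m. (T c a)\<^sup>2) / (real (m * k))\<^sup>2"
    unfolding energy_def by (rule divide_right_mono) simp
  also have "\<dots> = (\<Sum>b<k. energy m (residue_part k S b))"
    using assms by (simp add: energy_def T_def sum_divide_distrib[symmetric] power_mult_distrib)
  finally show ?thesis .
qed

lemma part_fun_submultiplicative:
  assumes "0 \<le> \<rho>" "0 \<le> \<beta>" "0 < m" "0 < k"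
  shows "part_fun (m * k) \<rho> \<beta> \<le> part_fun m \<rho> \<beta> ^ k"
proof -
  define w where "w S = \<rho> ^ card S * exp (\<beta> * energy m S)" for S
  define R where "R S = restrict (residue_part k S) {..<k}" for S
  have inj: "inj_on R (Pow {..<m * k})"
  proof (rule inj_onI)
    fix S T assume "R S = R T"
    have "i \<in> S \<longleftrightarrow> i \<in> T" for i
    proof -
      have "residue_part k S (i mod k) = residue_part k T (i mod k)"
        using fun_cong[OF \<open>R S = R T\<close>, of "i mod k"] assms(4) by (simp add: R_def)
      moreover have "i div k \<in> residue_part k S (i mod k) \<longleftrightarrow> i \<in> S" for S
        by (simp add: residue_part_def)
      ultimately show ?thesis by metis
    qed
    then show "S = T" by auto
  qed
  have "part_fun (m * k) \<rho> \<beta> \<le> (\<Sum>S\<in>Pow {..<m * k}. \<Prod>b<k. w (R S b))"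
    unfolding weight_sum_def
  proof (rule sum_mono)
    fix S assume "S \<in> Pow {..<m * k}"
    then have S: "S \<subseteq> {..<m * k}" by simp
    have "\<rho> ^ card S * exp (\<beta> * energy (m * k) S)
        \<le> \<rho> ^ card S * exp (\<beta> * (\<Sum>b<k. energy m (residue_part k S b)))"
      using energy_le_sum_residue_parts[OF S assms(3,4)] assms by (intro mult_left_mono) (auto intro: mult_left_mono)
    also have "\<dots> = (\<Prod>b<k. w (R S b))"
      by (simp add: w_def R_def prod.distrib card_eq_sum_residue_parts[OF S] power_sum exp_sum sum_distrib_left)
    finally show "\<rho> ^ card S * exp (\<beta> * energy (m * k) S) \<le> (\<Prod>b<k. w (R S b))" .
  qed
  also have "\<dots> = (\<Sum>g\<in>R ` Pow {..<m * k}. \<Prod>b<k. w (g b))"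
    by (simp add: sum.reindex[OF inj])
  also have "\<dots> \<le> (\<Sum>g\<in>PiE {..<k} (\<lambda>_. Pow {..<m}). \<Prod>b<k. w (g b))"
  proof (rule sum_mono2)
    show "R ` Pow {..<m * k} \<subseteq> PiE {..<k} (\<lambda>_. Pow {..<m})"
      using residue_part_subset[of _ m k] unfolding R_def by (intro image_subsetI restrict_PiE_iff[THEN iffD2]) blast
  qed (auto intro!: finite_PiE prod_nonneg simp: w_def assms)
  also have "\<dots> = (\<Prod>b<k. \<Sum>S\<in>Pow {..<m}. w S)"
    by (rule prod_sum_PiE[symmetric]) auto
  finally show ?thesis by (simp add: weight_sum_def w_def)
qed

text \<open>Placing the sites of a system of size \<open>n\<close> as the first \<open>n\<close> sites of a larger one
  only rescales the energy.\<close>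

lemma part_fun_le_larger_system:
  assumes "0 \<le> \<rho>" "0 \<le> \<beta>" "0 < n" "n \<le> n'"
  shows "part_fun n \<rho> \<beta> \<le> exp (real n' * (\<beta> * ((real n' / real n)\<^sup>2 - 1))) * part_fun n' \<rho> \<beta>"
proof -
  have "1 \<le> real n' / real n" using assms by simp
  then have ge: "0 \<le> (real n' / real n)\<^sup>2 - 1" by simp
  have "part_fun n \<rho> \<beta> \<le> weight_sum (Pow {..<n}) n' \<rho> (\<beta> * (real n' / real n)\<^sup>2)"
    unfolding weight_sum_def
  proof (intro sum_mono mult_left_mono)
    fix S assume "S \<in> Pow {..<n}"
    have "(\<Sum>l<n. (real (tail_count S l))\<^sup>2) \<le> (\<Sum>l<n'. (real (tail_count S l))\<^sup>2)"
      using assms by (intro sum_mono2) auto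
    then have "(real n)\<^sup>2 * energy n S \<le> (real n')\<^sup>2 * energy n' S"
      using assms by (simp add: energy_def)
    then have "energy n S \<le> (real n' / real n)\<^sup>2 * energy n' S"
      using assms by (simp add: field_simps)
    then show "exp (\<beta> * energy n S) \<le> exp (\<beta> * (real n' / real n)\<^sup>2 * energy n' S)"
      using assms mult_left_mono by (fastforce simp: mult.assoc)
  qed (use assms in auto)
  also have "\<dots> \<le> part_fun n' \<rho> (\<beta> + \<beta> * ((real n' / real n)\<^sup>2 - 1))"
    using weight_sum_mono_set[of \<rho> "Pow {..<n'}" "Pow {..<n}" n' "\<beta> * (real n' / real n)\<^sup>2"] assms
    by (auto simp: algebra_simps Pow_mono)
  also have "\<dots> \<le> exp (real n' * \<bar>\<beta> * ((real n' / real n)\<^sup>2 - 1)\<bar>) * part_fun n' \<rho> \<beta>"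
    by (rule weight_sum_shift_beta) (use assms in auto)
  finally show ?thesis using ge assms by simp
qed

definition log_part :: "nat \<Rightarrow> real \<Rightarrow> real \<Rightarrow> real" where
  "log_part n \<rho> \<beta> = ln (part_fun n \<rho> \<beta>) / real n"

definition pressure :: "real \<Rightarrow> real \<Rightarrow> real" where
  "pressure \<rho> \<beta> = lim (\<lambda>n. log_part n \<rho> \<beta>)"

lemma part_fun_pos: "0 \<le> \<rho> \<Longrightarrow> 0 < part_fun n \<rho> \<beta>"
  using part_fun_ge_1[of \<rho> n \<beta>] by linarith

lemma log_part_nonneg: "0 \<le> \<rho> \<Longrightarrow> 0 \<le> log_part n \<rho> \<beta>"
  using part_fun_ge_1[of \<rho> n \<beta>] by (simp add: log_part_def)

lemma part_fun_eq_exp_log_part: "0 \<le> \<rho> \<Longrightarrow> 0 < n \<Longrightarrow> part_fun n \<rho> \<beta> = exp (real n * log_part n \<rho> \<beta>)"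
  using part_fun_pos[of \<rho> n \<beta>] by (simp add: log_part_def)

text \<open>Enlarging \<open>n\<close> to the next multiple \<open>m k\<close> of \<open>m\<close> and splitting into \<open>k\<close> residue classes bounds
\<open>log_part n\<close> by \<open>log_part m\<close> as \<open>n\<close> grows; so the limit is the infimum over \<open>m\<close>.\<close>

lemma log_part_le_smaller_system:
  assumes "0 \<le> \<rho>" "0 \<le> \<beta>" "0 < m" "0 < n"
  defines "y \<equiv> 1 + real m / real n"
  shows "log_part n \<rho> \<beta> \<le> y * (\<beta> * (y\<^sup>2 - 1)) + y * log_part m \<rho> \<beta>"
proof -
  \<comment> \<open>\<open>m k\<close> is a multiple of \<open>m\<close> in \<open>{n..n + m}\<close>\<close>
  define k where "k = n div m + 1"
  define x where "x = real (m * k) / real n"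
  have le: "n \<le> m * k" and le': "m * k \<le> n + m"
    using mult_div_mod_eq[of m n] mod_less_divisor[OF assms(3), of n] unfolding k_def distrib_left by linarith+
  have "part_fun n \<rho> \<beta> \<le> exp (real (m * k) * (\<beta> * (x\<^sup>2 - 1))) * part_fun (m * k) \<rho> \<beta>"
    unfolding x_def by (rule part_fun_le_larger_system) (use assms le in auto)
  also have "\<dots> \<le> exp (real (m * k) * (\<beta> * (x\<^sup>2 - 1))) * part_fun m \<rho> \<beta> ^ k"
    using part_fun_submultiplicative[of \<rho> \<beta> m k] assms by (intro mult_left_mono) (auto simp: k_def)
  finally have "ln (part_fun n \<rho> \<beta>) \<le> ln (exp (real (m * k) * (\<beta> * (x\<^sup>2 - 1))) * part_fun m \<rho> \<beta> ^ k)"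
    using part_fun_pos[of \<rho>] assms by (subst ln_le_cancel_iff) auto
  also have "\<dots> = real (m * k) * (\<beta> * (x\<^sup>2 - 1)) + real k * ln (part_fun m \<rho> \<beta>)"
    using part_fun_pos[of \<rho> m \<beta>] assms by (simp add: ln_mult ln_realpow)
  finally have "log_part n \<rho> \<beta> \<le> x * (\<beta> * (x\<^sup>2 - 1)) + x * log_part m \<rho> \<beta>"
    using assms by (simp add: log_part_def x_def field_simps)
  moreover have x: "1 \<le> x" "x \<le> y"
  proof -
    have "real n \<le> real (m * k)" "real (m * k) \<le> real (n + m)"
      using le le' by (simp_all only: of_nat_le_iff)
    moreover have "y = real (n + m) / real n" using assms by (simp add: y_def add_divide_distrib)
    ultimately show "1 \<le> x" "x \<le> y" using assms unfolding x_def by (auto intro: divide_right_mono)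
  qed
  then have "x * (\<beta> * (x\<^sup>2 - 1)) \<le> y * (\<beta> * (y\<^sup>2 - 1))"
    using assms by (intro mult_mono power_mono diff_mono mult_nonneg_nonneg) auto
  moreover have "x * log_part m \<rho> \<beta> \<le> y * log_part m \<rho> \<beta>"
    using x log_part_nonneg[of \<rho> m \<beta>] assms by (intro mult_right_mono) auto
  ultimately show ?thesis by linarith
qed

lemma log_part_tendsto_pressure:
  assumes "0 \<le> \<rho>" "0 \<le> \<beta>"
  shows "(\<lambda>n. log_part n \<rho> \<beta>) \<longlonglongrightarrow> pressure \<rho> \<beta>"
proof -
  define L where "L = (INF m\<in>{0<..}. log_part m \<rho> \<beta>)"
  have bdd: "bdd_below ((\<lambda>m. log_part m \<rho> \<beta>) ` {0<..})"
    using log_part_nonneg[OF assms(1)] by (intro bdd_belowI2[of _ 0]) auto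
  have "(\<lambda>n. log_part n \<rho> \<beta>) \<longlonglongrightarrow> L"
  proof (rule order_tendstoI)
    fix a assume "a < L"
    show "\<forall>\<^sub>F n in sequentially. a < log_part n \<rho> \<beta>"
      using eventually_gt_at_top[of 0]
    proof eventually_elim
      case (elim n)
      then have "L \<le> log_part n \<rho> \<beta>" unfolding L_def by (intro cINF_lower bdd) auto
      then show ?case using \<open>a < L\<close> by linarith
    qed
  next
    fix a assume "L < a"
    then obtain m where m: "0 < m" "log_part m \<rho> \<beta> < a"
      unfolding L_def by (subst (asm) cINF_less_iff[OF _ bdd]) auto
    have "(\<lambda>n. (1 + real m / real n) * (\<beta> * ((1 + real m / real n)\<^sup>2 - 1))
        + (1 + real m / real n) * log_part m \<rho> \<beta>) \<longlonglongrightarrow> (1 + 0) * (\<beta> * ((1 + 0)\<^sup>2 - 1)) + (1 + 0) * log_part m \<rho> \<beta>"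
      by (intro tendsto_intros tendsto_divide_0[OF tendsto_const] filterlim_compose[OF tendsto_inverse_0_at_top]
          filterlim_at_top_imp_at_infinity filterlim_real_sequentially)
    then have "\<forall>\<^sub>F n in sequentially. (1 + real m / real n) * (\<beta> * ((1 + real m / real n)\<^sup>2 - 1))
        + (1 + real m / real n) * log_part m \<rho> \<beta> < a"
      by (rule order_tendstoD) (use m in simp)
    then show "\<forall>\<^sub>F n in sequentially. log_part n \<rho> \<beta> < a"
      using eventually_gt_at_top[of 0]
    proof eventually_elim
      case (elim n)
      then show ?case using log_part_le_smaller_system[OF assms m(1), of n] by linarith
    qed
  qed
  then show ?thesis unfolding pressure_def by (simp add: limI)
qed

section \<open>Monotonicity, Lipschitz bounds and convexity\<close>

lemma log_part_mono_rho: "0 \<le> \<rho> \<Longrightarrow> \<rho> \<le> \<rho>' \<Longrightarrow> log_part n \<rho> \<beta> \<le> log_part n \<rho>' \<beta>"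
  unfolding log_part_def
  by (intro divide_right_mono ln_mono weight_sum_mono_rho part_fun_pos) auto

lemma log_part_shift_beta:
  assumes "0 \<le> \<rho>" "0 < n" shows "log_part n \<rho> (\<beta> + t) \<le> log_part n \<rho> \<beta> + \<bar>t\<bar>"
proof -
  have "exp (real n * log_part n \<rho> (\<beta> + t)) \<le> exp (real n * (log_part n \<rho> \<beta> + \<bar>t\<bar>))"
    using weight_sum_shift_beta[of "Pow {..<n}" n \<rho> \<beta> t] assms
    by (simp add: part_fun_eq_exp_log_part exp_add[symmetric] algebra_simps)
  then show ?thesis using assms by simp
qed

lemma log_part_shift_rho:
  assumes "0 \<le> \<rho>" "0 \<le> s" "0 < n" shows "log_part n (exp s * \<rho>) \<beta> \<le> log_part n \<rho> \<beta> + s"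
proof -
  have "exp (real n * log_part n (exp s * \<rho>) \<beta>) \<le> exp (real n * (log_part n \<rho> \<beta> + s))"
    using part_fun_shift_rho[of \<rho> s n \<beta>] assms
    by (simp add: part_fun_eq_exp_log_part exp_add[symmetric] algebra_simps)
  then show ?thesis using assms by simp
qed

lemma eventually_pos_nat: "(\<And>n. 0 < n \<Longrightarrow> P n) \<Longrightarrow> \<forall>\<^sub>F n::nat in sequentially. P n"
  using eventually_gt_at_top[of 0] by (rule eventually_mono) auto

lemma pressure_mono_rho: "0 \<le> \<rho> \<Longrightarrow> 0 \<le> \<beta> \<Longrightarrow> \<rho> \<le> \<rho>' \<Longrightarrow> pressure \<rho> \<beta> \<le> pressure \<rho>' \<beta>"
  by (rule LIMSEQ_le[OF log_part_tendsto_pressure log_part_tendsto_pressure])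
    (auto intro: log_part_mono_rho)

lemma pressure_shift_beta:
  assumes "0 \<le> \<rho>" "0 \<le> \<beta>" "0 \<le> \<beta> + t" shows "pressure \<rho> (\<beta> + t) \<le> pressure \<rho> \<beta> + \<bar>t\<bar>"
  by (rule tendsto_le[OF trivial_limit_sequentially
      tendsto_add[OF log_part_tendsto_pressure tendsto_const] log_part_tendsto_pressure])
    (use assms in \<open>auto intro!: eventually_pos_nat log_part_shift_beta\<close>)

lemma pressure_shift_rho:
  assumes "0 \<le> \<rho>" "0 \<le> \<beta>" "0 \<le> s" shows "pressure (exp s * \<rho>) \<beta> \<le> pressure \<rho> \<beta> + s"
  by (rule tendsto_le[OF trivial_limit_sequentially
      tendsto_add[OF log_part_tendsto_pressure tendsto_const] log_part_tendsto_pressure])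
    (use assms in \<open>auto intro!: eventually_pos_nat log_part_shift_rho\<close>)

lemma abs_pressure_diff_le:
  assumes "0 < \<rho>" "0 < \<rho>'" "0 \<le> \<beta>" "0 \<le> \<beta>'"
  shows "\<bar>pressure \<rho>' \<beta>' - pressure \<rho> \<beta>\<bar> \<le> \<bar>ln \<rho>' - ln \<rho>\<bar> + \<bar>\<beta>' - \<beta>\<bar>"
proof -
  have *: "pressure \<rho>' \<beta>' \<le> pressure \<rho> \<beta> + \<bar>ln \<rho>' - ln \<rho>\<bar> + \<bar>\<beta>' - \<beta>\<bar>"
    if "0 < \<rho>" "0 < \<rho>'" "0 \<le> \<beta>" "0 \<le> \<beta>'" for \<rho> \<rho>' \<beta> \<beta>'
  proof -
    define s where "s = \<bar>ln \<rho>' - ln \<rho>\<bar>"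
    have "\<rho>' = exp (ln \<rho>' - ln \<rho>) * \<rho>" using that by (simp add: exp_diff)
    also have "\<dots> \<le> exp s * \<rho>" using that by (simp add: s_def)
    finally have "pressure \<rho>' \<beta>' \<le> pressure (exp s * \<rho>) \<beta>'"
      using that by (intro pressure_mono_rho) auto
    also have "\<dots> \<le> pressure \<rho> \<beta>' + s" using that by (intro pressure_shift_rho) (auto simp: s_def)
    also have "pressure \<rho> \<beta>' \<le> pressure \<rho> \<beta> + \<bar>\<beta>' - \<beta>\<bar>"
      using pressure_shift_beta[of \<rho> \<beta> "\<beta>' - \<beta>"] that by auto
    finally show ?thesis by (simp add: s_def)
  qed
  from *[of \<rho> \<rho>' \<beta> \<beta>'] *[of \<rho>' \<rho> \<beta>' \<beta>] assms show ?thesis by (simp add: abs_minus_commute)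
qed

lemma isCont_pressure:
  assumes "0 < fst p" "0 < snd p"
  shows "isCont (\<lambda>(\<rho>, \<beta>). pressure \<rho> \<beta>) p"
  unfolding isCont_def
proof (rule Lim_null_comparison[THEN LIM_zero_cancel])
  have "\<forall>\<^sub>F q in at p. 0 < fst q" "\<forall>\<^sub>F q in at p. 0 < snd q"
    using order_tendstoD(1)[OF tendsto_fst[OF tendsto_ident_at] assms(1)]
      order_tendstoD(1)[OF tendsto_snd[OF tendsto_ident_at] assms(2)] by auto
  then show "\<forall>\<^sub>F q in at p. norm ((case q of (\<rho>, \<beta>) \<Rightarrow> pressure \<rho> \<beta>) - (case p of (\<rho>, \<beta>) \<Rightarrow> pressure \<rho> \<beta>))
      \<le> \<bar>ln (fst q) - ln (fst p)\<bar> + \<bar>snd q - snd p\<bar>"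
    by eventually_elim (use assms in \<open>auto simp: case_prod_beta intro!: abs_pressure_diff_le\<close>)
  have "((\<lambda>q. \<bar>ln (fst q) - ln (fst p)\<bar> + \<bar>snd q - snd p\<bar>) \<longlongrightarrow> \<bar>ln (fst p) - ln (fst p)\<bar> + \<bar>snd p - snd p\<bar>) (at p)"
    using assms by (intro tendsto_intros) auto
  then show "((\<lambda>q. \<bar>ln (fst q) - ln (fst p)\<bar> + \<bar>snd q - snd p\<bar>) \<longlongrightarrow> 0) (at p)" by simp
qed

text \<open>Convexity in \<open>ln \<rho>\<close> is Hoelder's inequality for the sum over configurations; normalising the weights
reduces it to convexity of the exponential function in each term.\<close>

lemma log_part_convex:
  assumes "0 \<le> t" "t \<le> 1"
  shows "log_part n (exp ((1 - t) * u + t * v)) \<beta> \<le> (1 - t) * log_part n (exp u) \<beta> + t * log_part n (exp v) \<beta>"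
proof -
  define a where "a u = ln (part_fun n (exp u) \<beta>)" for u
  define x where "x u S = real (card S) * u + \<beta> * energy n S - a u" for u S
  have part: "(\<Sum>S\<in>Pow {..<n}. exp (real (card S) * u + \<beta> * energy n S)) = part_fun n (exp u) \<beta>" for u
    by (simp add: weight_sum_def exp_add exp_of_nat_mult)
  have one: "(\<Sum>S\<in>Pow {..<n}. exp (x u S)) = 1" for u
    using part_fun_pos[of "exp u" n \<beta>]
    by (simp add: x_def exp_diff a_def sum_divide_distrib[symmetric] part)
  have "part_fun n (exp ((1 - t) * u + t * v)) \<beta> / exp ((1 - t) * a u + t * a v)
      = (\<Sum>S\<in>Pow {..<n}. exp ((1 - t) * x u S + t * x v S))"
    unfolding part[symmetric] sum_divide_distrib
    by (intro sum.cong refl) (simp add: x_def exp_diff[symmetric] algebra_simps)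
  also have "\<dots> \<le> (\<Sum>S\<in>Pow {..<n}. (1 - t) * exp (x u S) + t * exp (x v S))"
    using assms by (intro sum_mono convex_onD[OF exp_convex, simplified]) auto
  also have "\<dots> = 1" by (simp add: sum.distrib sum_distrib_left[symmetric] one)
  finally have "part_fun n (exp ((1 - t) * u + t * v)) \<beta> \<le> exp ((1 - t) * a u + t * a v)"
    by (simp add: divide_le_eq)
  then have "a ((1 - t) * u + t * v) \<le> (1 - t) * a u + t * a v"
    unfolding a_def using part_fun_pos[of "exp ((1 - t) * u + t * v)" n \<beta>] 
    by (metis exp_ge_zero ln_exp ln_mono)
  then show ?thesis unfolding log_part_def a_def 
    by (simp add: add_divide_distrib[symmetric] divide_right_mono)
qed

lemma pressure_convex:
  assumes "0 \<le> \<beta>"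
  shows "convex_on UNIV (\<lambda>u. pressure (exp u) \<beta>)"
proof (rule convex_onI)
  fix t u v :: real assume t: "0 < t" "t < 1"
  show "pressure (exp ((1 - t) *\<^sub>R u + t *\<^sub>R v)) \<beta> \<le> (1 - t) * pressure (exp u) \<beta> + t * pressure (exp v) \<beta>"
    by (rule LIMSEQ_le[OF log_part_tendsto_pressure
          tendsto_add[OF tendsto_mult[OF tendsto_const log_part_tendsto_pressure]
             tendsto_mult[OF tendsto_const log_part_tendsto_pressure]]])
      (use assms t log_part_convex[of t _ u v \<beta>] in auto)
qed simp

section \<open>The Lyapunov exponent as a pressure\<close>

text \<open>Completing the square in the exponent gives a normal density shifted by \<open>\<theta> s\<^sup>2\<close>.\<close>

lemma normal_exponential_moment:
  assumes "prob_space M" "distributed M lborel X (normal_density 0 s)" "0 < s"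
  shows "integrable M (\<lambda>\<omega>. exp (\<theta> * X \<omega>))"
    and "integral\<^sup>L M (\<lambda>\<omega>. exp (\<theta> * X \<omega>)) = exp (\<theta>\<^sup>2 * s\<^sup>2 / 2)"
proof -
  have eq: "normal_density 0 s x * exp (\<theta> * x) = exp (\<theta>\<^sup>2 * s\<^sup>2 / 2) * normal_density (\<theta> * s\<^sup>2) s x" for x
  proof -
    have "- x\<^sup>2 / (2 * s\<^sup>2) + \<theta> * x = \<theta>\<^sup>2 * s\<^sup>2 / 2 + - (x - \<theta> * s\<^sup>2)\<^sup>2 / (2 * s\<^sup>2)"
      using assms(3) by (simp add: field_simps power2_eq_square)
    then have "exp (- x\<^sup>2 / (2 * s\<^sup>2)) * exp (\<theta> * x) = exp (\<theta>\<^sup>2 * s\<^sup>2 / 2) * exp (- (x - \<theta> * s\<^sup>2)\<^sup>2 / (2 * s\<^sup>2))"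
      by (simp only: exp_add[symmetric])
    then show ?thesis by (simp add: normal_density_def)
  qed
  have "integrable lborel (\<lambda>x. normal_density 0 s x * exp (\<theta> * x))"
    unfolding eq using assms(3) by (intro integrable_mult_right integrable_normal_density)
  then show "integrable M (\<lambda>\<omega>. exp (\<theta> * X \<omega>))"
    using distributed_integrable[OF assms(2), of "\<lambda>x. exp (\<theta> * x)"] by simp
  have "integral\<^sup>L M (\<lambda>\<omega>. exp (\<theta> * X \<omega>)) = (\<integral>x. normal_density 0 s x * exp (\<theta> * x) \<partial>lborel)"
    using distributed_integral[OF assms(2), of "\<lambda>x. exp (\<theta> * x)"] by simp
  also have "\<dots> = exp (\<theta>\<^sup>2 * s\<^sup>2 / 2)" unfolding eq using assms(3) by simp
  finally show "integral\<^sup>L M (\<lambda>\<omega>. exp (\<theta> * X \<omega>)) = exp (\<theta>\<^sup>2 * s\<^sup>2 / 2)" .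
qed

lemma sum_increments:
  fixes x :: "nat \<Rightarrow> real"
  assumes "S \<subseteq> {..<n}" "x 0 = 0"
  shows "(\<Sum>i\<in>S. x i) = (\<Sum>l<n. real (tail_count S (Suc l)) * (x (Suc l) - x l))"
proof -
  have fin: "finite S" using assms finite_subset by blast
  have "(\<Sum>i\<in>S. x i) = (\<Sum>i\<in>S. \<Sum>l<n. if Suc l \<le> i then x (Suc l) - x l else 0)"
  proof (rule sum.cong)
    fix i assume "i \<in> S"
    then have "{l \<in> {..<n}. Suc l \<le> i} = {..<i}" using assms(1) by auto
    then show "x i = (\<Sum>l<n. if Suc l \<le> i then x (Suc l) - x l else 0)"
      using sum_lessThan_telescope[of x i] assms(2) by (simp add: sum.If_cases Int_def)
  qed simp
  also have "\<dots> = (\<Sum>l<n. \<Sum>i\<in>S. if Suc l \<le> i then x (Suc l) - x l else 0)" by (rule sum.swap)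
  also have "\<dots> = (\<Sum>l<n. real (tail_count S (Suc l)) * (x (Suc l) - x l))"
    unfolding sum_indicator_tail_count[OF fin] by (simp add: mult.commute)
  finally show ?thesis .
qed

text \<open>For a set \<open>S\<close> of times, the increment of the Brownian motion over the \<open>l\<close>-th step is shared by all
  later times in \<open>S\<close>; independence of the increments turns this into the squares of the tail counts.\<close>

lemma brownian_product_moment:
  fixes \<sigma> \<tau> :: real
  assumes "standard_brownian_motion M W" "0 < \<tau>" "S \<subseteq> {..<n}"
  defines "g \<equiv> \<lambda>\<omega>. \<Prod>i\<in>S. exp (\<sigma> * W (real i * \<tau>) \<omega> - \<sigma>\<^sup>2 * (real i * \<tau>) / 2)"
  shows "integrable M g"
    and "integral\<^sup>L M g = exp (\<sigma>\<^sup>2 * \<tau> / 2 * ((\<Sum>l<n. (real (tail_count S (Suc l)))\<^sup>2) - (\<Sum>i\<in>S. real i)))"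
proof -
  have bm: "prob_space M" "\<And>t. 0 \<le> t \<Longrightarrow> W t \<in> borel_measurable M" "AE \<omega> in M. W 0 \<omega> = 0"
    "\<And>s t. 0 \<le> s \<Longrightarrow> s < t \<Longrightarrow> distributed M lborel (\<lambda>\<omega>. W t \<omega> - W s \<omega>) (normal_density 0 (sqrt (t - s)))"
    "\<And>(n::nat) t. 0 \<le> t 0 \<Longrightarrow> (\<And>i. i < n \<Longrightarrow> t i < t (Suc i)) \<Longrightarrow>
      prob_space.indep_vars M (\<lambda>_. borel) (\<lambda>i \<omega>. W (t (Suc i)) \<omega> - W (t i) \<omega>) {..<n}"
    using assms(1) unfolding standard_brownian_motion_def by auto
  interpret prob_space M by (rule bm(1))
  define X where "X l \<omega> = W (real (Suc l) * \<tau>) \<omega> - W (real l * \<tau>) \<omega>" for l \<omega>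
  define \<theta> where "\<theta> l = \<sigma> * real (tail_count S (Suc l))" for l
  define C where "C = exp (- (\<sigma>\<^sup>2 * \<tau> / 2 * (\<Sum>i\<in>S. real i)))"
  have fin: "finite S" using assms(3) finite_subset by blast
  have X_dist: "distributed M lborel (X l) (normal_density 0 (sqrt \<tau>))" for l
    using bm(4)[of "real l * \<tau>" "real (Suc l) * \<tau>"] assms(2)
    by (simp add: X_def[abs_def] left_diff_distrib[symmetric])
  note mgf = normal_exponential_moment[OF bm(1) X_dist real_sqrt_gt_zero[OF assms(2)]]
  have "indep_vars (\<lambda>_. borel) X {..<n}"
    using bm(5)[of "\<lambda>i. real i * \<tau>" n] assms(2) by (simp add: X_def[abs_def])
  then have ind: "indep_vars (\<lambda>_. borel) (\<lambda>l \<omega>. exp (\<theta> l * X l \<omega>)) {..<n}"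
    by (rule indep_vars_compose2) auto
  have W_meas[measurable]: "W (real i * \<tau>) \<in> borel_measurable M" for i
    using bm(2) assms(2) by simp
  have g_meas: "g \<in> borel_measurable M" unfolding g_def by measurable
  have prod_int: "integrable M (\<lambda>\<omega>. \<Prod>l<n. exp (\<theta> l * X l \<omega>))"
    by (rule indep_vars_integrable[OF _ ind]) (auto intro: mgf)
  have AE_eq: "AE \<omega> in M. g \<omega> = C * (\<Prod>l<n. exp (\<theta> l * X l \<omega>))"
    using bm(3)
  proof eventually_elim
    case (elim \<omega>)
    have "(\<Sum>i\<in>S. W (real i * \<tau>) \<omega>) = (\<Sum>l<n. real (tail_count S (Suc l)) * X l \<omega>)"
      unfolding X_def using elim by (intro sum_increments assms(3)) simp
    then have "(\<Sum>i\<in>S. \<sigma> * W (real i * \<tau>) \<omega> - \<sigma>\<^sup>2 * (real i * \<tau>) / 2)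
        = - (\<sigma>\<^sup>2 * \<tau> / 2 * (\<Sum>i\<in>S. real i)) + (\<Sum>l<n. \<theta> l * X l \<omega>)"
      by (simp add: sum_subtractf sum_distrib_left[symmetric] sum_divide_distrib[symmetric] \<theta>_def
          mult.assoc sum_distrib_right[symmetric] mult.commute[of \<tau>])
    then show ?case
      by (simp only: g_def C_def exp_sum[OF fin, symmetric] exp_sum[OF finite_lessThan, symmetric] exp_add[symmetric])
  qed
  show "integrable M g"
    by (subst integrable_cong_AE[OF g_meas _ AE_eq])
      (use prod_int in \<open>auto intro: borel_measurable_integrable\<close>)
  have "integral\<^sup>L M g = (\<integral>\<omega>. C * (\<Prod>l<n. exp (\<theta> l * X l \<omega>)) \<partial>M)"
    by (rule integral_cong_AE[OF g_meas _ AE_eq])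
      (use borel_measurable_integrable[OF prod_int] in measurable)
  also have "\<dots> = C * (\<Prod>l<n. \<integral>\<omega>. exp (\<theta> l * X l \<omega>) \<partial>M)"
    by (subst integral_mult_right_zero, subst indep_vars_lebesgue_integral[OF _ ind]) (auto intro: mgf)
  also have "\<dots> = C * exp (\<Sum>l<n. (\<theta> l)\<^sup>2 * \<tau> / 2)"
    using assms(2) by (simp add: mgf exp_sum)
  also have "\<dots> = exp (\<sigma>\<^sup>2 * \<tau> / 2 * ((\<Sum>l<n. (real (tail_count S (Suc l)))\<^sup>2) - (\<Sum>i\<in>S. real i)))"
  proof -
    have "(\<Sum>l<n. (\<theta> l)\<^sup>2 * \<tau> / 2) = \<sigma>\<^sup>2 * \<tau> / 2 * (\<Sum>l<n. (real (tail_count S (Suc l)))\<^sup>2)"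
      unfolding sum_distrib_left by (intro sum.cong refl) (simp add: \<theta>_def power_mult_distrib)
    then show ?thesis by (simp only: C_def exp_add[symmetric] right_diff_distrib) simp
  qed
  finally show "integral\<^sup>L M g = exp (\<sigma>\<^sup>2 * \<tau> / 2 * ((\<Sum>l<n. (real (tail_count S (Suc l)))\<^sup>2) - (\<Sum>i\<in>S. real i)))" .
qed

lemma sum_Pow_prod: "finite A \<Longrightarrow> (\<Sum>S\<in>Pow A. \<Prod>i\<in>S. f i) = (\<Prod>i\<in>A. 1 + f i)"
  for f :: "'i \<Rightarrow> 'b::comm_semiring_1"
  using prod_add[of A f "\<lambda>_. 1"] by (simp add: add.commute)

lemma mult_process_eq_prod:
  "mult_process W x0 \<rho> \<sigma> \<tau> n \<omega> = x0 * (\<Prod>i<n. mult_factor W \<rho> \<sigma> \<tau> i \<omega>)"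
  by (induction n) (auto simp: mult_ac)

lemma mult_process_eq_sum:
  "mult_process W x0 \<rho> \<sigma> \<tau> n = (\<lambda>\<omega>. x0 * (\<Sum>S\<in>Pow {..<n}. \<rho> ^ card S *
     (\<Prod>i\<in>S. exp (\<sigma> * W (real i * \<tau>) \<omega> - \<sigma>\<^sup>2 * (real i * \<tau>) / 2))))"
  by (rule ext) (simp add: mult_process_eq_prod mult_factor_def Let_def sum_Pow_prod[symmetric] prod.distrib)

text \<open>The tail counts entering the expectation start at the second site, and each time carries the
  compensator \<open>- \<sigma>\<^sup>2 t / 2\<close>; this lowers \<open>energy\<close> by at most two.\<close>

lemma expectation_mult_process_bounds:
  assumes "standard_brownian_motion M W" "0 < x0" "0 < \<rho>" "0 < \<beta>" "0 < n" "0 < \<tau>"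
    and "1 / 2 * \<sigma>\<^sup>2 * \<tau> * (real n)\<^sup>2 = \<beta>"
  shows "x0 * exp (- (2 * \<beta>)) * part_fun n \<rho> \<beta> \<le> integral\<^sup>L M (mult_process W x0 \<rho> \<sigma> \<tau> n)"
    and "integral\<^sup>L M (mult_process W x0 \<rho> \<sigma> \<tau> n) \<le> x0 * part_fun n \<rho> \<beta>"
proof -
  define E where "E S = exp (\<sigma>\<^sup>2 * \<tau> / 2 * ((\<Sum>l<n. (real (tail_count S (Suc l)))\<^sup>2) - (\<Sum>i\<in>S. real i)))" for S
  note moment = brownian_product_moment[OF assms(1,6)]
  have "integral\<^sup>L M (mult_process W x0 \<rho> \<sigma> \<tau> n) = x0 * (\<Sum>S\<in>Pow {..<n}. \<rho> ^ card S * E S)"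
    unfolding mult_process_eq_sum E_def
    by (subst integral_mult_right_zero, subst Bochner_Integration.integral_sum) (auto intro!: integrable_mult_right moment sum.cong simp: moment(2))
  moreover have E: "exp (- (2 * \<beta>)) * exp (\<beta> * energy n S) \<le> E S" "E S \<le> exp (\<beta> * energy n S)"
    if S: "S \<subseteq> {..<n}" for S
  proof -
    have fin: "finite S" using S finite_subset by blast
    have "{i \<in> S. n \<le> i} = {}" using S by auto
    then have n0: "tail_count S n = 0" unfolding tail_count_def by (simp only: card.empty)
    define R where "R = (real (card S))\<^sup>2 + (\<Sum>i\<in>S. real i)"
    have "(\<Sum>l<n. (real (tail_count S l))\<^sup>2) = (\<Sum>l<Suc n. (real (tail_count S l))\<^sup>2)"
      by (simp add: n0)
    also have "\<dots> = (real (card S))\<^sup>2 + (\<Sum>l<n. (real (tail_count S (Suc l)))\<^sup>2)"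
      by (subst sum.lessThan_Suc_shift) (simp add: tail_count_def)
    finally have "(\<Sum>l<n. (real (tail_count S (Suc l)))\<^sup>2) - (\<Sum>i\<in>S. real i)
        = (\<Sum>l<n. (real (tail_count S l))\<^sup>2) - R" by (simp add: R_def)
    moreover have "\<sigma>\<^sup>2 * \<tau> / 2 = \<beta> / (real n)\<^sup>2" using assms(5,7) by (simp add: field_simps)
    ultimately have ES: "E S = exp (\<beta> * energy n S - \<beta> * (R / (real n)\<^sup>2))"
      by (simp add: E_def energy_def diff_divide_distrib right_diff_distrib)
    have "(\<Sum>i\<in>S. real i) \<le> (\<Sum>i\<in>S. real n)" using S by (intro sum_mono) auto
    also have "\<dots> \<le> real n * real n"
      using card_le_of_subset_lessThan[OF S] by (auto intro!: mult_right_mono)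
    finally have "(\<Sum>i\<in>S. real i) \<le> (real n)\<^sup>2" by (simp add: power2_eq_square)
    moreover have "(real (card S))\<^sup>2 \<le> (real n)\<^sup>2"
      using card_le_of_subset_lessThan[OF S] by (intro power_mono) auto
    ultimately have "R \<le> 2 * (real n)\<^sup>2" unfolding R_def by linarith
    moreover have "0 \<le> R" by (simp add: R_def sum_nonneg)
    ultimately have "0 \<le> R / (real n)\<^sup>2" "R / (real n)\<^sup>2 \<le> 2"
      using assms(5) by (auto simp: divide_le_eq)
    then have "0 \<le> \<beta> * (R / (real n)\<^sup>2)" "\<beta> * (R / (real n)\<^sup>2) \<le> \<beta> * 2"
      using assms(4) by (auto simp del: times_divide_eq_right intro!: mult_left_mono mult_nonneg_nonneg)
    then show "exp (- (2 * \<beta>)) * exp (\<beta> * energy n S) \<le> E S" "E S \<le> exp (\<beta> * energy n S)"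
      unfolding ES exp_add[symmetric] by auto
  qed
  moreover have "exp (- (2 * \<beta>)) * part_fun n \<rho> \<beta> \<le> (\<Sum>S\<in>Pow {..<n}. \<rho> ^ card S * E S)"
    unfolding weight_sum_def sum_distrib_left
  proof (rule sum_mono)
    fix S assume "S \<in> Pow {..<n}"
    then show "exp (- (2 * \<beta>)) * (\<rho> ^ card S * exp (\<beta> * energy n S)) \<le> \<rho> ^ card S * E S"
      using mult_left_mono[OF E(1), of S "\<rho> ^ card S"] assms(3) by (simp add: mult.left_commute)
  qed
  moreover have "(\<Sum>S\<in>Pow {..<n}. \<rho> ^ card S * E S) \<le> part_fun n \<rho> \<beta>"
    unfolding weight_sum_def using E(2) assms(3) by (intro sum_mono mult_left_mono) auto
  ultimately show "x0 * exp (- (2 * \<beta>)) * part_fun n \<rho> \<beta> \<le> integral\<^sup>L M (mult_process W x0 \<rho> \<sigma> \<tau> n)"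
    "integral\<^sup>L M (mult_process W x0 \<rho> \<sigma> \<tau> n) \<le> x0 * part_fun n \<rho> \<beta>"
    using assms(2) by (auto simp: mult.assoc)
qed

lemma lyapunov_exponent_eq_pressure:
  assumes "standard_brownian_motion M W" "0 < x0" "0 < \<rho>" "0 < \<beta>"
    and "\<And>\<beta> n. \<beta> > 0 \<Longrightarrow> n \<ge> 1 \<Longrightarrow>
           \<sigma> \<beta> n > 0 \<and> \<tau> \<beta> n > 0 \<and> 1/2 * (\<sigma> \<beta> n)\<^sup>2 * \<tau> \<beta> n * (real n)\<^sup>2 = \<beta>"
  shows "lyapunov_exponent M W x0 \<sigma> \<tau> \<rho> \<beta> = pressure \<rho> \<beta>"
proof -
  define Z where "Z n = integral\<^sup>L M (mult_process W x0 \<rho> (\<sigma> \<beta> n) (\<tau> \<beta> n) n)" for n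
  have lim: "(\<lambda>n. log_part n \<rho> \<beta>) \<longlonglongrightarrow> pressure \<rho> \<beta>"
    by (rule log_part_tendsto_pressure) (use assms in auto)
  have null: "(\<lambda>n. c / real n) \<longlonglongrightarrow> 0" for c :: real
    by (rule lim_const_over_n)
  have lower: "(\<lambda>n. (ln x0 - 2 * \<beta>) / real n + log_part n \<rho> \<beta>) \<longlonglongrightarrow> pressure \<rho> \<beta>"
    using tendsto_add[OF null lim] by simp
  have upper: "(\<lambda>n. ln x0 / real n + log_part n \<rho> \<beta>) \<longlonglongrightarrow> pressure \<rho> \<beta>"
    using tendsto_add[OF null lim] by simp
  have bounds: "(ln x0 - 2 * \<beta>) / real n + log_part n \<rho> \<beta> \<le> ln (Z n) / real n
      \<and> ln (Z n) / real n \<le> ln x0 / real n + log_part n \<rho> \<beta>" if n: "0 < n" for n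
  proof -
    have G: "0 < part_fun n \<rho> \<beta>" using assms by (intro part_fun_pos) auto
    have Z: "x0 * exp (- (2 * \<beta>)) * part_fun n \<rho> \<beta> \<le> Z n" "Z n \<le> x0 * part_fun n \<rho> \<beta>"
      unfolding Z_def using assms(5)[OF assms(4), of n] n
      by (auto intro!: expectation_mult_process_bounds[OF assms(1-4)])
    have low: "0 < x0 * exp (- (2 * \<beta>)) * part_fun n \<rho> \<beta>" using G assms by simp
    then have "0 < Z n" using Z by linarith
    have "ln (x0 * exp (- (2 * \<beta>)) * part_fun n \<rho> \<beta>) \<le> ln (Z n)" by (rule ln_mono[OF Z(1) low])
    moreover have "ln (Z n) \<le> ln (x0 * part_fun n \<rho> \<beta>)" by (rule ln_mono[OF Z(2) \<open>0 < Z n\<close>])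
    ultimately have "ln x0 - 2 * \<beta> + ln (part_fun n \<rho> \<beta>) \<le> ln (Z n)" "ln (Z n) \<le> ln x0 + ln (part_fun n \<rho> \<beta>)"
      using G assms(2) by (auto simp: ln_mult)
    then show ?thesis
      unfolding log_part_def add_divide_distrib[symmetric] by (auto intro: divide_right_mono)
  qed
  have "(\<lambda>n. ln (Z n) / real n) \<longlonglongrightarrow> pressure \<rho> \<beta>"
    by (rule tendsto_sandwich[OF _ _ lower upper]) (use bounds in \<open>auto intro: eventually_pos_nat\<close>)
  then show ?thesis unfolding lyapunov_exponent_def Z_def by (rule limI)
qed

section \<open>Mean-field bounds at low density\<close>

definition tail_sum :: "nat \<Rightarrow> (nat \<Rightarrow> real) \<Rightarrow> nat \<Rightarrow> real" where
  "tail_sum n d l = (\<Sum>j\<in>{l..<n}. d j)"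

definition mf_field :: "nat \<Rightarrow> real \<Rightarrow> (nat \<Rightarrow> real) \<Rightarrow> nat \<Rightarrow> real" where
  "mf_field n \<beta> c i = 2 * \<beta> / (real n)\<^sup>2 * (\<Sum>l\<le>i. c l)"

text \<open>The trial free energy of independent sites in the field generated by an arbitrary tail profile \<open>c\<close>:
the logarithm of their partition function, corrected for counting the interaction twice.\<close>

definition mf_value :: "nat \<Rightarrow> real \<Rightarrow> real \<Rightarrow> (nat \<Rightarrow> real) \<Rightarrow> real" where
  "mf_value n \<rho> \<beta> c =
     (\<Sum>i<n. ln (1 + \<rho> * exp (mf_field n \<beta> c i))) - \<beta> / (real n)\<^sup>2 * (\<Sum>l<n. (c l)\<^sup>2)"

lemma sum_mf_field:
  assumes "S \<subseteq> {..<n}"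
  shows "(\<Sum>i\<in>S. mf_field n \<beta> c i) = 2 * \<beta> / (real n)\<^sup>2 * (\<Sum>l<n. c l * real (tail_count S l))"
proof -
  have fin: "finite S" using assms finite_subset by blast
  have "(\<Sum>i\<in>S. \<Sum>l\<le>i. c l) = (\<Sum>i\<in>S. \<Sum>l<n. if l \<le> i then c l else 0)"
  proof (rule sum.cong)
    fix i assume "i \<in> S"
    then have "{..i} = {l \<in> {..<n}. l \<le> i}" using assms by auto
    then show "(\<Sum>l\<le>i. c l) = (\<Sum>l<n. if l \<le> i then c l else 0)"
      by (simp add: sum.If_cases Int_def)
  qed simp
  also have "\<dots> = (\<Sum>l<n. \<Sum>i\<in>S. if l \<le> i then c l else 0)" by (rule sum.swap)
  also have "\<dots> = (\<Sum>l<n. c l * real (tail_count S l))"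
    by (simp add: sum_indicator_tail_count[OF fin])
  finally show ?thesis unfolding mf_field_def by (subst sum_distrib_left[symmetric]) simp
qed

text \<open>Completing the square: relative to independent sites feeling the field of \<open>c\<close>, the weight of
  a configuration is tilted by the squared fluctuation of its tails around \<open>c\<close>.\<close>

lemma weight_eq_mean_field:
  assumes "S \<subseteq> {..<n}"
  shows "\<rho> ^ card S * exp (\<beta> * energy n S) =
    exp (- (\<beta> / (real n)\<^sup>2 * (\<Sum>l<n. (c l)\<^sup>2))) * (\<Prod>i\<in>S. \<rho> * exp (mf_field n \<beta> c i)) *
    exp (\<beta> / (real n)\<^sup>2 * (\<Sum>l<n. (real (tail_count S l) - c l)\<^sup>2))"
proof -
  have "finite S" using assms finite_subset by blast
  then have "(\<Prod>i\<in>S. \<rho> * exp (mf_field n \<beta> c i)) = \<rho> ^ card S * exp (\<Sum>i\<in>S. mf_field n \<beta> c i)"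
    by (simp add: prod.distrib exp_sum)
  moreover have "\<beta> * energy n S = - (\<beta> / (real n)\<^sup>2 * (\<Sum>l<n. (c l)\<^sup>2)) + (\<Sum>i\<in>S. mf_field n \<beta> c i)
      + \<beta> / (real n)\<^sup>2 * (\<Sum>l<n. (real (tail_count S l) - c l)\<^sup>2)"
  proof -
    have "(\<Sum>l<n. (real (tail_count S l) - c l)\<^sup>2)
        = (\<Sum>l<n. (real (tail_count S l))\<^sup>2) - 2 * (\<Sum>l<n. c l * real (tail_count S l)) + (\<Sum>l<n. (c l)\<^sup>2)"
      by (simp add: power2_diff sum.distrib sum_subtractf sum_distrib_left mult_ac)
    then show ?thesis
      unfolding sum_mf_field[OF assms] energy_def
      by (simp only:) (simp add: algebra_simps add_divide_distrib diff_divide_distrib)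
  qed
  ultimately show ?thesis by (simp only: exp_add mult_ac)
qed

lemma exp_mf_value:
  assumes "0 \<le> \<rho>"
  shows "exp (mf_value n \<rho> \<beta> c) =
    exp (- (\<beta> / (real n)\<^sup>2 * (\<Sum>l<n. (c l)\<^sup>2))) * (\<Prod>i<n. 1 + \<rho> * exp (mf_field n \<beta> c i))"
proof -
  have "0 < 1 + \<rho> * exp (mf_field n \<beta> c i)" for i using assms by (simp add: add_pos_nonneg)
  then show ?thesis by (simp add: mf_value_def exp_diff exp_sum exp_minus field_simps)
qed

text \<open>Dropping the squared fluctuations only decreases the weights, so every profile gives a lower bound.\<close>

lemma exp_mf_value_le_part_fun:
  assumes "0 \<le> \<rho>" "0 \<le> \<beta>"
  shows "exp (mf_value n \<rho> \<beta> c) \<le> part_fun n \<rho> \<beta>"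
proof -
  let ?C = "exp (- (\<beta> / (real n)\<^sup>2 * (\<Sum>l<n. (c l)\<^sup>2)))"
  have "exp (mf_value n \<rho> \<beta> c) = (\<Sum>S\<in>Pow {..<n}. ?C * (\<Prod>i\<in>S. \<rho> * exp (mf_field n \<beta> c i)))"
    unfolding exp_mf_value[OF assms(1)] sum_distrib_left[symmetric] by (subst sum_Pow_prod) auto
  also have "\<dots> \<le> part_fun n \<rho> \<beta>"
    unfolding weight_sum_def
  proof (rule sum_mono)
    fix S assume "S \<in> Pow {..<n}"
    then have S: "S \<subseteq> {..<n}" by simp
    have "1 \<le> exp (\<beta> / (real n)\<^sup>2 * (\<Sum>l<n. (real (tail_count S l) - c l)\<^sup>2))"
      using assms by (simp add: sum_nonneg)
    then show "?C * (\<Prod>i\<in>S. \<rho> * exp (mf_field n \<beta> c i)) \<le> \<rho> ^ card S * exp (\<beta> * energy n S)"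
      unfolding weight_eq_mean_field[OF S, of \<rho> \<beta> c]
      using mult_left_mono[of 1 _ "?C * (\<Prod>i\<in>S. \<rho> * exp (mf_field n \<beta> c i))"] assms
      by (simp add: prod_nonneg)
  qed
  finally show ?thesis .
qed

lemma mf_value_le_log_part:
  assumes "0 \<le> \<rho>" "0 \<le> \<beta>" "0 < n"
  shows "mf_value n \<rho> \<beta> c / real n \<le> log_part n \<rho> \<beta>"
proof -
  have "exp (mf_value n \<rho> \<beta> c) \<le> exp (real n * log_part n \<rho> \<beta>)"
    using exp_mf_value_le_part_fun[OF assms(1,2), of n c] part_fun_eq_exp_log_part[OF assms(1,3)] by simp
  then show ?thesis using assms by (simp add: divide_le_eq mult.commute)
qed

definition sparse :: "real \<Rightarrow> nat \<Rightarrow> nat set set" where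
  "sparse \<epsilon> n = {S \<in> Pow {..<n}. real (card S) \<le> \<epsilon> * real n}"

definition dense :: "real \<Rightarrow> nat \<Rightarrow> nat set set" where
  "dense \<epsilon> n = {S \<in> Pow {..<n}. \<epsilon> * real n < real (card S)}"

lemma exp_minus_affine_le_square:
  assumes "\<bar>\<theta>\<bar> \<le> (1::real)"
  shows "exp \<theta> - 1 - \<theta> \<le> \<theta>\<^sup>2"
proof (cases "0 \<le> \<theta>")
  case True
  then show ?thesis using exp_bound[of \<theta>] assms by simp
next
  case False
  define x where "x = - \<theta>"
  have x: "0 < x" "x \<le> 1" using False assms by (auto simp: x_def)
  have "1 \<le> (1 + x + x\<^sup>2 / 2) * (1 - x + x\<^sup>2)"
  proof -
    have "(1 + x + x\<^sup>2 / 2) * (1 - x + x\<^sup>2) = 1 + (x ^ 2 + x ^ 3 + x ^ 4) / 2"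
      by (simp add: field_simps power2_eq_square power3_eq_cube power4_eq_xxxx)
    then show ?thesis using x by simp
  qed
  also have "\<dots> \<le> exp x * (1 - x + x\<^sup>2)"
    using x by (intro mult_right_mono exp_lower_Taylor_quadratic) auto
  finally have "exp (- x) \<le> 1 - x + x\<^sup>2"
    by (simp add: exp_minus inverse_eq_divide divide_le_eq mult.commute)
  then show ?thesis by (simp add: x_def)
qed

lemma prod_tilted_le:
  assumes "\<And>i. i < n \<Longrightarrow> 0 \<le> q i"
  shows "(\<Prod>i<n. 1 + q i * exp (if l \<le> i then \<theta> else 0))
    \<le> (\<Prod>i<n. 1 + q i) * exp ((exp \<theta> - 1) * tail_sum n (\<lambda>i. q i / (1 + q i)) l)"
proof -
  define r where "r i = (if l \<le> i then (exp \<theta> - 1) * (q i / (1 + q i)) else 0)" for i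
  have "(\<Prod>i<n. 1 + q i * exp (if l \<le> i then \<theta> else 0)) \<le> (\<Prod>i<n. (1 + q i) * exp (r i))"
  proof (rule prod_mono, safe)
    fix i assume "i < n"
    then have q: "0 \<le> q i" using assms by simp
    then show "0 \<le> 1 + q i * exp (if l \<le> i then \<theta> else 0)" by simp
    have "1 + q i * exp (if l \<le> i then \<theta> else 0) = (1 + q i) * (1 + r i)"
    proof -
      define p where "p = q i / (1 + q i)"
      have "(1 + q i) * (1 + (exp \<theta> - 1) * p) = 1 + q i + (exp \<theta> - 1) * ((1 + q i) * p)"
        by (simp add: algebra_simps)
      moreover have "(1 + q i) * p = q i" using q by (simp add: p_def)
      ultimately have "(1 + q i) * (1 + (exp \<theta> - 1) * p) = 1 + q i * exp \<theta>"
        by (simp only:) (simp add: algebra_simps)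
      then show ?thesis by (simp add: r_def p_def[symmetric])
    qed
    also have "\<dots> \<le> (1 + q i) * exp (r i)"
      using q by (intro mult_left_mono) auto
    finally show "1 + q i * exp (if l \<le> i then \<theta> else 0) \<le> (1 + q i) * exp (r i)" .
  qed
  also have "\<dots> = (\<Prod>i<n. 1 + q i) * exp (\<Sum>i<n. r i)" by (simp add: prod.distrib exp_sum)
  also have "(\<Sum>i<n. r i) = (exp \<theta> - 1) * tail_sum n (\<lambda>i. q i / (1 + q i)) l"
  proof -
    have "{i \<in> {..<n}. l \<le> i} = {l..<n}" by auto
    then show ?thesis by (simp add: r_def sum.If_cases Int_def tail_sum_def sum_distrib_left)
  qed
  finally show ?thesis .
qed

text \<open>If \<open>c\<close> is nearly self-consistent, the fluctuation term costs only a polynomial factor as long as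
  the density is at most \<open>\<epsilon>\<close>: a tail deviating by \<open>a n\<close> from its mean has probability at most
  \<open>e exp (- 2 \<beta> a\<^sup>2 n + \<beta> a\<^sup>2 n)\<close> under the independent measure (exponential Chebyshev inequality with
  tilt \<open>\<theta> = 2 \<beta> a\<close>), which compensates the gain \<open>exp (\<beta> a\<^sup>2 n)\<close>. The range \<open>\<bar>a\<bar> \<le> \<epsilon>\<close> keeps the tilt
  at most one in absolute value.\<close>

lemma tilted_sum_le:
  assumes "0 < n" "0 \<le> \<beta>" "\<And>i. i < n \<Longrightarrow> 0 \<le> q i" "\<And>i. i < n \<Longrightarrow> q i / (1 + q i) \<le> \<delta>"
    and "0 \<le> \<delta>" "4 * \<beta> * \<delta> \<le> 1" "2 * \<beta> * \<epsilon> \<le> 1" "\<bar>a\<bar> \<le> \<epsilon>"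
    and gap: "0 \<le> tail_sum n (\<lambda>i. q i / (1 + q i)) l - c" "tail_sum n (\<lambda>i. q i / (1 + q i)) l - c \<le> 1"
  shows "(\<Sum>S\<in>Pow {..<n}. (\<Prod>i\<in>S. q i) * exp (2 * \<beta> * a * (real (tail_count S l) - c) - \<beta> * n * a\<^sup>2))
    \<le> (\<Prod>i<n. 1 + q i) * exp 1"
proof -
  define \<theta> where "\<theta> = 2 * \<beta> * a"
  define P where "P = tail_sum n (\<lambda>i. q i / (1 + q i)) l"
  have \<theta>: "\<bar>\<theta>\<bar> \<le> 1"
  proof -
    have "\<bar>\<theta>\<bar> = 2 * \<beta> * \<bar>a\<bar>" using assms by (simp add: \<theta>_def abs_mult)
    also have "\<dots> \<le> 2 * \<beta> * \<epsilon>" using assms by (intro mult_left_mono) auto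
    finally show ?thesis using assms by simp
  qed
  have P: "P \<le> real n * \<delta>" "0 \<le> P"
  proof -
    have "P \<le> (\<Sum>i\<in>{l..<n}. \<delta>)" unfolding P_def tail_sum_def using assms(4) by (intro sum_mono) auto
    also have "\<dots> \<le> real n * \<delta>" using assms by (auto intro!: mult_right_mono)
    finally show "P \<le> real n * \<delta>" .
    show "0 \<le> P" unfolding P_def tail_sum_def using assms(3) by (intro sum_nonneg) auto
  qed
  have "(\<Sum>S\<in>Pow {..<n}. (\<Prod>i\<in>S. q i) * exp (\<theta> * (real (tail_count S l) - c) - \<beta> * n * a\<^sup>2))
      = exp (- \<theta> * c - \<beta> * n * a\<^sup>2) * (\<Sum>S\<in>Pow {..<n}. \<Prod>i\<in>S. q i * exp (if l \<le> i then \<theta> else 0))"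
    unfolding sum_distrib_left
  proof (rule sum.cong)
    fix S assume "S \<in> Pow {..<n}"
    then have "finite S" using finite_subset by auto
    then have "(\<Prod>i\<in>S. q i * exp (if l \<le> i then \<theta> else 0)) = (\<Prod>i\<in>S. q i) * exp (\<theta> * real (tail_count S l))"
      by (simp only: prod.distrib exp_sum[symmetric] sum_indicator_tail_count)
    then show "(\<Prod>i\<in>S. q i) * exp (\<theta> * (real (tail_count S l) - c) - \<beta> * n * a\<^sup>2)
        = exp (- \<theta> * c - \<beta> * n * a\<^sup>2) * (\<Prod>i\<in>S. q i * exp (if l \<le> i then \<theta> else 0))"
      by (simp only:) (simp add: exp_add[symmetric] algebra_simps)
  qed simp
  also have "\<dots> = exp (- \<theta> * c - \<beta> * n * a\<^sup>2) * (\<Prod>i<n. 1 + q i * exp (if l \<le> i then \<theta> else 0))"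
    by (subst sum_Pow_prod) auto
  also have "\<dots> \<le> exp (- \<theta> * c - \<beta> * n * a\<^sup>2) * ((\<Prod>i<n. 1 + q i) * exp ((exp \<theta> - 1) * P))"
    unfolding P_def using assms(3) by (intro mult_left_mono prod_tilted_le) auto
  also have "\<dots> = (\<Prod>i<n. 1 + q i) * exp ((exp \<theta> - 1 - \<theta>) * P + \<theta> * (P - c) - \<beta> * n * a\<^sup>2)"
  proof -
    have "exp ((exp \<theta> - 1 - \<theta>) * P + \<theta> * (P - c) - \<beta> * n * a\<^sup>2)
        = exp (- \<theta> * c - \<beta> * n * a\<^sup>2) * exp ((exp \<theta> - 1) * P)"
      by (simp add: exp_add[symmetric] algebra_simps)
    then show ?thesis by (simp only: mult_ac)
  qed
  also have "\<dots> \<le> (\<Prod>i<n. 1 + q i) * exp 1"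
  proof -
    have "(exp \<theta> - 1 - \<theta>) * P \<le> \<theta>\<^sup>2 * (real n * \<delta>)"
      using exp_minus_affine_le_square[OF \<theta>] P by (intro mult_mono) auto
    also have "\<dots> = (4 * \<beta> * \<delta>) * (\<beta> * n * a\<^sup>2)" by (simp add: \<theta>_def power2_eq_square)
    also have "\<dots> \<le> 1 * (\<beta> * n * a\<^sup>2)" using assms by (intro mult_right_mono) auto
    finally have "(exp \<theta> - 1 - \<theta>) * P \<le> \<beta> * n * a\<^sup>2" by simp
    moreover have "\<theta> * (P - c) \<le> 1 * 1"
      using \<theta> gap by (intro mult_mono) (auto simp: P_def)
    ultimately show ?thesis
      using assms(3) by (intro mult_left_mono prod_nonneg) auto
  qed
  finally show ?thesis by (simp add: \<theta>_def)
qed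

text \<open>The largest tail fluctuation controls the average one, and tail counts take at most \<open>n + 1\<close>
  values; summing over both choices produces the factor \<open>n (n + 1)\<close>.\<close>

lemma weight_sum_sparse_le:
  assumes "0 < n" "0 \<le> \<rho>" "0 \<le> \<beta>"
    and d: "\<And>i. i < n \<Longrightarrow> 0 \<le> d i" "\<And>i. i < n \<Longrightarrow> d i \<le> q i / (1 + q i)"
    and gap: "(\<Sum>i<n. q i / (1 + q i) - d i) \<le> 1"
    and q_def: "\<And>i. q i = \<rho> * exp (mf_field n \<beta> (tail_sum n d) i)"
    and \<delta>: "\<And>i. i < n \<Longrightarrow> q i / (1 + q i) \<le> \<delta>" "\<delta> \<le> \<epsilon>" "4 * \<beta> * \<delta> \<le> 1" "2 * \<beta> * \<epsilon> \<le> 1"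
  shows "weight_sum (sparse \<epsilon> n) n \<rho> \<beta>
    \<le> exp (mf_value n \<rho> \<beta> (tail_sum n d)) * (real n * (real n + 1) * exp 1)"
proof -
  define c where "c = tail_sum n d"
  define C where "C = exp (- (\<beta> / (real n)\<^sup>2 * (\<Sum>l<n. (c l)\<^sup>2)))"
  define a where "a l m = (real m - c l) / real n" for l m :: nat
  define g where "g l m S = exp (2 * \<beta> * a l m * (real (tail_count S l) - c l) - \<beta> * n * (a l m)\<^sup>2)" for l m S
  define I where "I l = {m. m \<le> n \<and> \<bar>a l m\<bar> \<le> \<epsilon>}" for l
  have finI: "finite (I l)" for l by (rule finite_subset[of _ "{..n}"]) (auto simp: I_def)
  have q0: "0 \<le> q i" for i using assms(2) by (simp add: q_def)
  have \<delta>0: "0 \<le> \<delta>" using \<delta>(1)[of 0] q0[of 0] assms(1) by (smt (verit) divide_nonneg_nonneg)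
  have "d i \<le> \<delta>" if "i < n" for i using d(2)[OF that] \<delta>(1)[OF that] by simp
  then have c: "0 \<le> c l" "c l \<le> \<epsilon> * n" for l
  proof -
    show "0 \<le> c l" unfolding c_def tail_sum_def using d by (intro sum_nonneg) auto
    have "c l \<le> (\<Sum>j\<in>{l..<n}. \<epsilon>)"
      unfolding c_def tail_sum_def using d(2) \<delta> by (intro sum_mono) force
    also have "\<dots> = real (n - l) * \<epsilon>" by simp
    also have "\<dots> \<le> real n * \<epsilon>" using \<delta> \<delta>0 by (intro mult_right_mono) auto
    also have "\<dots> = \<epsilon> * n" by simp
    finally show "c l \<le> \<epsilon> * n" .
  qed
  have fluct: "exp (\<beta> / (real n)\<^sup>2 * (\<Sum>l<n. (real (tail_count S l) - c l)\<^sup>2)) \<le> (\<Sum>l<n. \<Sum>m\<in>I l. g l m S)"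
    if "S \<in> sparse \<epsilon> n" for S
  proof -
    have S: "S \<subseteq> {..<n}" "real (card S) \<le> \<epsilon> * n" "finite S"
      using that finite_subset[of S "{..<n}"] by (auto simp: sparse_def)
    define x where "x l = (real (tail_count S l) - c l)\<^sup>2" for l
    \<comment> \<open>a site at which the fluctuation of the tail is largest\<close>
    obtain l where l: "l < n" "\<And>k. k < n \<Longrightarrow> x k \<le> x l"
    proof -
      have "Max (x ` {..<n}) \<in> x ` {..<n}" using assms(1) by (intro Max_in) auto
      then obtain l where "l < n" "x l = Max (x ` {..<n})" by auto
      then show ?thesis by (intro that[of l]) auto
    qed
    define m where "m = tail_count S l"
    have "(\<Sum>k<n. x k) \<le> real n * x l" using sum_mono[of "{..<n}" x "\<lambda>_. x l"] l by simp
    then have "\<beta> / (real n)\<^sup>2 * (\<Sum>k<n. x k) \<le> \<beta> / (real n)\<^sup>2 * (real n * x l)"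
      using assms by (intro mult_left_mono) auto
    also have "\<dots> = \<beta> * n * (a l m)\<^sup>2"
      using assms(1) by (simp add: x_def a_def m_def power_divide power2_eq_square)
    also have "\<dots> = 2 * \<beta> * a l m * (real (tail_count S l) - c l) - \<beta> * n * (a l m)\<^sup>2"
      using assms(1) by (simp add: a_def m_def power2_eq_square)
    finally have "exp (\<beta> / (real n)\<^sup>2 * (\<Sum>k<n. x k)) \<le> g l m S" by (simp add: g_def)
    also have "\<dots> \<le> (\<Sum>m\<in>I l. g l m S)"
    proof (rule member_le_sum)
      have "real m \<le> real (card S)" using tail_count_le_card[OF S(3)] by (simp add: m_def)
      then have "\<bar>real m - c l\<bar> \<le> \<epsilon> * n" using c[of l] S(2) by linarith
      then have "\<bar>a l m\<bar> \<le> \<epsilon>" using assms(1) by (simp add: a_def abs_divide divide_le_eq)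
      moreover have "m \<le> n" using tail_count_le_card[OF S(3), of l] card_le_of_subset_lessThan[OF S(1)] by (simp add: m_def)
      ultimately show "m \<in> I l" by (simp add: I_def)
    qed (auto simp: g_def finI)
    also have "\<dots> \<le> (\<Sum>l<n. \<Sum>m\<in>I l. g l m S)"
      using l by (intro member_le_sum[of l "{..<n}"]) (auto simp: g_def intro!: sum_nonneg)
    finally show ?thesis by (simp add: x_def)
  qed
  have "weight_sum (sparse \<epsilon> n) n \<rho> \<beta> \<le> (\<Sum>S\<in>sparse \<epsilon> n. C * (\<Prod>i\<in>S. q i) * (\<Sum>l<n. \<Sum>m\<in>I l. g l m S))"
    unfolding weight_sum_def
  proof (rule sum_mono)
    fix S assume S: "S \<in> sparse \<epsilon> n"
    then have "S \<subseteq> {..<n}" by (simp add: sparse_def)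
    from weight_eq_mean_field[OF this, of \<rho> \<beta> c]
    show "\<rho> ^ card S * exp (\<beta> * energy n S) \<le> C * (\<Prod>i\<in>S. q i) * (\<Sum>l<n. \<Sum>m\<in>I l. g l m S)"
      using mult_left_mono[OF fluct[OF S], of "C * (\<Prod>i\<in>S. q i)"] q0
      by (simp add: C_def q_def c_def prod_nonneg)
  qed
  also have "\<dots> \<le> (\<Sum>S\<in>Pow {..<n}. C * (\<Prod>i\<in>S. q i) * (\<Sum>l<n. \<Sum>m\<in>I l. g l m S))"
    by (rule sum_mono2) (auto simp: sparse_def C_def g_def q0 intro!: mult_nonneg_nonneg sum_nonneg prod_nonneg)
  also have "\<dots> = C * (\<Sum>l<n. \<Sum>m\<in>I l. \<Sum>S\<in>Pow {..<n}. (\<Prod>i\<in>S. q i) * g l m S)"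
    by (simp only: sum_distrib_left mult.assoc sum.swap[of _ _ "Pow {..<n}"])
  also have "\<dots> \<le> C * (\<Sum>l<n. \<Sum>m\<in>I l. (\<Prod>i<n. 1 + q i) * exp 1)"
  proof (intro mult_left_mono sum_mono)
    fix l m assume "l \<in> {..<n}" "m \<in> I l"
    have diff: "tail_sum n (\<lambda>i. q i / (1 + q i)) l - c l = (\<Sum>i\<in>{l..<n}. q i / (1 + q i) - d i)"
      by (simp add: c_def tail_sum_def sum_subtractf)
    have "(\<Sum>i\<in>{l..<n}. q i / (1 + q i) - d i) \<le> (\<Sum>i<n. q i / (1 + q i) - d i)"
      using d by (intro sum_mono2) auto
    then show "(\<Sum>S\<in>Pow {..<n}. (\<Prod>i\<in>S. q i) * g l m S) \<le> (\<Prod>i<n. 1 + q i) * exp 1"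
      unfolding g_def using \<open>m \<in> I l\<close> assms(1,3) q0 \<delta> \<delta>0 gap d
      by (intro tilted_sum_le[where \<delta> = \<delta> and \<epsilon> = \<epsilon>]) (auto simp: I_def diff intro!: sum_nonneg)
  qed (simp add: C_def)
  also have "\<dots> = exp (mf_value n \<rho> \<beta> c) * exp 1 * (\<Sum>l<n. real (card (I l)))"
    by (simp add: exp_mf_value[OF assms(2)] C_def q_def c_def sum_distrib_left sum_distrib_right mult_ac)
  also have "\<dots> \<le> exp (mf_value n \<rho> \<beta> c) * exp 1 * (\<Sum>l<n. real n + 1)"
  proof (intro mult_left_mono sum_mono)
    fix l
    have "card (I l) \<le> card {..n}" by (intro card_mono) (auto simp: I_def)
    then show "real (card (I l)) \<le> real n + 1" by simp
  qed simp
  finally show ?thesis by (simp add: c_def mult_ac)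
qed

section \<open>The low-density phase\<close>

text \<open>Iteration of the self-consistency equation for the density of independent sites in their own field,
started at the empty configuration and therefore staying at low density.\<close>

primrec mf_density :: "nat \<Rightarrow> real \<Rightarrow> real \<Rightarrow> nat \<Rightarrow> nat \<Rightarrow> real" where
  "mf_density n \<rho> \<beta> 0 = (\<lambda>_. 0)"
| "mf_density n \<rho> \<beta> (Suc m) =
     (\<lambda>i. let q = \<rho> * exp (mf_field n \<beta> (tail_sum n (mf_density n \<rho> \<beta> m)) i) in q / (1 + q))"

text \<open>For the parameters considered, \<open>n\<close> steps of the iteration solve the self-consistency equation up to an
error of at most \<open>2\<^bsup>-n\<^esup>\<close> per site. Unlike the fixed point itself,
this iterate is an explicit composition of elementary functions of \<open>\<rho>\<close> and \<open>\<beta>\<close>.\<close>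

definition low_value :: "nat \<Rightarrow> real \<Rightarrow> real \<Rightarrow> real" where
  "low_value n \<rho> \<beta> = mf_value n \<rho> \<beta> (tail_sum n (mf_density n \<rho> \<beta> n))"

text \<open>The smallness conditions shared by all estimates. The bound on \<open>\<beta> e \<rho>\<close> keeps the mean field below
one and the iteration contracting, the one on \<open>\<beta> \<epsilon>\<close> bounds the tilts of sparse configurations, and
\<open>e \<rho> \<le> \<epsilon> / 2\<close> separates the density of the mean-field state from the threshold \<open>\<epsilon>\<close> of dense ones.\<close>

definition low_domain :: "real \<Rightarrow> real \<Rightarrow> real \<Rightarrow> bool" where
  "low_domain \<epsilon> \<rho> \<beta> \<longleftrightarrow> 0 < \<rho> \<and> 0 < \<beta> \<and> \<epsilon> \<le> 1 / 4 \<and> exp 1 * \<rho> \<le> \<epsilon> / 2 \<and>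
     4 * \<beta> * (exp 1 * \<rho>) \<le> 1 \<and> 2 * \<beta> * \<epsilon> \<le> 1"

definition low_phase :: "real \<Rightarrow> real \<Rightarrow> bool" where
  "low_phase \<rho> \<beta> \<longleftrightarrow> (\<lambda>n. low_value n \<rho> \<beta> / real n) \<longlonglongrightarrow> pressure \<rho> \<beta>"

lemma tail_sum_le:
  assumes "\<And>j. j < n \<Longrightarrow> d j \<le> \<delta>" "0 \<le> \<delta>"
  shows "tail_sum n d l \<le> real n * \<delta>"
proof -
  have "tail_sum n d l \<le> (\<Sum>j\<in>{l..<n}. \<delta>)" unfolding tail_sum_def using assms by (intro sum_mono) auto
  also have "\<dots> \<le> real n * \<delta>" using assms by (auto intro!: mult_right_mono)
  finally show ?thesis .
qed

lemma tail_sum_nonneg: "(\<And>j. j < n \<Longrightarrow> 0 \<le> d j) \<Longrightarrow> 0 \<le> tail_sum n d l"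
  unfolding tail_sum_def by (intro sum_nonneg) auto

lemma mean_sum_le:
  assumes "\<And>l. c l \<le> real n * \<delta>" "0 \<le> \<delta>" "i < n"
  shows "(\<Sum>l\<le>i. c l) / (real n)\<^sup>2 \<le> \<delta>"
proof -
  have "(\<Sum>l\<le>i. c l) \<le> (\<Sum>l\<le>i. real n * \<delta>)" using assms by (intro sum_mono) auto
  also have "\<dots> = real (Suc i) * (real n * \<delta>)" by simp
  also have "\<dots> \<le> real n * (real n * \<delta>)" using assms by (intro mult_right_mono) auto
  finally show ?thesis using assms by (simp add: divide_le_eq power2_eq_square mult_ac)
qed

lemma mf_field_le:
  assumes "\<And>j. j < n \<Longrightarrow> d j \<le> \<delta>" "0 \<le> \<delta>" "0 \<le> \<beta>" "i < n"
  shows "mf_field n \<beta> (tail_sum n d) i \<le> 2 * \<beta> * \<delta>"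
  using mult_left_mono[OF mean_sum_le[of "tail_sum n d" n \<delta> i], of "2 * \<beta>"] tail_sum_le[OF assms(1,2)] assms
  by (simp add: mf_field_def)

lemma mf_field_nonneg: "(\<And>l. 0 \<le> c l) \<Longrightarrow> 0 \<le> \<beta> \<Longrightarrow> 0 \<le> mf_field n \<beta> c i"
  unfolding mf_field_def by (intro mult_nonneg_nonneg sum_nonneg) auto

lemma mf_field_diff:
  "mf_field n \<beta> (tail_sum n d') i - mf_field n \<beta> (tail_sum n d) i = mf_field n \<beta> (tail_sum n (\<lambda>j. d' j - d j)) i"
  by (simp add: mf_field_def tail_sum_def sum_subtractf right_diff_distrib)

lemma low_domainD:
  assumes "low_domain \<epsilon> \<rho> \<beta>"
  shows "0 < \<rho>" "0 < \<beta>" "\<epsilon> \<le> 1 / 4" "exp 1 * \<rho> \<le> \<epsilon> / 2" "4 * \<beta> * (exp 1 * \<rho>) \<le> 1" "2 * \<beta> * \<epsilon> \<le> 1" "0 < \<epsilon>"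
proof -
  show *: "0 < \<rho>" "0 < \<beta>" "\<epsilon> \<le> 1 / 4" "exp 1 * \<rho> \<le> \<epsilon> / 2" "4 * \<beta> * (exp 1 * \<rho>) \<le> 1" "2 * \<beta> * \<epsilon> \<le> 1"
    using assms by (auto simp: low_domain_def)
  then have "0 < exp 1 * \<rho>" by simp
  with *(4) show "0 < \<epsilon>" by linarith
qed

lemma mf_density_bounds:
  assumes "low_domain \<epsilon> \<rho> \<beta>" "i < n"
  shows "0 \<le> mf_density n \<rho> \<beta> m i" "mf_density n \<rho> \<beta> m i \<le> exp 1 * \<rho>"
    "0 \<le> mf_field n \<beta> (tail_sum n (mf_density n \<rho> \<beta> m)) i"
    "mf_field n \<beta> (tail_sum n (mf_density n \<rho> \<beta> m)) i \<le> 1"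
proof -
  note dom = low_domainD[OF assms(1)]
  have field: "0 \<le> mf_field n \<beta> (tail_sum n d) i \<and> mf_field n \<beta> (tail_sum n d) i \<le> 1"
    if d: "\<And>j. j < n \<Longrightarrow> 0 \<le> d j" "\<And>j. j < n \<Longrightarrow> d j \<le> exp 1 * \<rho>" and "i < n" for d i
    using mf_field_le[of n d "exp 1 * \<rho>" \<beta> i] mf_field_nonneg[of "tail_sum n d" \<beta> n i] tail_sum_nonneg[of n d] that dom
    by auto
  have *: "\<forall>i<n. 0 \<le> mf_density n \<rho> \<beta> m i \<and> mf_density n \<rho> \<beta> m i \<le> exp 1 * \<rho>"
  proof (induction m)
    case 0
    then show ?case using dom by simp
  next
    case (Suc m)
    show ?case
    proof safe
      fix i assume i: "i < n"
      define q where "q = \<rho> * exp (mf_field n \<beta> (tail_sum n (mf_density n \<rho> \<beta> m)) i)"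
      have "mf_field n \<beta> (tail_sum n (mf_density n \<rho> \<beta> m)) i \<le> 1" using field[OF _ _ i] Suc by blast
      then have q: "0 < q" "q \<le> exp 1 * \<rho>" using dom by (auto simp: q_def)
      have eq: "mf_density n \<rho> \<beta> (Suc m) i = q / (1 + q)" by (simp add: q_def Let_def)
      show "0 \<le> mf_density n \<rho> \<beta> (Suc m) i" using q unfolding eq by simp
      have "q / (1 + q) \<le> q" using q by (simp add: divide_le_eq)
      then show "mf_density n \<rho> \<beta> (Suc m) i \<le> exp 1 * \<rho>" using q unfolding eq by linarith
    qed
  qed
  then show "0 \<le> mf_density n \<rho> \<beta> m i" "mf_density n \<rho> \<beta> m i \<le> exp 1 * \<rho>" using assms by auto
  show "0 \<le> mf_field n \<beta> (tail_sum n (mf_density n \<rho> \<beta> m)) i"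
    "mf_field n \<beta> (tail_sum n (mf_density n \<rho> \<beta> m)) i \<le> 1"
    using field[OF _ _ assms(2)] * by blast+
qed

text \<open>The iteration of the self-consistency equation is monotone and halves its increments, because
  the field changes by at most \<open>2 \<beta>\<close> times the change of the density and the density by at most
  \<open>e \<rho>\<close> times the change of the field.\<close>

lemma mf_density_gap:
  assumes "low_domain \<epsilon> \<rho> \<beta>" "i < n"
  shows "mf_density n \<rho> \<beta> m i \<le> mf_density n \<rho> \<beta> (Suc m) i"
    and "mf_density n \<rho> \<beta> (Suc m) i - mf_density n \<rho> \<beta> m i \<le> (1 / 2) ^ m"
proof -
  note dom = low_domainD[OF assms(1)]
  define D where "D m i = mf_density n \<rho> \<beta> (Suc m) i - mf_density n \<rho> \<beta> m i" for m i
  have "\<forall>i<n. 0 \<le> D m i \<and> D m i \<le> (1 / 2) ^ m"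
  proof (induction m)
    case 0
    show ?case
    proof safe
      fix i assume i: "i < n"
      have "D 0 i = mf_density n \<rho> \<beta> 1 i" by (simp add: D_def)
      then show "0 \<le> D 0 i" "D 0 i \<le> (1 / 2) ^ 0"
        using mf_density_bounds[OF assms(1) i, of 1] dom by auto
    qed
  next
    case (Suc m)
    show ?case
    proof safe
      fix i assume i: "i < n"
      define x where "x m = mf_field n \<beta> (tail_sum n (mf_density n \<rho> \<beta> m)) i" for m
      define q where "q m = \<rho> * exp (x m)" for m
      have q0: "0 < q m" for m using dom by (simp add: q_def)
      have "D (Suc m) i = q (Suc m) / (1 + q (Suc m)) - q m / (1 + q m)"
        by (simp add: D_def q_def x_def Let_def)
      also have "\<dots> = (q (Suc m) - q m) / ((1 + q (Suc m)) * (1 + q m))"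
        using q0[of m] q0[of "Suc m"] by (simp add: diff_frac_eq) (simp add: algebra_simps)
      finally have D: "D (Suc m) i = (q (Suc m) - q m) / ((1 + q (Suc m)) * (1 + q m))" .
      have x: "x (Suc m) - x m = mf_field n \<beta> (tail_sum n (D m)) i"
        unfolding x_def D_def by (rule mf_field_diff)
      have x0: "0 \<le> x (Suc m) - x m"
        unfolding x using Suc dom by (intro mf_field_nonneg tail_sum_nonneg) auto
      have x1: "x (Suc m) - x m \<le> 2 * \<beta> * (1 / 2) ^ m"
        unfolding x using Suc dom i by (intro mf_field_le) auto
      have x2: "x (Suc m) \<le> 1" unfolding x_def by (rule mf_density_bounds[OF assms(1) i])
      have "q (Suc m) - q m = q (Suc m) * (1 - exp (- (x (Suc m) - x m)))"
        by (simp add: q_def right_diff_distrib exp_diff exp_minus)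
      also have "\<dots> \<le> q (Suc m) * (x (Suc m) - x m)"
      proof (rule mult_left_mono)
        show "1 - exp (- (x (Suc m) - x m)) \<le> x (Suc m) - x m"
          using exp_ge_add_one_self[of "- (x (Suc m) - x m)"] by linarith
      qed (use q0[of "Suc m"] in simp)
      also have "\<dots> \<le> (exp 1 * \<rho>) * (2 * \<beta> * (1 / 2) ^ m)"
        using x0 x1 x2 dom by (intro mult_mono) (auto simp: q_def)
      also have "\<dots> = (4 * \<beta> * (exp 1 * \<rho>)) * (1 / 2) ^ Suc m" by simp
      also have "\<dots> \<le> 1 * (1 / 2) ^ Suc m" using dom by (intro mult_right_mono) auto
      finally have up: "q (Suc m) - q m \<le> (1 / 2) ^ Suc m" by simp
      have lo: "0 \<le> q (Suc m) - q m" using x0 dom by (simp add: q_def)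
      have one: "1 \<le> (1 + q (Suc m)) * (1 + q m)"
        using mult_mono[of 1 "1 + q (Suc m)" 1 "1 + q m"] q0[of m] q0[of "Suc m"] by simp
      show "0 \<le> D (Suc m) i" unfolding D using lo one by simp
      have "D (Suc m) i \<le> q (Suc m) - q m"
        unfolding D using lo one by (simp add: divide_le_eq mult_le_cancel_left1)
      then show "D (Suc m) i \<le> (1 / 2) ^ Suc m" using up by linarith
    qed
  qed
  then show "mf_density n \<rho> \<beta> m i \<le> mf_density n \<rho> \<beta> (Suc m) i"
    "mf_density n \<rho> \<beta> (Suc m) i - mf_density n \<rho> \<beta> m i \<le> (1 / 2) ^ m"
    using assms(2) by (auto simp: D_def)
qed

lemma weight_sum_sparse_le_low_value:
  assumes "low_domain \<epsilon> \<rho> \<beta>" "0 < n"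
  shows "weight_sum (sparse \<epsilon> n) n \<rho> \<beta> \<le> exp (low_value n \<rho> \<beta>) * (real n * (real n + 1) * exp 1)"
proof -
  note dom = low_domainD[OF assms(1)]
  define q where "q i = \<rho> * exp (mf_field n \<beta> (tail_sum n (mf_density n \<rho> \<beta> n)) i)" for i
  have Suc: "q i / (1 + q i) = mf_density n \<rho> \<beta> (Suc n) i" for i by (simp add: q_def Let_def)
  have "(\<Sum>i<n. q i / (1 + q i) - mf_density n \<rho> \<beta> n i) \<le> (\<Sum>i<n. (1 / 2) ^ n)"
    unfolding Suc by (intro sum_mono mf_density_gap(2)[OF assms(1)]) auto
  also have "\<dots> = real n / 2 ^ n" by (simp add: power_divide)
  also have "\<dots> \<le> 1" using of_nat_less_two_power[of n, where 'a = real] by simp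
  finally have gap: "(\<Sum>i<n. q i / (1 + q i) - mf_density n \<rho> \<beta> n i) \<le> 1" .
  show ?thesis
    unfolding low_value_def
  proof (rule weight_sum_sparse_le[where q = q and \<delta> = "exp 1 * \<rho>"])
    show "mf_density n \<rho> \<beta> n i \<le> q i / (1 + q i)" if "i < n" for i
      unfolding Suc by (rule mf_density_gap(1)[OF assms(1) that])
    show "q i / (1 + q i) \<le> exp 1 * \<rho>" if "i < n" for i
      unfolding Suc by (rule mf_density_bounds(2)[OF assms(1) that])
  qed (use assms dom gap mf_density_bounds(1)[OF assms(1)] in \<open>auto simp: q_def\<close>)
qed

lemma part_fun_eq_sparse_dense:
  "part_fun n \<rho> \<beta> = weight_sum (sparse \<epsilon> n) n \<rho> \<beta> + weight_sum (dense \<epsilon> n) n \<rho> \<beta>"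
proof -
  have "Pow {..<n} = sparse \<epsilon> n \<union> dense \<epsilon> n" "sparse \<epsilon> n \<inter> dense \<epsilon> n = {}"
    by (auto simp: sparse_def dense_def)
  moreover have "finite (sparse \<epsilon> n)" "finite (dense \<epsilon> n)"
    by (auto simp: sparse_def dense_def)
  ultimately show ?thesis using weight_sum_Un by metis
qed

text \<open>If dense configurations carry less than half of the weight, the sparse ones determine the
  exponential growth rate, and these are captured by the mean-field value.\<close>

lemma low_phaseI:
  assumes "low_domain \<epsilon> \<rho> \<beta>"
    and "\<forall>\<^sub>F n in sequentially. 2 * weight_sum (dense \<epsilon> n) n \<rho> \<beta> < part_fun n \<rho> \<beta>"
  shows "low_phase \<rho> \<beta>"
proof -
  note dom = low_domainD[OF assms(1)]
  have lim: "(\<lambda>n. log_part n \<rho> \<beta>) \<longlonglongrightarrow> pressure \<rho> \<beta>"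
    by (rule log_part_tendsto_pressure) (use dom in auto)
  have "(\<lambda>n. ln (2 * (real n * (real n + 1) * exp 1)) / real n) \<longlonglongrightarrow> 0" by real_asymp
  from tendsto_diff[OF lim this]
  have lower: "(\<lambda>n. log_part n \<rho> \<beta> - ln (2 * (real n * (real n + 1) * exp 1)) / real n) \<longlonglongrightarrow> pressure \<rho> \<beta>" by simp
  show ?thesis
    unfolding low_phase_def
  proof (rule tendsto_sandwich[OF _ _ lower lim])
    show "\<forall>\<^sub>F n in sequentially. low_value n \<rho> \<beta> / real n \<le> log_part n \<rho> \<beta>"
      unfolding low_value_def using dom by (intro eventually_pos_nat mf_value_le_log_part) auto
    show "\<forall>\<^sub>F n in sequentially. log_part n \<rho> \<beta> - ln (2 * (real n * (real n + 1) * exp 1)) / real n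
        \<le> low_value n \<rho> \<beta> / real n"
      using assms(2) eventually_gt_at_top[of 0]
    proof eventually_elim
      case (elim n)
      define N where "N = real n * (real n + 1) * exp 1"
      have N: "0 < N" using elim by (simp add: N_def)
      have "part_fun n \<rho> \<beta> < 2 * weight_sum (sparse \<epsilon> n) n \<rho> \<beta>"
        using elim part_fun_eq_sparse_dense[of n \<rho> \<beta> \<epsilon>] by linarith
      also have "\<dots> \<le> 2 * N * exp (low_value n \<rho> \<beta>)"
        using weight_sum_sparse_le_low_value[OF assms(1) elim(2)] unfolding N_def[symmetric]
        by (simp add: mult.commute)
      finally have "ln (part_fun n \<rho> \<beta>) \<le> ln (2 * N * exp (low_value n \<rho> \<beta>))"
        using part_fun_pos[of \<rho> n \<beta>] dom by (intro ln_mono) auto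
      also have "\<dots> = ln (2 * N) + low_value n \<rho> \<beta>" using N by (subst ln_mult) auto
      finally show ?case
        unfolding log_part_def N_def[symmetric] diff_divide_distrib[symmetric]
        by (intro divide_right_mono) auto
    qed
  qed
qed

lemma dense_shift_rho:
  assumes "0 \<le> \<rho>" "0 \<le> s"
  shows "exp (s * \<epsilon> * real n) * weight_sum (dense \<epsilon> n) n \<rho> \<beta> \<le> weight_sum (dense \<epsilon> n) n (exp s * \<rho>) \<beta>"
  unfolding weight_sum_def sum_distrib_left
proof (rule sum_mono)
  fix S assume "S \<in> dense \<epsilon> n"
  then have "s * (\<epsilon> * real n) \<le> s * real (card S)"
    using assms by (intro mult_left_mono) (auto simp: dense_def)
  then have "exp (s * \<epsilon> * real n) \<le> exp s ^ card S" by (simp add: exp_of_nat2_mult[symmetric] mult.assoc)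
  then show "exp (s * \<epsilon> * real n) * (\<rho> ^ card S * exp (\<beta> * energy n S))
      \<le> (exp s * \<rho>) ^ card S * exp (\<beta> * energy n S)"
    using assms by (simp add: power_mult_distrib mult.assoc mult_right_mono)
qed

text \<open>Outside the low-density phase, dense configurations carry at least half of the weight for infinitely
many \<open>n\<close>, and each of their weights grows at rate at least \<open>\<epsilon>\<close> per site in \<open>ln \<rho>\<close>. Since the limit exists, comparing
along these \<open>n\<close> suffices.\<close>

lemma pressure_growth_outside_low_phase:
  assumes "low_domain \<epsilon> \<rho> \<beta>" "\<not> low_phase \<rho> \<beta>" "0 \<le> s"
  shows "pressure \<rho> \<beta> + \<epsilon> * s \<le> pressure (exp s * \<rho>) \<beta>"
proof (rule ccontr)
  note dom = low_domainD[OF assms(1)]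
  assume "\<not> ?thesis"
  moreover have "(\<lambda>n. log_part n (exp s * \<rho>) \<beta> - log_part n \<rho> \<beta> + ln 2 / real n)
      \<longlonglongrightarrow> pressure (exp s * \<rho>) \<beta> - pressure \<rho> \<beta> + 0"
    using dom by (intro tendsto_add tendsto_diff log_part_tendsto_pressure) (auto, real_asymp)
  ultimately have "\<forall>\<^sub>F n in sequentially. log_part n (exp s * \<rho>) \<beta> - log_part n \<rho> \<beta> + ln 2 / real n < \<epsilon> * s"
    by (intro order_tendstoD) auto
  then have "\<forall>\<^sub>F n in sequentially. 2 * weight_sum (dense \<epsilon> n) n \<rho> \<beta> < part_fun n \<rho> \<beta>"
    using eventually_gt_at_top[of 0]
  proof eventually_elim
    case (elim n)
    then have "real n * (log_part n (exp s * \<rho>) \<beta> - log_part n \<rho> \<beta> + ln 2 / real n) < real n * (\<epsilon> * s)"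
      by (intro mult_strict_left_mono) auto
    then have "real n * log_part n (exp s * \<rho>) \<beta> + ln 2 < \<epsilon> * s * n + real n * log_part n \<rho> \<beta>"
      using elim by (simp add: algebra_simps)
    then have "exp (real n * log_part n (exp s * \<rho>) \<beta> + ln 2) < exp (\<epsilon> * s * n + real n * log_part n \<rho> \<beta>)" by simp
    then have "part_fun n (exp s * \<rho>) \<beta> * 2 < exp (\<epsilon> * s * n) * part_fun n \<rho> \<beta>"
      using dom elim by (simp add: part_fun_eq_exp_log_part exp_add)
    moreover have "exp (\<epsilon> * s * n) * weight_sum (dense \<epsilon> n) n \<rho> \<beta> \<le> part_fun n (exp s * \<rho>) \<beta>"
      using dense_shift_rho[of \<rho> s \<epsilon> n \<beta>] part_fun_eq_sparse_dense[of n "exp s * \<rho>" \<beta> \<epsilon>]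
        weight_sum_nonneg[of "exp s * \<rho>" "sparse \<epsilon> n" n \<beta>] dom assms(3) by (simp add: mult_ac)
    ultimately have "exp (\<epsilon> * s * n) * (2 * weight_sum (dense \<epsilon> n) n \<rho> \<beta>) < exp (\<epsilon> * s * n) * part_fun n \<rho> \<beta>"
      by linarith
    then show ?case by simp
  qed
  then show False using low_phaseI[OF assms(1)] assms(2) by blast
qed

text \<open>For a fixed profile each site contributes a slope of at most its activity \<open>e \<rho>\<close> in \<open>ln \<rho>\<close>, and a
slope in \<open>\<beta>\<close> that is small with the profile. Freezing the profile avoids differentiating the
solution of the self-consistency equation.\<close>

lemma mf_value_shift:
  assumes "0 < n" "0 \<le> \<rho>" "0 \<le> s" "0 \<le> \<delta>" "\<delta> \<le> 1 / 4"
    and c: "\<And>l. 0 \<le> c l" "\<And>l. c l \<le> real n * \<delta>"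
    and f: "\<And>i. i < n \<Longrightarrow> mf_field n \<beta> c i \<le> 1"
  shows "mf_value n \<rho> \<beta> c - real n * (exp 1 * \<rho> * s + \<bar>\<beta>' - \<beta>\<bar>) \<le> mf_value n (exp (- s) * \<rho>) \<beta>' c"
proof -
  define t where "t = \<bar>\<beta>' - \<beta>\<bar>"
  define a where "a i = 2 * ((\<Sum>l\<le>i. c l) / (real n)\<^sup>2)" for i
  have field: "mf_field n b c i = b * a i" for b i by (simp add: mf_field_def a_def)
  have a: "0 \<le> a i" "a i \<le> 2 * \<delta>" if "i < n" for i
    using mean_sum_le[of c n \<delta> i] that c assms(4) by (simp_all add: a_def sum_nonneg)
  have site: "ln (1 + \<rho> * exp (mf_field n \<beta> c i)) - exp 1 * \<rho> * s - t * (2 * \<delta>)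
      \<le> ln (1 + exp (- s) * \<rho> * exp (mf_field n \<beta>' c i))" if i: "i < n" for i
  proof -
    define q where "q = \<rho> * exp (\<beta> * a i)"
    define q' where "q' = exp (- s) * \<rho> * exp (\<beta>' * a i)"
    have q: "0 \<le> q" "q \<le> exp 1 * \<rho>" "0 \<le> q'"
    proof -
      show "0 \<le> q" "0 \<le> q'" using assms(2) by (auto simp: q_def q'_def)
      show "q \<le> exp 1 * \<rho>"
        using assms(2) f[OF i] mult_left_mono[of "exp (\<beta> * a i)" "exp 1" \<rho>]
        by (simp add: q_def field mult.commute)
    qed
    have "1 + q \<le> (1 + exp (- s) * q) * exp (exp 1 * \<rho> * s)"
    proof -
      have "1 + q \<le> (1 + exp (- s) * q) * (1 + q * s)"
      proof -
        have "q \<le> exp (- s) * q + q * s"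
          using q(1) mult_left_mono[OF exp_ge_add_one_self[of "- s"], of q] by (simp add: algebra_simps)
        moreover have "0 \<le> exp (- s) * q * (q * s)" using q assms by simp
        ultimately show ?thesis by (simp add: algebra_simps)
      qed
      also have "\<dots> \<le> (1 + exp (- s) * q) * exp (q * s)"
        using q by (intro mult_left_mono) auto
      also have "\<dots> \<le> (1 + exp (- s) * q) * exp (exp 1 * \<rho> * s)"
        using q assms by (intro mult_left_mono) (auto intro!: mult_right_mono)
      finally show ?thesis .
    qed
    also have "1 + exp (- s) * q \<le> (1 + q') * exp (t * (2 * \<delta>))"
    proof -
      have "\<beta> * a i - \<beta>' * a i \<le> t * a i"
        unfolding left_diff_distrib[symmetric] using a[OF i] by (intro mult_right_mono) (auto simp: t_def)
      also have "\<dots> \<le> t * (2 * \<delta>)" using a[OF i] by (intro mult_left_mono) (auto simp: t_def)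
      finally have "exp (\<beta> * a i) \<le> exp (\<beta>' * a i) * exp (t * (2 * \<delta>))" by (simp add: exp_add[symmetric])
      then have "exp (- s) * \<rho> * exp (\<beta> * a i) \<le> exp (- s) * \<rho> * (exp (\<beta>' * a i) * exp (t * (2 * \<delta>)))"
        using assms by (intro mult_left_mono) auto
      then have "exp (- s) * q \<le> q' * exp (t * (2 * \<delta>))"
        by (simp add: q_def q'_def mult_ac)
      moreover have "1 \<le> exp (t * (2 * \<delta>))" using assms by (simp add: t_def)
      ultimately show ?thesis unfolding distrib_right by linarith
    qed
    finally have "1 + q \<le> (1 + q') * exp (t * (2 * \<delta>)) * exp (exp 1 * \<rho> * s)" by simp
    then have "ln (1 + q) \<le> ln ((1 + q') * exp (t * (2 * \<delta>)) * exp (exp 1 * \<rho> * s))"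
      using q by (intro ln_mono) auto
    also have "\<dots> = ln (1 + q') + t * (2 * \<delta>) + exp 1 * \<rho> * s" using q by (simp add: ln_mult)
    finally show ?thesis by (simp add: q_def q'_def field)
  qed
  have "(\<Sum>i<n. ln (1 + \<rho> * exp (mf_field n \<beta> c i)) - exp 1 * \<rho> * s - t * (2 * \<delta>))
      \<le> (\<Sum>i<n. ln (1 + exp (- s) * \<rho> * exp (mf_field n \<beta>' c i)))"
    using site by (intro sum_mono) auto
  moreover have "(\<Sum>l<n. (c l)\<^sup>2) / (real n)\<^sup>2 \<le> real n * \<delta>\<^sup>2"
  proof -
    have "(\<Sum>l<n. (c l)\<^sup>2) \<le> (\<Sum>l<n. (real n * \<delta>)\<^sup>2)" using c by (intro sum_mono power_mono) auto
    then show ?thesis using assms(1) by (simp add: divide_le_eq power_mult_distrib mult_ac)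
  qed
  then have "(\<beta>' - \<beta>) * ((\<Sum>l<n. (c l)\<^sup>2) / (real n)\<^sup>2) \<le> t * (real n * \<delta>\<^sup>2)"
    by (intro mult_mono) (auto simp: t_def sum_nonneg)
  moreover have "t * (real n * \<delta>\<^sup>2) + real n * (t * (2 * \<delta>)) \<le> real n * t"
  proof -
    have "\<delta>\<^sup>2 + 2 * \<delta> \<le> 1" using assms mult_mono[of \<delta> "1 / 4" \<delta> "1 / 4"] by (simp add: power2_eq_square)
    then have "real n * t * (\<delta>\<^sup>2 + 2 * \<delta>) \<le> real n * t * 1" by (intro mult_left_mono) (auto simp: t_def)
    then show ?thesis by (simp add: algebra_simps)
  qed
  ultimately show ?thesis
    by (simp add: mf_value_def sum_subtractf t_def[symmetric] algebra_simps diff_divide_distrib)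
qed

lemma low_value_shift:
  assumes "low_domain \<epsilon> \<rho> \<beta>" "0 < n" "0 \<le> s" "0 \<le> \<beta>'"
  shows "low_value n \<rho> \<beta> / real n - (exp 1 * \<rho> * s + \<bar>\<beta>' - \<beta>\<bar>) \<le> log_part n (exp (- s) * \<rho>) \<beta>'"
proof -
  note dom = low_domainD[OF assms(1)]
  define c where "c = tail_sum n (mf_density n \<rho> \<beta> n)"
  have "mf_value n \<rho> \<beta> c - real n * (exp 1 * \<rho> * s + \<bar>\<beta>' - \<beta>\<bar>) \<le> mf_value n (exp (- s) * \<rho>) \<beta>' c"
    unfolding c_def using dom assms mf_density_bounds[OF assms(1)]
    by (intro mf_value_shift[where \<delta> = "exp 1 * \<rho>"]) (auto intro!: tail_sum_nonneg tail_sum_le)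
  then have "(low_value n \<rho> \<beta> - real n * (exp 1 * \<rho> * s + \<bar>\<beta>' - \<beta>\<bar>)) / real n \<le> mf_value n (exp (- s) * \<rho>) \<beta>' c / real n"
    unfolding low_value_def c_def by (intro divide_right_mono) auto
  also have "\<dots> \<le> log_part n (exp (- s) * \<rho>) \<beta>'"
    using dom assms by (intro mf_value_le_log_part) auto
  finally show ?thesis using assms(2) by (simp add: diff_divide_distrib)
qed

lemma pressure_decrease_low_phase:
  assumes "low_domain \<epsilon> \<rho> \<beta>" "low_phase \<rho> \<beta>" "0 \<le> s"
  shows "pressure \<rho> \<beta> - exp 1 * \<rho> * s \<le> pressure (exp (- s) * \<rho>) \<beta>"
proof (rule tendsto_le[OF trivial_limit_sequentially])
  note dom = low_domainD[OF assms(1)]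
  show "(\<lambda>n. log_part n (exp (- s) * \<rho>) \<beta>) \<longlonglongrightarrow> pressure (exp (- s) * \<rho>) \<beta>"
    using dom by (intro log_part_tendsto_pressure) auto
  show "(\<lambda>n. low_value n \<rho> \<beta> / real n - exp 1 * \<rho> * s) \<longlonglongrightarrow> pressure \<rho> \<beta> - exp 1 * \<rho> * s"
    using assms(2) unfolding low_phase_def by (intro tendsto_intros)
  show "\<forall>\<^sub>F n in sequentially. low_value n \<rho> \<beta> / real n - exp 1 * \<rho> * s \<le> log_part n (exp (- s) * \<rho>) \<beta>"
    using low_value_shift[OF assms(1) _ assms(3), of _ \<beta>] dom by (intro eventually_pos_nat) auto
qed

text \<open>Lowering \<open>ln \<rho>\<close> by \<open>s\<close> costs a dense configuration at least \<open>\<epsilon> s\<close> per site and the mean-field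
  value at most \<open>e \<rho> s\<close>; a change of \<open>\<beta>\<close> moves either by at most its own size. So the low-density
  phase contains a cone below each of its points.\<close>

lemma low_phase_cone:
  assumes "low_domain \<epsilon> \<rho> \<beta>" "low_phase \<rho> \<beta>" "low_domain \<epsilon> (exp (- s) * \<rho>) \<beta>'"
    and "0 \<le> s" "4 * \<bar>\<beta>' - \<beta>\<bar> < \<epsilon> * s"
  shows "low_phase (exp (- s) * \<rho>) \<beta>'"
proof (rule low_phaseI[OF assms(3)])
  note dom = low_domainD[OF assms(1)] and dom' = low_domainD[OF assms(3)]
  define t where "t = \<bar>\<beta>' - \<beta>\<bar>"
  have "s * (exp 1 * \<rho>) \<le> s * (\<epsilon> / 2)" using dom assms(4) by (intro mult_left_mono) auto
  then have pos: "0 < \<epsilon> * s - exp 1 * \<rho> * s - 2 * t" using assms(5) by (simp add: t_def algebra_simps)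
  have "(\<lambda>n. log_part n \<rho> \<beta> - low_value n \<rho> \<beta> / real n + ln 2 / real n) \<longlonglongrightarrow> pressure \<rho> \<beta> - pressure \<rho> \<beta> + 0"
    using dom assms(2) unfolding low_phase_def
    by (intro tendsto_add tendsto_diff log_part_tendsto_pressure) (auto, real_asymp)
  then have "\<forall>\<^sub>F n in sequentially. log_part n \<rho> \<beta> - low_value n \<rho> \<beta> / real n + ln 2 / real n < \<epsilon> * s - exp 1 * \<rho> * s - 2 * t"
    using pos by (intro order_tendstoD) auto
  then show "\<forall>\<^sub>F n in sequentially. 2 * weight_sum (dense \<epsilon> n) n (exp (- s) * \<rho>) \<beta>' < part_fun n (exp (- s) * \<rho>) \<beta>'"
    using eventually_gt_at_top[of 0]
  proof eventually_elim
    case (elim n)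
    have "weight_sum (dense \<epsilon> n) n (exp (- s) * \<rho>) \<beta>' \<le> exp (real n * t) * weight_sum (dense \<epsilon> n) n (exp (- s) * \<rho>) \<beta>"
      using weight_sum_shift_beta[of "dense \<epsilon> n" n "exp (- s) * \<rho>" \<beta> "\<beta>' - \<beta>"] dom
      by (auto simp: t_def dense_def)
    also have "\<dots> \<le> exp (real n * t) * (exp (- (s * \<epsilon> * n)) * weight_sum (dense \<epsilon> n) n \<rho> \<beta>)"
    proof (intro mult_left_mono)
      have "exp (s * \<epsilon> * n) * weight_sum (dense \<epsilon> n) n (exp (- s) * \<rho>) \<beta> \<le> weight_sum (dense \<epsilon> n) n \<rho> \<beta>"
      proof -
        have "exp s * (exp (- s) * \<rho>) = \<rho>" by (simp add: exp_minus field_simps)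
        moreover have "0 \<le> exp (- s) * \<rho>" using dom by simp
        ultimately show ?thesis using dense_shift_rho[of "exp (- s) * \<rho>" s \<epsilon> n \<beta>] assms(4) by metis
      qed
      then show "weight_sum (dense \<epsilon> n) n (exp (- s) * \<rho>) \<beta> \<le> exp (- (s * \<epsilon> * n)) * weight_sum (dense \<epsilon> n) n \<rho> \<beta>"
        by (simp add: exp_minus field_simps)
    qed simp
    also have "\<dots> \<le> exp (real n * t) * (exp (- (s * \<epsilon> * n)) * part_fun n \<rho> \<beta>)"
      using dom by (intro mult_left_mono weight_sum_mono_set) (auto simp: dense_def)
    also have "\<dots> = exp (real n * t - s * \<epsilon> * n + real n * log_part n \<rho> \<beta>)"
      using dom elim by (simp add: part_fun_eq_exp_log_part exp_add exp_diff exp_minus field_simps)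
    finally have "2 * weight_sum (dense \<epsilon> n) n (exp (- s) * \<rho>) \<beta>' \<le> exp (ln 2) * exp (real n * t - s * \<epsilon> * n + real n * log_part n \<rho> \<beta>)"
      by simp
    also have "\<dots> = exp (ln 2 + (real n * t - s * \<epsilon> * n + real n * log_part n \<rho> \<beta>))"
      by (rule exp_add[symmetric])
    also have "\<dots> < exp (real n * log_part n (exp (- s) * \<rho>) \<beta>')"
    proof -
      have "log_part n \<rho> \<beta> + ln 2 / real n < \<epsilon> * s - t + log_part n (exp (- s) * \<rho>) \<beta>'"
        using elim low_value_shift[OF assms(1) elim(2) assms(4), of \<beta>'] dom' by (simp add: t_def)
      then have "real n * (log_part n \<rho> \<beta> + ln 2 / real n) < real n * (\<epsilon> * s - t + log_part n (exp (- s) * \<rho>) \<beta>')"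
        using elim by (intro mult_strict_left_mono) auto
      then show ?thesis using elim by (simp add: algebra_simps)
    qed
    also have "\<dots> = part_fun n (exp (- s) * \<rho>) \<beta>'"
      using dom' elim by (simp add: part_fun_eq_exp_log_part)
    finally show ?case .
  qed
qed

text \<open>As \<open>\<beta>\<close> times the energy is at most \<open>\<beta>\<close> per occupied site, dense configurations are negligible when
  \<open>z = \<rho> e\<^bsup>\<beta>\<^esup>\<close> is small: \<open>z\<^bsup>|S|\<^esup> \<le> (\<surd>z)\<^bsup>|S|\<^esup> (\<surd>z)\<^bsup>\<epsilon>n\<^esup>\<close>.\<close>

lemma low_phase_small:
  assumes "low_domain \<epsilon> \<rho> \<beta>" and z: "sqrt (\<rho> * exp \<beta>) + \<epsilon> / 2 * ln (\<rho> * exp \<beta>) < 0"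
  shows "low_phase \<rho> \<beta>"
proof (rule low_phaseI[OF assms(1)])
  note dom = low_domainD[OF assms(1)]
  define y where "y = sqrt (\<rho> * exp \<beta>)"
  have y: "0 < y" "\<rho> * exp \<beta> = y\<^sup>2" using dom by (auto simp: y_def)
  have neg: "y + \<epsilon> * ln y < 0" using z y by (simp add: y_def[symmetric] ln_realpow)
  have "y \<le> 1"
  proof (rule ccontr)
    assume "\<not> y \<le> 1"
    then have "0 \<le> \<epsilon> * ln y" using dom by simp
    with neg y show False by linarith
  qed
  have bound: "weight_sum (dense \<epsilon> n) n \<rho> \<beta> \<le> exp (real n * (y + \<epsilon> * ln y))" for n
  proof -
    have "weight_sum (dense \<epsilon> n) n \<rho> \<beta> \<le> (\<Sum>S\<in>dense \<epsilon> n. exp (\<epsilon> * n * ln y) * y ^ card S)"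
      unfolding weight_sum_def
    proof (rule sum_mono)
      fix S assume S: "S \<in> dense \<epsilon> n"
      then have "\<beta> * energy n S \<le> \<beta> * real (card S)"
        using dom by (intro mult_left_mono energy_le_card) (auto simp: dense_def)
      then have "\<rho> ^ card S * exp (\<beta> * energy n S) \<le> \<rho> ^ card S * exp (\<beta> * real (card S))"
        using dom by (intro mult_left_mono) auto
      also have "\<dots> = y ^ card S * y ^ card S"
        using y by (simp add: exp_of_nat2_mult power_mult_distrib[symmetric] power2_eq_square)
      finally have "\<rho> ^ card S * exp (\<beta> * energy n S) \<le> y ^ card S * y ^ card S" .
      also have "\<dots> \<le> exp (\<epsilon> * n * ln y) * y ^ card S"
      proof (rule mult_right_mono)
        have "y ^ card S = exp (real (card S) * ln y)" using y by (simp add: exp_of_nat_mult)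
        also have "\<dots> \<le> exp (\<epsilon> * n * ln y)"
          using S y \<open>y \<le> 1\<close> by (auto simp: dense_def intro!: mult_right_mono_neg)
        finally show "y ^ card S \<le> exp (\<epsilon> * n * ln y)" .
      qed (use y in simp)
      finally show "\<rho> ^ card S * exp (\<beta> * energy n S) \<le> exp (\<epsilon> * n * ln y) * y ^ card S" .
    qed
    also have "\<dots> \<le> (\<Sum>S\<in>Pow {..<n}. exp (\<epsilon> * n * ln y) * y ^ card S)"
      using y by (intro sum_mono2) (auto simp: dense_def)
    also have "\<dots> = exp (\<epsilon> * n * ln y) * (1 + y) ^ n"
      using sum_Pow_prod[of "{..<n}" "\<lambda>_. y"] by (simp add: sum_distrib_left[symmetric])
    also have "\<dots> \<le> exp (\<epsilon> * n * ln y) * exp y ^ n"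
      using y by (intro mult_left_mono power_mono) auto
    also have "\<dots> = exp (real n * (y + \<epsilon> * ln y))"
      by (simp add: exp_of_nat_mult[symmetric] exp_add[symmetric] algebra_simps)
    finally show ?thesis .
  qed
  have "(\<lambda>n. exp (real n * (y + \<epsilon> * ln y))) \<longlonglongrightarrow> 0" using neg by real_asymp
  then have "\<forall>\<^sub>F n in sequentially. exp (real n * (y + \<epsilon> * ln y)) < 1 / 2" by (rule order_tendstoD) simp
  then show "\<forall>\<^sub>F n in sequentially. 2 * weight_sum (dense \<epsilon> n) n \<rho> \<beta> < part_fun n \<rho> \<beta>"
  proof eventually_elim
    case (elim n)
    then show ?case using bound[of n] part_fun_ge_1[of \<rho> n \<beta>] dom by linarith
  qed
qed

lemma sum_squares_ge: "real n ^ 3 / 3 \<le> (\<Sum>l<n. (real (n - l))\<^sup>2)"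
proof -
  have "(\<Sum>l<n. (real (n - l))\<^sup>2) = (\<Sum>l<n. (real (Suc l))\<^sup>2)"
    by (rule sum.reindex_bij_witness[of _ "\<lambda>l. n - Suc l" "\<lambda>l. n - Suc l"]) auto
  also have "real n ^ 3 / 3 \<le> (\<Sum>l<n. (real (Suc l))\<^sup>2)"
    by (induction n) (auto simp: power2_eq_square power3_eq_cube algebra_simps)
  finally show ?thesis .
qed

text \<open>The configuration with all sites occupied has energy about \<open>n / 3\<close>.\<close>

lemma pressure_ge_full:
  assumes "0 < \<rho>" "0 \<le> \<beta>"
  shows "ln \<rho> + \<beta> / 3 \<le> pressure \<rho> \<beta>"
proof (rule tendsto_lowerbound[OF log_part_tendsto_pressure])
  show "\<forall>\<^sub>F n in sequentially. ln \<rho> + \<beta> / 3 \<le> log_part n \<rho> \<beta>"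
  proof (rule eventually_pos_nat)
    fix n :: nat assume n: "0 < n"
    have "{i \<in> {..<n}. l \<le> i} = {l..<n}" for l by auto
    then have "real n / 3 \<le> energy n {..<n}"
      using n sum_squares_ge[of n]
      by (simp add: energy_def tail_count_def le_divide_eq power2_eq_square power3_eq_cube)
    then have "\<beta> * (real n / 3) \<le> \<beta> * energy n {..<n}"
      using assms by (intro mult_left_mono) auto
    then have "exp (real n * (\<beta> / 3)) \<le> exp (\<beta> * energy n {..<n})" by (simp add: mult.commute)
    then have "exp (real n * ln \<rho>) * exp (real n * (\<beta> / 3)) \<le> \<rho> ^ n * exp (\<beta> * energy n {..<n})"
      using assms by (intro mult_mono) (auto simp: exp_of_nat_mult)
    then have "exp (real n * (ln \<rho> + \<beta> / 3)) \<le> weight_sum {{..<n}} n \<rho> \<beta>"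
      by (simp add: weight_sum_def exp_add[symmetric] distrib_left)
    also have "\<dots> \<le> part_fun n \<rho> \<beta>" using assms by (intro weight_sum_mono_set) auto
    finally show "ln \<rho> + \<beta> / 3 \<le> log_part n \<rho> \<beta>"
      using part_fun_eq_exp_log_part[of \<rho> n \<beta>] assms n by simp
  qed
qed (use assms in auto)

lemma not_low_phase_large:
  assumes "low_domain \<epsilon> \<rho> \<beta>" "exp 1 * \<rho> < ln \<rho> + \<beta> / 3"
  shows "\<not> low_phase \<rho> \<beta>"
proof
  note dom = low_domainD[OF assms(1)]
  assume "low_phase \<rho> \<beta>"
  then have "(\<lambda>n. low_value n \<rho> \<beta> / real n) \<longlonglongrightarrow> pressure \<rho> \<beta>" by (simp add: low_phase_def)
  moreover have "\<forall>\<^sub>F n in sequentially. low_value n \<rho> \<beta> / real n \<le> exp 1 * \<rho>"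
  proof (rule eventually_pos_nat)
    fix n :: nat assume n: "0 < n"
    let ?c = "tail_sum n (mf_density n \<rho> \<beta> n)"
    have "low_value n \<rho> \<beta> \<le> (\<Sum>i<n. ln (1 + \<rho> * exp (mf_field n \<beta> ?c i)))"
      using dom by (simp add: low_value_def mf_value_def sum_nonneg)
    also have "\<dots> \<le> (\<Sum>i<n. exp 1 * \<rho>)"
    proof (rule sum_mono)
      fix i assume "i \<in> {..<n}"
      then have "\<rho> * exp (mf_field n \<beta> ?c i) \<le> exp 1 * \<rho>"
        using mf_density_bounds(4)[OF assms(1), of i n n] dom by simp
      moreover have "ln (1 + \<rho> * exp (mf_field n \<beta> ?c i)) \<le> \<rho> * exp (mf_field n \<beta> ?c i)"
        using dom by (intro ln_add_one_self_le_self) auto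
      ultimately show "ln (1 + \<rho> * exp (mf_field n \<beta> ?c i)) \<le> exp 1 * \<rho>" by linarith
    qed
    finally show "low_value n \<rho> \<beta> / real n \<le> exp 1 * \<rho>" using n by (simp add: divide_le_eq mult_ac)
  qed
  ultimately have "pressure \<rho> \<beta> \<le> exp 1 * \<rho>" by (intro tendsto_upperbound) auto
  then show False using pressure_ge_full[of \<rho> \<beta>] assms(2) dom by linarith
qed

section \<open>Double power series with bounded absolute sum\<close>

abbreviation monom2 :: "real \<Rightarrow> real \<Rightarrow> nat \<times> nat \<Rightarrow> real" where
  "monom2 s t a \<equiv> s ^ fst a * t ^ snd a"

text \<open>The functions on a square around \<open>(x0, y0)\<close> whose power series has absolute sum at most \<open>N\<close> at the
corner: a ball of a Banach algebra. Working with this norm gives analyticity in both variables at once,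
with bounds that do not depend on the size of the system.\<close>

definition series_bounded :: "real \<Rightarrow> real \<Rightarrow> real \<Rightarrow> real \<Rightarrow> (real \<Rightarrow> real \<Rightarrow> real) \<Rightarrow> bool" where
  "series_bounded x0 y0 r N f \<longleftrightarrow> (\<exists>c :: nat \<times> nat \<Rightarrow> real.
     (\<forall>A. finite A \<longrightarrow> (\<Sum>a\<in>A. \<bar>c a\<bar> * monom2 r r a) \<le> N) \<and>
     (\<forall>x y. \<bar>x - x0\<bar> < r \<and> \<bar>y - y0\<bar> < r \<longrightarrow>
        ((\<lambda>a. c a * monom2 (x - x0) (y - y0) a) has_sum f x y) UNIV))"

lemma summable_on_if_bounded_sums:
  fixes f :: "'i \<Rightarrow> real"
  assumes "\<And>A. finite A \<Longrightarrow> A \<subseteq> I \<Longrightarrow> (\<Sum>i\<in>A. \<bar>f i\<bar>) \<le> N"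
  shows "f summable_on I"
proof -
  have "(\<lambda>i. \<bar>f i\<bar>) summable_on I"
  proof (rule nonneg_bdd_above_summable_on)
    show "bdd_above (sum (\<lambda>i. \<bar>f i\<bar>) ` {F. F \<subseteq> I \<and> finite F})"
      by (rule bdd_aboveI2[of _ _ N]) (use assms in blast)
  qed simp
  then show ?thesis using summable_on_iff_abs_summable_on_real[of f I] by simp
qed

lemma abs_monom2_le:
  assumes "\<bar>s\<bar> \<le> r" "\<bar>t\<bar> \<le> r"
  shows "\<bar>monom2 s t a\<bar> \<le> monom2 r r a"
  unfolding abs_mult power_abs by (intro mult_mono power_mono) (use assms in auto)

lemma summable_series:
  assumes "\<And>A. finite A \<Longrightarrow> A \<subseteq> I \<Longrightarrow> (\<Sum>i\<in>A. \<bar>w i\<bar> * monom2 r r (e i)) \<le> N" "\<bar>s\<bar> \<le> r" "\<bar>t\<bar> \<le> r"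
  shows "(\<lambda>i. w i * monom2 s t (e i)) summable_on I"
proof (rule summable_on_if_bounded_sums)
  fix A assume A: "finite A" "A \<subseteq> I"
  have "(\<Sum>i\<in>A. \<bar>w i * monom2 s t (e i)\<bar>) \<le> (\<Sum>i\<in>A. \<bar>w i\<bar> * monom2 r r (e i))"
  proof (rule sum_mono)
    fix i
    show "\<bar>w i * monom2 s t (e i)\<bar> \<le> \<bar>w i\<bar> * monom2 r r (e i)"
      using abs_monom2_le[OF assms(2,3), of "e i"] unfolding abs_mult[of "w i"] by (intro mult_left_mono) auto
  qed
  also have "\<dots> \<le> N" using assms(1)[OF A] .
  finally show "(\<Sum>i\<in>A. \<bar>w i * monom2 s t (e i)\<bar>) \<le> N" .
qed

text \<open>Sorting an arbitrary absolutely bounded family of monomial terms by exponent gives a power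
  series; products and infinite sums of series are the instances used below.\<close>

lemma series_bounded_regroup:
  fixes e :: "'i \<Rightarrow> nat \<times> nat" and w :: "'i \<Rightarrow> real"
  assumes r: "0 < r"
    and bound: "\<And>A. finite A \<Longrightarrow> A \<subseteq> I \<Longrightarrow> (\<Sum>i\<in>A. \<bar>w i\<bar> * monom2 r r (e i)) \<le> N"
    and sum: "\<And>x y. \<bar>x - x0\<bar> < r \<Longrightarrow> \<bar>y - y0\<bar> < r \<Longrightarrow>
      ((\<lambda>i. w i * monom2 (x - x0) (y - y0) (e i)) has_sum f x y) I"
  shows "series_bounded x0 y0 r N f"
proof -
  define J where "J a = {i \<in> I. e i = a}" for a
  define c where "c a = infsum w (J a)" for a
  have abs_summable: "(\<lambda>i. \<bar>w i\<bar> * monom2 r r (e i)) summable_on I"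
    using r by (intro summable_on_if_bounded_sums[of _ _ N]) (simp add: abs_mult bound)
  have wJ: "(\<lambda>i. \<bar>w i\<bar>) summable_on J a" for a
  proof -
    have "(\<lambda>i. \<bar>w i\<bar> * monom2 r r (e i)) summable_on J a"
      by (rule summable_on_subset_banach[OF abs_summable]) (auto simp: J_def)
    then have "(\<lambda>i. \<bar>w i\<bar> * monom2 r r a) summable_on J a"
      by (rule summable_on_cong[THEN iffD1, rotated]) (simp add: J_def)
    then show ?thesis using r by (simp add: summable_on_cmult_left')
  qed
  have wJ': "w summable_on J a" for a using wJ[of a] summable_on_iff_abs_summable_on_real[of w "J a"] by simp
  have "(\<Sum>a\<in>A. \<bar>c a\<bar> * monom2 r r a) \<le> N" if "finite A" for A
  proof -
    have "(\<Sum>a\<in>A. \<bar>c a\<bar> * monom2 r r a) \<le> (\<Sum>a\<in>A. infsum (\<lambda>i. \<bar>w i\<bar> * monom2 r r (e i)) (J a))"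
    proof (rule sum_mono)
      fix a
      have "\<bar>c a\<bar> \<le> infsum (\<lambda>i. \<bar>w i\<bar>) (J a)"
        unfolding c_def using norm_infsum_bound[of w "J a"] wJ[of a] by simp
      then have "\<bar>c a\<bar> * monom2 r r a \<le> infsum (\<lambda>i. \<bar>w i\<bar>) (J a) * monom2 r r a"
        using r by (intro mult_right_mono) auto
      also have "\<dots> = infsum (\<lambda>i. \<bar>w i\<bar> * monom2 r r a) (J a)"
        by (rule infsum_cmult_left[symmetric]) (rule wJ)
      also have "\<dots> = infsum (\<lambda>i. \<bar>w i\<bar> * monom2 r r (e i)) (J a)"
        by (rule infsum_cong) (simp add: J_def)
      finally show "\<bar>c a\<bar> * monom2 r r a \<le> infsum (\<lambda>i. \<bar>w i\<bar> * monom2 r r (e i)) (J a)" .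
    qed
    also have "\<dots> = infsum (\<lambda>i. \<bar>w i\<bar> * monom2 r r (e i)) (\<Union>a\<in>A. J a)"
      using that by (intro sum_infsum summable_on_subset_banach[OF abs_summable]) (auto simp: J_def)
    also have "\<dots> \<le> N"
    proof (rule infsum_le_finite_sums)
      show "(\<lambda>i. \<bar>w i\<bar> * monom2 r r (e i)) summable_on (\<Union>a\<in>A. J a)"
        by (rule summable_on_subset_banach[OF abs_summable]) (auto simp: J_def)
      show "(\<Sum>i\<in>F. \<bar>w i\<bar> * monom2 r r (e i)) \<le> N" if "finite F" "F \<subseteq> (\<Union>a\<in>A. J a)" for F
        using that by (intro bound) (auto simp: J_def)
    qed
    finally show ?thesis .
  qed
  moreover have "((\<lambda>a. c a * monom2 (x - x0) (y - y0) a) has_sum f x y) UNIV"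
    if xy: "\<bar>x - x0\<bar> < r" "\<bar>y - y0\<bar> < r" for x y
  proof (rule has_sum_SigmaD)
    have inj: "inj_on (\<lambda>i. (e i, i)) I" by (auto intro: inj_onI)
    have img: "(\<lambda>i. (e i, i)) ` I = Sigma UNIV J" by (force simp: J_def)
    show "((\<lambda>(a, i). w i * monom2 (x - x0) (y - y0) a) has_sum f x y) (Sigma UNIV J)"
      unfolding img[symmetric] has_sum_reindex[OF inj] using sum[OF xy] by (simp add: o_def)
    show "((\<lambda>i. (\<lambda>(a, i). w i * monom2 (x - x0) (y - y0) a) (a, i)) has_sum c a * monom2 (x - x0) (y - y0) a) (J a)" for a
      unfolding c_def prod.case by (intro has_sum_cmult_left has_sum_infsum wJ')
  qed
  ultimately show ?thesis unfolding series_bounded_def by (intro exI[of _ c]) auto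
qed

lemma series_boundedE:
  assumes "series_bounded x0 y0 r N f"
  obtains c where "\<And>A. finite A \<Longrightarrow> (\<Sum>a\<in>A. \<bar>c a\<bar> * monom2 r r a) \<le> N"
    "\<And>x y. \<bar>x - x0\<bar> < r \<Longrightarrow> \<bar>y - y0\<bar> < r \<Longrightarrow> ((\<lambda>a. c a * monom2 (x - x0) (y - y0) a) has_sum f x y) UNIV"
  using assms unfolding series_bounded_def by blast

lemma series_bounded_nonneg: "series_bounded x0 y0 r N f \<Longrightarrow> 0 \<le> N"
  by (erule series_boundedE) (metis finite.emptyI sum.empty)

lemma series_bounded_mono: "series_bounded x0 y0 r N f \<Longrightarrow> N \<le> N' \<Longrightarrow> series_bounded x0 y0 r N' f"
  unfolding series_bounded_def by (elim exE conjE, rule_tac x = c in exI) (auto intro: order_trans)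

lemma series_bounded_abs_le:
  assumes "series_bounded x0 y0 r N f" "\<bar>x - x0\<bar> < r" "\<bar>y - y0\<bar> < r"
  shows "\<bar>f x y\<bar> \<le> N"
proof -
  obtain c where c: "\<And>A. finite A \<Longrightarrow> (\<Sum>a\<in>A. \<bar>c a\<bar> * monom2 r r a) \<le> N"
    "((\<lambda>a. c a * monom2 (x - x0) (y - y0) a) has_sum f x y) UNIV"
    using assms by (elim series_boundedE) auto
  have *: "(\<Sum>a\<in>A. \<bar>c a * monom2 (x - x0) (y - y0) a\<bar>) \<le> N" if "finite A" for A
  proof -
    have "(\<Sum>a\<in>A. \<bar>c a * monom2 (x - x0) (y - y0) a\<bar>) \<le> (\<Sum>a\<in>A. \<bar>c a\<bar> * monom2 r r a)"
      unfolding abs_mult[of "c _"] using assms by (intro sum_mono mult_left_mono abs_monom2_le) auto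
    then show ?thesis using c(1)[OF that] by simp
  qed
  then have "(\<lambda>a. norm (c a * monom2 (x - x0) (y - y0) a)) summable_on UNIV"
    by (intro summable_on_if_bounded_sums) auto
  then have "norm (f x y) \<le> infsum (\<lambda>a. norm (c a * monom2 (x - x0) (y - y0) a)) UNIV"
    by (intro norm_has_sum_bound[OF _ c(2)]) auto
  also have "\<dots> \<le> N"
    using * \<open>(\<lambda>a. norm (c a * monom2 (x - x0) (y - y0) a)) summable_on UNIV\<close>
    by (intro infsum_le_finite_sums) auto
  finally show ?thesis by simp
qed

lemma series_bounded_single:
  assumes "0 < r" "\<bar>v\<bar> * monom2 r r a0 \<le> N"
  shows "series_bounded x0 y0 r N (\<lambda>x y. v * monom2 (x - x0) (y - y0) a0)"
proof (rule series_bounded_regroup[OF assms(1), where I = "{()}" and w = "\<lambda>_. v" and e = "\<lambda>_. a0"])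
  fix A :: "unit set" assume "A \<subseteq> {()}"
  then have "A = {} \<or> A = {()}" by auto
  moreover have "0 \<le> \<bar>v\<bar> * monom2 r r a0" using assms by simp
  then have "0 \<le> N" using assms(2) by linarith
  ultimately show "(\<Sum>i\<in>A. \<bar>v\<bar> * monom2 r r a0) \<le> N" using assms by auto
qed (auto intro: has_sum_finiteI)

lemma series_bounded_const: "0 < r \<Longrightarrow> series_bounded x0 y0 r \<bar>v\<bar> (\<lambda>x y. v)"
  using series_bounded_single[of r v "(0, 0)" "\<bar>v\<bar>" x0 y0] by simp

lemma series_bounded_infinite_sum:
  assumes r: "0 < r"
    and f: "\<And>k. k \<in> K \<Longrightarrow> series_bounded x0 y0 r (N k) (f k)"
    and N: "\<And>A. finite A \<Longrightarrow> A \<subseteq> K \<Longrightarrow> sum N A \<le> T"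
    and g: "\<And>x y. \<bar>x - x0\<bar> < r \<Longrightarrow> \<bar>y - y0\<bar> < r \<Longrightarrow> ((\<lambda>k. f k x y) has_sum g x y) K"
  shows "series_bounded x0 y0 r T g"
proof -
  have "\<forall>k\<in>K. \<exists>c. (\<forall>A. finite A \<longrightarrow> (\<Sum>a\<in>A. \<bar>c a\<bar> * monom2 r r a) \<le> N k) \<and>
     (\<forall>x y. \<bar>x - x0\<bar> < r \<and> \<bar>y - y0\<bar> < r \<longrightarrow>
        ((\<lambda>a. c a * monom2 (x - x0) (y - y0) a) has_sum f k x y) UNIV)"
    using f unfolding series_bounded_def by blast
  then obtain c where *: "\<forall>k\<in>K. (\<forall>A. finite A \<longrightarrow> (\<Sum>a\<in>A. \<bar>c k a\<bar> * monom2 r r a) \<le> N k) \<and>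
     (\<forall>x y. \<bar>x - x0\<bar> < r \<and> \<bar>y - y0\<bar> < r \<longrightarrow>
        ((\<lambda>a. c k a * monom2 (x - x0) (y - y0) a) has_sum f k x y) UNIV)"
    unfolding bchoice_iff by (elim exE)
  then have c: "(\<Sum>a\<in>A. \<bar>c k a\<bar> * monom2 r r a) \<le> N k" if "k \<in> K" "finite A" for k A
    using that by simp
  have sum: "((\<lambda>a. c k a * monom2 (x - x0) (y - y0) a) has_sum f k x y) UNIV"
    if "k \<in> K" "\<bar>x - x0\<bar> < r" "\<bar>y - y0\<bar> < r" for k x y
    using * that by simp
  define w where "w i = c (fst i) (snd i)" for i
  have bound: "(\<Sum>i\<in>A. \<bar>w i\<bar> * monom2 r r (snd i)) \<le> T" if "finite A" "A \<subseteq> K \<times> UNIV" for A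
  proof -
    have "(\<Sum>i\<in>A. \<bar>w i\<bar> * monom2 r r (snd i)) \<le> (\<Sum>i\<in>fst ` A \<times> snd ` A. \<bar>w i\<bar> * monom2 r r (snd i))"
      using that r by (intro sum_mono2) (auto intro!: finite_cartesian_product rev_image_eqI)
    also have "\<dots> = (\<Sum>k\<in>fst ` A. \<Sum>a\<in>snd ` A. \<bar>c k a\<bar> * monom2 r r a)"
      by (simp add: sum.cartesian_product w_def case_prod_beta)
    also have "\<dots> \<le> (\<Sum>k\<in>fst ` A. N k)" using that by (intro sum_mono c) auto
    also have "\<dots> \<le> T" using that by (intro N) auto
    finally show ?thesis .
  qed
  show ?thesis
  proof (rule series_bounded_regroup[OF r bound])
    fix x y :: real assume xy: "\<bar>x - x0\<bar> < r" "\<bar>y - y0\<bar> < r"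
    show "((\<lambda>i. w i * monom2 (x - x0) (y - y0) (snd i)) has_sum g x y) (K \<times> UNIV)"
    proof (rule has_sum_SigmaI)
      show "(\<lambda>i. w i * monom2 (x - x0) (y - y0) (snd i)) summable_on K \<times> UNIV"
        using xy by (intro summable_series[OF bound]) auto
      show "((\<lambda>k. f k x y) has_sum g x y) K" by (rule g[OF xy])
      show "((\<lambda>a. w (k, a) * monom2 (x - x0) (y - y0) (snd (k, a))) has_sum f k x y) UNIV" if "k \<in> K" for k
        using sum[OF that xy] by (simp add: w_def)
    qed
  qed
qed

lemma series_bounded_mult:
  assumes r: "0 < r" and "series_bounded x0 y0 r M f" "series_bounded x0 y0 r N g"
  shows "series_bounded x0 y0 r (M * N) (\<lambda>x y. f x y * g x y)"
proof -
  obtain c where c: "\<And>A. finite A \<Longrightarrow> (\<Sum>a\<in>A. \<bar>c a\<bar> * monom2 r r a) \<le> M"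
    "\<And>x y. \<bar>x - x0\<bar> < r \<Longrightarrow> \<bar>y - y0\<bar> < r \<Longrightarrow> ((\<lambda>a. c a * monom2 (x - x0) (y - y0) a) has_sum f x y) UNIV"
    using series_boundedE[OF assms(2)] by blast
  obtain d where d: "\<And>A. finite A \<Longrightarrow> (\<Sum>a\<in>A. \<bar>d a\<bar> * monom2 r r a) \<le> N"
    "\<And>x y. \<bar>x - x0\<bar> < r \<Longrightarrow> \<bar>y - y0\<bar> < r \<Longrightarrow> ((\<lambda>a. d a * monom2 (x - x0) (y - y0) a) has_sum g x y) UNIV"
    using series_boundedE[OF assms(3)] by blast
  define e where "e i = (fst (fst i) + fst (snd i), snd (fst i) + snd (snd i))" for i :: "(nat \<times> nat) \<times> (nat \<times> nat)"
  define w where "w i = c (fst i) * d (snd i)" for i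
  have M0: "0 \<le> M" by (rule series_bounded_nonneg[OF assms(2)])
  have mon: "monom2 s t (e i) = monom2 s t (fst i) * monom2 s t (snd i)" for s t i
    by (simp add: e_def power_add)
  have bound: "(\<Sum>i\<in>A. \<bar>w i\<bar> * monom2 r r (e i)) \<le> M * N" if "finite A" for A
  proof -
    have "(\<Sum>i\<in>A. \<bar>w i\<bar> * monom2 r r (e i)) \<le> (\<Sum>i\<in>fst ` A \<times> snd ` A. \<bar>w i\<bar> * monom2 r r (e i))"
      using that r by (intro sum_mono2) (auto intro!: finite_cartesian_product rev_image_eqI)
    also have "\<dots> = (\<Sum>a\<in>fst ` A. \<bar>c a\<bar> * monom2 r r a) * (\<Sum>b\<in>snd ` A. \<bar>d b\<bar> * monom2 r r b)"
      unfolding sum_product sum.cartesian_product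
      by (intro sum.cong refl) (auto simp: w_def mon abs_mult case_prod_beta mult_ac)
    also have "\<dots> \<le> M * N"
      using that r M0 by (intro mult_mono c d sum_nonneg) auto
    finally show ?thesis .
  qed
  show ?thesis
  proof (rule series_bounded_regroup[OF r bound])
    fix x y :: real assume xy: "\<bar>x - x0\<bar> < r" "\<bar>y - y0\<bar> < r"
    let ?m = "monom2 (x - x0) (y - y0)"
    show "((\<lambda>i. w i * ?m (e i)) has_sum f x y * g x y) (UNIV \<times> UNIV)"
    proof (rule has_sum_SigmaI)
      show "(\<lambda>i. w i * ?m (e i)) summable_on UNIV \<times> UNIV"
        using xy bound by (intro summable_series[of _ w r e "M * N"]) auto
      show "((\<lambda>a. c a * ?m a * g x y) has_sum f x y * g x y) UNIV"
        by (rule has_sum_cmult_left[OF c(2)[OF xy]])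
      show "((\<lambda>b. w (a, b) * ?m (e (a, b))) has_sum c a * ?m a * g x y) UNIV" for a
        using has_sum_cmult_right[OF d(2)[OF xy], of "c a * ?m a"] by (simp add: w_def mon mult_ac)
    qed
  qed
qed

lemma series_bounded_power:
  assumes "0 < r" "series_bounded x0 y0 r N f"
  shows "series_bounded x0 y0 r (N ^ k) (\<lambda>x y. f x y ^ k)"
proof (induction k)
  case 0
  then show ?case using series_bounded_const[OF assms(1), of x0 y0 1] by simp
next
  case (Suc k)
  then show ?case using series_bounded_mult[OF assms Suc] by simp
qed

lemma series_bounded_cmult:
  assumes "0 < r" "series_bounded x0 y0 r N f"
  shows "series_bounded x0 y0 r (\<bar>v\<bar> * N) (\<lambda>x y. v * f x y)"
  by (rule series_bounded_mult[OF assms(1) series_bounded_const[OF assms(1)] assms(2)])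

lemma series_bounded_sum:
  assumes "0 < r" "finite K" "\<And>k. k \<in> K \<Longrightarrow> series_bounded x0 y0 r (N k) (f k)"
  shows "series_bounded x0 y0 r (sum N K) (\<lambda>x y. \<Sum>k\<in>K. f k x y)"
proof (rule series_bounded_infinite_sum[OF assms(1,3)])
  show "sum N A \<le> sum N K" if "A \<subseteq> K" for A
    using assms(2,3) that series_bounded_nonneg by (intro sum_mono2) blast+
qed (use assms(2) in auto)

lemma series_bounded_diff:
  assumes "0 < r" "series_bounded x0 y0 r M f" "series_bounded x0 y0 r N g"
  shows "series_bounded x0 y0 r (M + N) (\<lambda>x y. f x y - g x y)"
proof -
  have "series_bounded x0 y0 r (\<bar>-1\<bar> * N) (\<lambda>x y. (-1) * g x y)"
    by (rule series_bounded_cmult[OF assms(1,3)])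
  then have *: "series_bounded x0 y0 r N (\<lambda>x y. - g x y)" by simp
  have "series_bounded x0 y0 r (\<Sum>b\<in>UNIV. if b then M else N) (\<lambda>x y. \<Sum>b\<in>UNIV. if b then f x y else - g x y)"
    by (rule series_bounded_sum[OF assms(1)]) (use * assms(2) in \<open>auto split: if_splits\<close>)
  then show ?thesis by (simp add: UNIV_bool add.commute[of N])
qed

text \<open>Substitution into a one-variable series, term by term; the norm of a power is at most the power of the
norm.\<close>

lemma series_bounded_compose:
  assumes r: "0 < r" and f: "series_bounded x0 y0 r N f"
    and T: "\<And>A. finite A \<Longrightarrow> (\<Sum>k\<in>A. \<bar>b k\<bar> * N ^ k) \<le> T"
    and h: "\<And>z. \<bar>z\<bar> \<le> N \<Longrightarrow> (\<lambda>k. b k * z ^ k) sums h z"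
  shows "series_bounded x0 y0 r T (\<lambda>x y. h (f x y))"
proof (rule series_bounded_infinite_sum[OF r, where K = UNIV])
  show "series_bounded x0 y0 r (\<bar>b k\<bar> * N ^ k) (\<lambda>x y. b k * f x y ^ k)" for k
    by (intro series_bounded_cmult series_bounded_power r f)
  fix x y :: real assume xy: "\<bar>x - x0\<bar> < r" "\<bar>y - y0\<bar> < r"
  have le: "\<bar>f x y\<bar> \<le> N" by (rule series_bounded_abs_le[OF f xy])
  have "(\<lambda>k. b k * f x y ^ k) summable_on UNIV"
  proof (rule summable_on_if_bounded_sums)
    fix A :: "nat set" assume A: "finite A"
    have "(\<Sum>k\<in>A. \<bar>b k * f x y ^ k\<bar>) \<le> (\<Sum>k\<in>A. \<bar>b k\<bar> * N ^ k)"
      using le by (intro sum_mono) (auto simp: abs_mult power_abs intro!: mult_left_mono power_mono)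
    then show "(\<Sum>k\<in>A. \<bar>b k * f x y ^ k\<bar>) \<le> T" using T[OF A] by simp
  qed
  then have "((\<lambda>k. b k * f x y ^ k) has_sum infsum (\<lambda>k. b k * f x y ^ k) UNIV) UNIV" by simp
  moreover from has_sum_imp_sums[OF this] h[OF le]
  have "infsum (\<lambda>k. b k * f x y ^ k) UNIV = h (f x y)" by (rule sums_unique2)
  ultimately show "((\<lambda>k. b k * f x y ^ k) has_sum h (f x y)) UNIV" by simp
qed (use T in auto)

lemma sum_le_if_sums:
  fixes u :: "nat \<Rightarrow> real"
  assumes "u sums T" "\<And>k. 0 \<le> u k" "finite A"
  shows "sum u A \<le> T"
  using sum_le_suminf[OF sums_summable[OF assms(1)] assms(3)] assms(2) sums_unique[OF assms(1)] by auto

lemma series_bounded_exp: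
  assumes "0 < r" "series_bounded x0 y0 r N f"
  shows "series_bounded x0 y0 r (exp N) (\<lambda>x y. exp (f x y))"
proof (rule series_bounded_compose[OF assms, where b = "\<lambda>k. 1 / fact k"])
  have exp_sums: "(\<lambda>k. 1 / fact k * z ^ k) sums exp z" for z :: real
    using exp_converges[of z] by (simp add: divide_inverse)
  show "(\<lambda>k. 1 / fact k * z ^ k) sums exp z" for z :: real by (rule exp_sums)
  show "(\<Sum>k\<in>A. \<bar>1 / fact k\<bar> * N ^ k) \<le> exp N" if "finite A" for A
    using sum_le_if_sums[OF exp_sums _ that, of N] series_bounded_nonneg[OF assms(2)] by simp
qed

lemma geometric_shifted_sums: "\<bar>z\<bar> < 1 \<Longrightarrow> (\<lambda>k. (if k = 0 then 0 else 1) * z ^ k) sums (z / (1 - z))" for z :: real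
proof -
  assume z: "\<bar>z\<bar> < 1"
  then have "(\<lambda>k. z * z ^ k) sums (z * (1 / (1 - z)))" by (intro sums_mult geometric_sums) auto
  then have "(\<lambda>k. (if Suc k = 0 then 0 else 1) * z ^ Suc k) sums (z / (1 - z))" by simp
  then show ?thesis by (subst (asm) sums_Suc_iff) simp
qed

lemma series_bounded_fraction:
  assumes "0 < r" "series_bounded x0 y0 r N f" "N < 1"
  shows "series_bounded x0 y0 r (N / (1 - N)) (\<lambda>x y. f x y / (1 + f x y))"
proof (rule series_bounded_compose[OF assms(1,2), where b = "\<lambda>k. if k = 0 then 0 else (-1) ^ Suc k"])
  have N: "0 \<le> N" by (rule series_bounded_nonneg[OF assms(2)])
  fix z :: real assume z: "\<bar>z\<bar> \<le> N"
  have "(\<lambda>k. - ((if k = 0 then 0 else 1) * (- z) ^ k)) sums - ((- z) / (1 - (- z)))"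
    using z assms(3) by (intro sums_minus geometric_shifted_sums) auto
  moreover have "- ((if k = 0 then 0 else 1) * (- z) ^ k) = (if k = 0 then 0 else (-1) ^ Suc k) * z ^ k" for k
    using power_mult_distrib[of "-1" z k] by simp
  ultimately show "(\<lambda>k. (if k = 0 then 0 else (-1) ^ Suc k) * z ^ k) sums (z / (1 + z))" by simp
next
  have N: "0 \<le> N" by (rule series_bounded_nonneg[OF assms(2)])
  fix A :: "nat set" assume "finite A"
  have "(\<Sum>k\<in>A. \<bar>if k = 0 then 0 else (-1) ^ Suc k\<bar> * N ^ k) = (\<Sum>k\<in>A. (if k = 0 then 0 else 1) * N ^ k)"
    by (intro sum.cong refl) (auto simp: power_abs)
  also have "\<dots> \<le> N / (1 - N)"
    using N assms(3) \<open>finite A\<close> by (intro sum_le_if_sums[OF geometric_shifted_sums]) auto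
  finally show "(\<Sum>k\<in>A. \<bar>if k = 0 then 0 else (-1) ^ Suc k\<bar> * N ^ k) \<le> N / (1 - N)" .
qed

lemma series_bounded_ln:
  assumes "0 < r" "series_bounded x0 y0 r N f" "N < 1"
  shows "series_bounded x0 y0 r (N / (1 - N)) (\<lambda>x y. ln (1 + f x y))"
proof (rule series_bounded_compose[OF assms(1,2), where b = "\<lambda>k. - ((-1) ^ k / of_nat k)"])
  have N: "0 \<le> N" by (rule series_bounded_nonneg[OF assms(2)])
  fix z :: real assume z: "\<bar>z\<bar> \<le> N"
  then show "(\<lambda>k. - ((-1) ^ k / of_nat k) * z ^ k) sums ln (1 + z)"
  proof -
    have "(\<lambda>k. - ((-1) ^ k / of_nat k) * z ^ k) = (\<lambda>k. - ((- z) ^ k) / of_nat k)"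
      using power_mult_distrib[of "-1" z] by (intro ext) simp
    then show ?thesis using ln_series'[of z] z assms(3) by (simp only:)
  qed
next
  have N: "0 \<le> N" by (rule series_bounded_nonneg[OF assms(2)])
  fix A :: "nat set" assume "finite A"
  have "(\<Sum>k\<in>A. \<bar>- ((-1) ^ k / of_nat k)\<bar> * N ^ k) \<le> (\<Sum>k\<in>A. (if k = 0 then 0 else 1) * N ^ k)"
  proof (intro sum_mono mult_right_mono)
    fix k :: nat
    show "\<bar>- ((-1) ^ k / of_nat k)\<bar> \<le> (if k = 0 then 0 else 1 :: real)"
      by (auto simp: power_abs abs_divide divide_le_eq)
  qed (use N in auto)
  also have "\<dots> \<le> N / (1 - N)"
    using N assms(3) \<open>finite A\<close> by (intro sum_le_if_sums[OF geometric_shifted_sums]) auto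
  finally show "(\<Sum>k\<in>A. \<bar>- ((-1) ^ k / of_nat k)\<bar> * N ^ k) \<le> N / (1 - N)" .
qed

lemma abs_has_sum_le:
  fixes f :: "'i \<Rightarrow> real"
  assumes "(f has_sum F) I" "\<And>A. finite A \<Longrightarrow> A \<subseteq> I \<Longrightarrow> (\<Sum>i\<in>A. \<bar>f i\<bar>) \<le> B"
  shows "\<bar>F\<bar> \<le> B"
proof -
  have s: "(\<lambda>i. norm (f i)) summable_on I"
    using assms(2) by (intro summable_on_if_bounded_sums[of _ _ B]) auto
  have "norm F \<le> infsum (\<lambda>i. norm (f i)) I"
    by (rule norm_has_sum_bound[OF has_sum_infsum[OF s] assms(1)])
  also have "\<dots> \<le> B" using assms(2) by (intro infsum_le_finite_sums s) auto
  finally show ?thesis by simp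
qed

text \<open>A monomial outside the square \<open>{..<K} \<times> {..<K}\<close> has degree at least \<open>K\<close> and hence gains the factor
\<open>q\<^bsup>K\<^esup>\<close> over its value at the corner. The bound depends on the coefficients only through \<open>N\<close>.\<close>

lemma double_series_remainder:
  fixes c :: "nat \<times> nat \<Rightarrow> real"
  assumes "0 < r" "0 \<le> q" "q \<le> 1" "\<bar>s\<bar> \<le> q * r" "\<bar>t\<bar> \<le> q * r"
    and bound: "\<And>A. finite A \<Longrightarrow> (\<Sum>a\<in>A. \<bar>c a\<bar> * monom2 r r a) \<le> N"
    and F: "((\<lambda>a. c a * monom2 s t a) has_sum F) UNIV"
  shows "\<bar>F - (\<Sum>a\<in>{..<K} \<times> {..<K}. c a * monom2 s t a)\<bar> \<le> q ^ K * N"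
proof (rule abs_has_sum_le)
  show "((\<lambda>a. c a * monom2 s t a) has_sum (F - (\<Sum>a\<in>{..<K} \<times> {..<K}. c a * monom2 s t a))) (UNIV - {..<K} \<times> {..<K})"
    by (rule has_sum_Diff[OF F]) (auto intro: has_sum_finite)
  fix A :: "(nat \<times> nat) set" assume A: "finite A" "A \<subseteq> UNIV - {..<K} \<times> {..<K}"
  have "(\<Sum>a\<in>A. \<bar>c a * monom2 s t a\<bar>) \<le> (\<Sum>a\<in>A. q ^ K * (\<bar>c a\<bar> * monom2 r r a))"
  proof (rule sum_mono)
    fix a assume "a \<in> A"
    then have "K \<le> fst a + snd a" using A by (cases a) force
    have "\<bar>monom2 s t a\<bar> \<le> monom2 (q * r) (q * r) a" using assms by (intro abs_monom2_le) auto
    also have "\<dots> = q ^ (fst a + snd a) * monom2 r r a" by (simp add: power_mult_distrib power_add)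
    also have "\<dots> \<le> q ^ K * monom2 r r a"
      using assms \<open>K \<le> fst a + snd a\<close> by (intro mult_right_mono power_decreasing) auto
    finally have "\<bar>c a\<bar> * \<bar>monom2 s t a\<bar> \<le> \<bar>c a\<bar> * (q ^ K * monom2 r r a)" by (rule mult_left_mono) simp
    then show "\<bar>c a * monom2 s t a\<bar> \<le> q ^ K * (\<bar>c a\<bar> * monom2 r r a)"
      unfolding abs_mult[of "c a"] by (simp add: mult_ac)
  qed
  also have "\<dots> \<le> q ^ K * N"
    unfolding sum_distrib_left[symmetric] using assms A by (intro mult_left_mono bound) auto
  finally show "(\<Sum>a\<in>A. \<bar>c a * monom2 s t a\<bar>) \<le> q ^ K * N" .
qed

lemma subsequence_all_convergent:
  fixes c :: "nat \<Rightarrow> 'b::countable \<Rightarrow> real"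
  assumes "\<And>n a. \<bar>c n a\<bar> \<le> B a"
  obtains d where "strict_mono d" "\<And>a. convergent (\<lambda>n. c (d n) a)"
proof -
  let ?P = "\<lambda>k s. convergent (\<lambda>n. c (s n) (from_nat k))"
  interpret subseqs ?P
  proof
    fix k and s :: "nat \<Rightarrow> nat"
    have "bounded (range (\<lambda>n. c (s n) (from_nat k)))"
      using assms by (intro boundedI[of _ "B (from_nat k)"]) auto
    from bounded_imp_convergent_subsequence[OF this]
    obtain l r where "strict_mono r" "((\<lambda>n. c (s n) (from_nat k)) \<circ> r) \<longlonglongrightarrow> l" by blast
    then show "\<exists>r. strict_mono r \<and> convergent (\<lambda>n. c ((s \<circ> r) n) (from_nat k))"
      by (auto simp: convergent_def o_def)
  qed
  have "convergent (\<lambda>n. c (diagseq n) a)" for a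
  proof -
    have "?P (to_nat a) (diagseq \<circ> ((+) (Suc (to_nat a))))"
      by (rule diagseq_holds)
        (use convergent_subseq_convergent in \<open>auto simp: o_def\<close>)
    then have "convergent (\<lambda>n. c (diagseq (n + Suc (to_nat a))) a)" by (simp add: o_def add.commute)
    then show ?thesis using convergent_ignore_initial_segment[of "\<lambda>n. c (diagseq n) a" "Suc (to_nat a)"] by simp
  qed
  then show ?thesis using subseq_diagseq that by blast
qed

text \<open>A pointwise limit of series with a common bound is again such a series: by compactness the
  coefficients converge along a subsequence, and the remainders are uniformly small.\<close>

lemma series_bounded_limit:
  assumes r: "0 < r" and f: "\<And>n. series_bounded x0 y0 r N (f n)"
    and g: "\<And>x y. \<bar>x - x0\<bar> < r \<Longrightarrow> \<bar>y - y0\<bar> < r \<Longrightarrow> (\<lambda>n. f n x y) \<longlonglongrightarrow> g x y"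
  shows "series_bounded x0 y0 r N g"
proof -
  have "\<forall>n. \<exists>c. (\<forall>A. finite A \<longrightarrow> (\<Sum>a\<in>A. \<bar>c a\<bar> * monom2 r r a) \<le> N) \<and>
     (\<forall>x y. \<bar>x - x0\<bar> < r \<and> \<bar>y - y0\<bar> < r \<longrightarrow>
        ((\<lambda>a. c a * monom2 (x - x0) (y - y0) a) has_sum f n x y) UNIV)"
    using f unfolding series_bounded_def by blast
  then obtain c where *: "\<forall>n. (\<forall>A. finite A \<longrightarrow> (\<Sum>a\<in>A. \<bar>c n a\<bar> * monom2 r r a) \<le> N) \<and>
     (\<forall>x y. \<bar>x - x0\<bar> < r \<and> \<bar>y - y0\<bar> < r \<longrightarrow>
        ((\<lambda>a. c n a * monom2 (x - x0) (y - y0) a) has_sum f n x y) UNIV)"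
    unfolding choice_iff by (elim exE)
  have c: "(\<Sum>a\<in>A. \<bar>c n a\<bar> * monom2 r r a) \<le> N" if "finite A" for n A
    using * that by simp
  have sum: "((\<lambda>a. c n a * monom2 (x - x0) (y - y0) a) has_sum f n x y) UNIV"
    if "\<bar>x - x0\<bar> < r" "\<bar>y - y0\<bar> < r" for n x y
    using * that by simp
  have "\<bar>c n a\<bar> \<le> N / monom2 r r a" for n a
    using c[of "{a}" n] r by (simp add: le_divide_eq)
  then obtain d where d: "strict_mono d" "\<And>a. convergent (\<lambda>n. c (d n) a)"
    using subsequence_all_convergent[of c "\<lambda>a. N / monom2 r r a"] by blast
  define e where "e a = lim (\<lambda>n. c (d n) a)" for a
  have e: "(\<lambda>n. c (d n) a) \<longlonglongrightarrow> e a" for a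
    using d(2)[of a] by (simp add: e_def convergent_LIMSEQ_iff)
  have e_bound: "(\<Sum>a\<in>A. \<bar>e a\<bar> * monom2 r r a) \<le> N" if "finite A" for A
  proof (rule LIMSEQ_le_const2)
    show "(\<lambda>n. \<Sum>a\<in>A. \<bar>c (d n) a\<bar> * monom2 r r a) \<longlonglongrightarrow> (\<Sum>a\<in>A. \<bar>e a\<bar> * monom2 r r a)"
      by (intro tendsto_intros e)
  qed (use c[OF that] in auto)
  moreover have "((\<lambda>a. e a * monom2 (x - x0) (y - y0) a) has_sum g x y) UNIV"
    if xy: "\<bar>x - x0\<bar> < r" "\<bar>y - y0\<bar> < r" for x y
  proof -
    let ?m = "monom2 (x - x0) (y - y0)"
    define q where "q = max \<bar>x - x0\<bar> \<bar>y - y0\<bar> / r"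
    have q: "0 \<le> q" "q < 1" "\<bar>x - x0\<bar> \<le> q * r" "\<bar>y - y0\<bar> \<le> q * r"
      using r xy by (auto simp: q_def)
    have "(\<lambda>a. e a * ?m a) summable_on UNIV"
      using xy by (intro summable_series[of _ e r "\<lambda>a. a" N] e_bound) auto
    then obtain S where S: "((\<lambda>a. e a * ?m a) has_sum S) UNIV" by (auto simp: summable_on_def)
    have "\<bar>g x y - S\<bar> \<le> q ^ K * N + q ^ K * N" for K
    proof -
      let ?Q = "{..<K} \<times> {..<K}"
      have "\<bar>g x y - (\<Sum>a\<in>?Q. e a * ?m a)\<bar> \<le> q ^ K * N"
      proof (rule LIMSEQ_le_const2)
        show "(\<lambda>n. \<bar>f (d n) x y - (\<Sum>a\<in>?Q. c (d n) a * ?m a)\<bar>) \<longlonglongrightarrow> \<bar>g x y - (\<Sum>a\<in>?Q. e a * ?m a)\<bar>"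
          using LIMSEQ_subseq_LIMSEQ[OF g[OF xy] d(1)] by (intro tendsto_intros e) (simp add: o_def)
        show "\<exists>n0. \<forall>n\<ge>n0. \<bar>f (d n) x y - (\<Sum>a\<in>?Q. c (d n) a * ?m a)\<bar> \<le> q ^ K * N"
          using q r c sum[OF xy] by (intro exI[of _ 0] allI impI double_series_remainder[where r = r]) auto
      qed
      moreover have "\<bar>S - (\<Sum>a\<in>?Q. e a * ?m a)\<bar> \<le> q ^ K * N"
        using q r e_bound S by (intro double_series_remainder[where r = r]) auto
      ultimately show ?thesis by linarith
    qed
    moreover have "(\<lambda>K. q ^ K * N + q ^ K * N) \<longlonglongrightarrow> 0 * N + 0 * N"
      using q by (intro tendsto_intros LIMSEQ_realpow_zero) auto
    ultimately have "\<bar>g x y - S\<bar> \<le> 0" by (intro LIMSEQ_le_const[of "\<lambda>K. q ^ K * N + q ^ K * N"]) auto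
    then show ?thesis using S by simp
  qed
  ultimately show ?thesis unfolding series_bounded_def by (intro exI[of _ e]) auto
qed

lemma real_analytic_at_if_series_bounded:
  assumes "0 < r" "series_bounded x0 y0 r N g"
    and "\<And>x y. \<bar>x - x0\<bar> < r \<Longrightarrow> \<bar>y - y0\<bar> < r \<Longrightarrow> f (x, y) = g x y"
  shows "real_analytic_at f (x0, y0)"
proof -
  obtain c where "\<And>A. finite A \<Longrightarrow> (\<Sum>a\<in>A. \<bar>c a\<bar> * monom2 r r a) \<le> N"
    and c: "\<And>x y. \<bar>x - x0\<bar> < r \<Longrightarrow> \<bar>y - y0\<bar> < r \<Longrightarrow>
      ((\<lambda>a. c a * monom2 (x - x0) (y - y0) a) has_sum g x y) UNIV"
    using series_boundedE[OF assms(2)] by blast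
  have "((\<lambda>(m, n). c (m, n) * (x - x0) ^ m * (y - y0) ^ n) has_sum f (x, y)) UNIV"
    if "\<bar>x - x0\<bar> < r" "\<bar>y - y0\<bar> < r" for x y
    using c[OF that] assms(3)[OF that] by (simp add: case_prod_unfold mult.assoc)
  then show ?thesis
    unfolding real_analytic_at_def fst_conv snd_conv using assms(1) by blast
qed

lemma series_bounded_fst: "0 < r \<Longrightarrow> series_bounded x0 y0 r (r + \<bar>x0\<bar>) (\<lambda>x y. x)"
  using series_bounded_diff[OF _ series_bounded_single[of r 1 "(1, 0)" r x0 y0] series_bounded_const[of r x0 y0 "- x0"]] by simp

lemma series_bounded_snd: "0 < r \<Longrightarrow> series_bounded x0 y0 r (r + \<bar>y0\<bar>) (\<lambda>x y. y)"
  using series_bounded_diff[OF _ series_bounded_single[of r 1 "(0, 1)" r x0 y0] series_bounded_const[of r x0 y0 "- y0"]] by simp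

section \<open>Analyticity in the low-density phase\<close>

context
  fixes n :: nat and x0 y0 r \<kappa> \<delta> :: real
  assumes n: "0 < n" and r: "0 < r" "r \<le> x0" "r \<le> y0"
    and small: "4 * exp 1 * x0 \<le> 1" "16 * exp 1 * x0 * y0 \<le> 1"
  defines "\<kappa> \<equiv> 2 * x0 * exp 1" and "\<delta> \<equiv> \<kappa> / (1 - \<kappa>)"
begin

text \<open>\<open>\<kappa>\<close> bounds the norm of the activity \<open>\<rho> exp \<phi>\<close>, \<open>\<delta>\<close> that of the density, on a square of radius at
most the coordinates of its centre; the smallness conditions say that a density of norm \<open>\<delta>\<close> generates
a field of norm at most one, so that the bounds reproduce themselves under the iteration.\<close>

lemma kappa_bounds: "0 < \<kappa>" "\<kappa> < 1" "0 < \<delta>" "4 * y0 * \<delta> \<le> 1"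
proof -
  have "\<kappa> \<le> 1 / 2" using small by (simp add: \<kappa>_def mult_ac)
  show *: "0 < \<kappa>" "\<kappa> < 1" "0 < \<delta>"
    using r \<open>\<kappa> \<le> 1 / 2\<close> by (auto simp: \<kappa>_def \<delta>_def)
  then have "\<delta> \<le> 2 * \<kappa>" using * \<open>\<kappa> \<le> 1 / 2\<close> by (simp add: \<delta>_def divide_le_eq)
  then have "4 * y0 * \<delta> \<le> 4 * y0 * (2 * \<kappa>)" using r by (intro mult_left_mono) auto
  also have "\<dots> = 16 * exp 1 * x0 * y0" by (simp add: \<kappa>_def)
  finally show "4 * y0 * \<delta> \<le> 1" using small by linarith
qed

lemma series_bounded_tail_sum:
  assumes "\<And>j. j < n \<Longrightarrow> series_bounded x0 y0 r \<delta> (d j)"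
  shows "series_bounded x0 y0 r (real n * \<delta>) (\<lambda>x y. tail_sum n (\<lambda>j. d j x y) l)"
  unfolding tail_sum_def
proof (rule series_bounded_mono)
  show "series_bounded x0 y0 r (\<Sum>j\<in>{l..<n}. \<delta>) (\<lambda>x y. \<Sum>j\<in>{l..<n}. d j x y)"
    by (rule series_bounded_sum[OF r(1)]) (use assms in auto)
  show "(\<Sum>j\<in>{l..<n}. \<delta>) \<le> real n * \<delta>" using kappa_bounds by (auto intro!: mult_right_mono)
qed

lemma series_bounded_beta: "series_bounded x0 y0 r (2 * y0) (\<lambda>x y. y)"
  using series_bounded_mono[OF series_bounded_snd[OF r(1)]] r by auto

lemma series_bounded_activity:
  assumes "\<And>j. j < n \<Longrightarrow> series_bounded x0 y0 r \<delta> (d j)" "i < n"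
  shows "series_bounded x0 y0 r \<kappa> (\<lambda>x y. x * exp (mf_field n y (tail_sum n (\<lambda>j. d j x y)) i))"
proof -
  have "series_bounded x0 y0 r (\<Sum>l\<le>i. real n * \<delta>) (\<lambda>x y. \<Sum>l\<le>i. tail_sum n (\<lambda>j. d j x y) l)"
    using series_bounded_tail_sum[OF assms(1)] by (intro series_bounded_sum r) auto
  from series_bounded_cmult[OF r(1) series_bounded_mult[OF r(1) series_bounded_beta this], of "2 / (real n)\<^sup>2"]
  have "series_bounded x0 y0 r (\<bar>2 / (real n)\<^sup>2\<bar> * (2 * y0 * (\<Sum>l\<le>i. real n * \<delta>)))
    (\<lambda>x y. mf_field n y (tail_sum n (\<lambda>j. d j x y)) i)"
    by (simp add: mf_field_def mult_ac)
  then have "series_bounded x0 y0 r 1 (\<lambda>x y. mf_field n y (tail_sum n (\<lambda>j. d j x y)) i)"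
  proof (rule series_bounded_mono)
    have "\<bar>2 / (real n)\<^sup>2\<bar> * (2 * y0 * (\<Sum>l\<le>i. real n * \<delta>)) = 4 * y0 * ((\<Sum>l\<le>i. real n * \<delta>) / (real n)\<^sup>2)"
      by simp
    also have "\<dots> \<le> 4 * y0 * \<delta>"
      using kappa_bounds r assms(2) by (intro mult_left_mono mean_sum_le) auto
    finally show "\<bar>2 / (real n)\<^sup>2\<bar> * (2 * y0 * (\<Sum>l\<le>i. real n * \<delta>)) \<le> 1" using kappa_bounds by linarith
  qed
  from series_bounded_mult[OF r(1) series_bounded_fst[OF r(1)] series_bounded_exp[OF r(1) this]]
  show ?thesis
  proof (rule series_bounded_mono)
    show "(r + \<bar>x0\<bar>) * exp 1 \<le> \<kappa>" using r unfolding \<kappa>_def by (intro mult_right_mono) auto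
  qed
qed

lemma series_bounded_mf_density:
  "i < n \<Longrightarrow> series_bounded x0 y0 r \<delta> (\<lambda>x y. mf_density n x y m i)"
proof (induction m arbitrary: i)
  case 0
  then show ?case using series_bounded_mono[OF series_bounded_const[OF r(1), of x0 y0 0]] kappa_bounds by simp
next
  case (Suc m)
  from series_bounded_fraction[OF r(1) series_bounded_activity[OF Suc.IH Suc.prems] kappa_bounds(2)]
  show ?case by (simp add: Let_def \<delta>_def)
qed

lemma series_bounded_low_value:
  "series_bounded x0 y0 r (\<delta> + 2 * y0 * \<delta>\<^sup>2) (\<lambda>x y. low_value n x y / real n)"
proof -
  define d where "d j x y = mf_density n x y n j" for j x y
  define c where "c x y = tail_sum n (\<lambda>j. d j x y)" for x y
  have d: "series_bounded x0 y0 r \<delta> (d j)" if "j < n" for j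
    using series_bounded_mf_density[OF that] unfolding d_def .
  have "series_bounded x0 y0 r \<delta> (\<lambda>x y. ln (1 + x * exp (mf_field n y (c x y) i)))" if "i < n" for i
    unfolding c_def \<delta>_def
    by (intro series_bounded_ln r(1) series_bounded_activity d that kappa_bounds(2)) (simp add: \<delta>_def[symmetric] d)
  then have "series_bounded x0 y0 r (\<Sum>i<n. \<delta>) (\<lambda>x y. \<Sum>i<n. ln (1 + x * exp (mf_field n y (c x y) i)))"
    by (intro series_bounded_sum r) auto
  moreover have "series_bounded x0 y0 r (\<bar>1 / (real n)\<^sup>2\<bar> * (2 * y0 * (\<Sum>l<n. (real n * \<delta>)\<^sup>2)))
      (\<lambda>x y. 1 / (real n)\<^sup>2 * (y * (\<Sum>l<n. (c x y l)\<^sup>2)))"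
    unfolding c_def
    by (rule series_bounded_cmult[OF r(1) series_bounded_mult[OF r(1) series_bounded_beta
          series_bounded_sum[OF r(1) finite_lessThan series_bounded_power[OF r(1) series_bounded_tail_sum[OF d]]]]])
  ultimately have "series_bounded x0 y0 r
      (\<bar>1 / real n\<bar> * ((\<Sum>i<n. \<delta>) + \<bar>1 / (real n)\<^sup>2\<bar> * (2 * y0 * (\<Sum>l<n. (real n * \<delta>)\<^sup>2))))
      (\<lambda>x y. 1 / real n * ((\<Sum>i<n. ln (1 + x * exp (mf_field n y (c x y) i))) - 1 / (real n)\<^sup>2 * (y * (\<Sum>l<n. (c x y l)\<^sup>2))))"
    by (rule series_bounded_cmult[OF r(1) series_bounded_diff[OF r(1)]])
  moreover have "\<bar>1 / real n\<bar> * ((\<Sum>i<n. \<delta>) + \<bar>1 / (real n)\<^sup>2\<bar> * (2 * y0 * (\<Sum>l<n. (real n * \<delta>)\<^sup>2))) = \<delta> + 2 * y0 * \<delta>\<^sup>2"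
    using n by (simp add: power_mult_distrib field_simps)
  moreover have "1 / real n * ((\<Sum>i<n. ln (1 + x * exp (mf_field n y (c x y) i))) - 1 / (real n)\<^sup>2 * (y * (\<Sum>l<n. (c x y l)\<^sup>2)))
      = low_value n x y / real n" for x y
    by (simp add: low_value_def mf_value_def c_def d_def)
  ultimately show ?thesis by (simp only:)
qed

end

text \<open>In the interior of the low-density phase the pressure is a pointwise limit of the series
\<open>low_value n / n\<close>, whose norms are bounded uniformly in \<open>n\<close>.\<close>

lemma real_analytic_low_phase:
  assumes f: "\<And>x y. 0 < x \<Longrightarrow> 0 < y \<Longrightarrow> f (x, y) = pressure x y"
    and small: "4 * exp 1 * x0 \<le> 1" "16 * exp 1 * x0 * y0 \<le> 1" and r: "0 < r" "r \<le> x0" "r \<le> y0"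
    and low: "\<And>x y. \<bar>x - x0\<bar> < r \<Longrightarrow> \<bar>y - y0\<bar> < r \<Longrightarrow> low_phase x y"
  shows "real_analytic_at f (x0, y0)"
proof (rule real_analytic_at_if_series_bounded[OF r(1)])
  define \<delta> where "\<delta> = 2 * x0 * exp 1 / (1 - 2 * x0 * exp 1)"
  show "series_bounded x0 y0 r (\<delta> + 2 * y0 * \<delta>\<^sup>2) pressure"
  proof (rule series_bounded_limit[OF r(1)])
    show "series_bounded x0 y0 r (\<delta> + 2 * y0 * \<delta>\<^sup>2) (\<lambda>x y. low_value (Suc n) x y / real (Suc n))" for n
      unfolding \<delta>_def by (rule series_bounded_low_value[OF zero_less_Suc r small])
    show "(\<lambda>n. low_value (Suc n) x y / real (Suc n)) \<longlonglongrightarrow> pressure x y" if "\<bar>x - x0\<bar> < r" "\<bar>y - y0\<bar> < r" for x y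
      using low[OF that] unfolding low_phase_def by (rule LIMSEQ_Suc)
  qed
  show "f (x, y) = pressure x y" if "\<bar>x - x0\<bar> < r" "\<bar>y - y0\<bar> < r" for x y
    using that r by (intro f) auto
qed

section \<open>Partial derivatives of analytic and of convex functions\<close>

lemma has_partial_single_iff:
  "has_partial [v] f p d \<longleftrightarrow> ((\<lambda>t. f (p + t *\<^sub>R v)) has_real_derivative d) (at 0)"
proof
  assume "has_partial [v] f p d"
  then obtain g where g: "\<forall>\<^sub>F t in nhds 0. g t = f (p + t *\<^sub>R v)" "(g has_real_derivative d) (at 0)" by auto
  then show "((\<lambda>t. f (p + t *\<^sub>R v)) has_real_derivative d) (at 0)"
    using DERIV_cong_ev[OF refl g(1) refl] by simp
next
  assume "((\<lambda>t. f (p + t *\<^sub>R v)) has_real_derivative d) (at 0)"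
  then show "has_partial [v] f p d"
    by (auto intro!: exI[of _ "\<lambda>t. f (p + t *\<^sub>R v)"])
qed

lemma real_analytic_imp_has_partial:
  assumes "real_analytic_at f p"
  shows "\<exists>d. has_partial [(1, 0)] f p d"
proof -
  obtain x0 y0 where p: "p = (x0, y0)" by (cases p)
  obtain c :: "nat \<times> nat \<Rightarrow> real" and r where r: "0 < r" and
    c: "\<And>x y. \<bar>x - x0\<bar> < r \<Longrightarrow> \<bar>y - y0\<bar> < r \<Longrightarrow>
        ((\<lambda>(m, n). c (m, n) * (x - x0) ^ m * (y - y0) ^ n) has_sum f (x, y)) UNIV"
    using assms unfolding real_analytic_at_def p by auto
  have sums: "(\<lambda>m. c (m, 0) * t ^ m) sums f (x0 + t, y0)" if "\<bar>t\<bar> < r" for t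
  proof -
    have inj: "inj (\<lambda>m::nat. (m, 0::nat))" by (auto intro: injI)
    have "((\<lambda>(m, n). c (m, n) * t ^ m * 0 ^ n) has_sum f (x0 + t, y0)) UNIV"
      using c[of "x0 + t" y0] that r by simp
    then have "((\<lambda>(m, n). c (m, n) * t ^ m * 0 ^ n) has_sum f (x0 + t, y0)) (range (\<lambda>m. (m, 0)))"
      by (rule has_sum_cong_neutral[THEN iffD1, rotated -1]) (auto simp: image_iff)
    then have "((\<lambda>m. c (m, 0) * t ^ m) has_sum f (x0 + t, y0)) UNIV"
      unfolding has_sum_reindex[OF inj] by (simp add: o_def)
    then show ?thesis by (rule has_sum_imp_sums)
  qed
  have "summable (\<lambda>m. c (m, 0) * (r / 2) ^ m)" using sums[of "r / 2"] r by (auto simp: sums_iff)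
  from termdiffs_strong[OF this, of 0] r
  have "((\<lambda>t. \<Sum>m. c (m, 0) * t ^ m) has_real_derivative (\<Sum>m. diffs (\<lambda>m. c (m, 0)) m * 0 ^ m)) (at 0)" by simp
  moreover have ev: "\<forall>\<^sub>F t in nhds 0. (\<Sum>m. c (m, 0) * t ^ m) = f (x0 + t, y0)"
    unfolding eventually_nhds_metric using sums r
    by (intro exI[of _ r]) (auto simp: dist_real_def sums_iff)
  ultimately have "((\<lambda>t. f (x0 + t, y0)) has_real_derivative (\<Sum>m. diffs (\<lambda>m. c (m, 0)) m * 0 ^ m)) (at 0)"
    using DERIV_cong_ev[OF refl ev refl] by simp
  then show ?thesis unfolding has_partial_single_iff p by auto
qed

text \<open>Subgradients of a convex function on the line form a monotone function, which is continuous
  outside a countable set; where it is continuous, it is the derivative.\<close>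

lemma convex_differentiable_somewhere:
  fixes h :: "real \<Rightarrow> real"
  assumes "convex_on UNIV h" "a < b"
  obtains x D where "a < x" "x < b" "(h has_real_derivative D) (at x)" "h x - h a \<le> D * (x - a)"
proof -
  define D where "D x = Inf ((\<lambda>t. (h x - h t) / (x - t)) ` ({x<..} \<inter> UNIV))" for x
  have sub: "h x + D x * (y - x) \<le> h y" for x y
    unfolding D_def using convex_le_Inf_differential[OF assms(1), of x y] by simp
  have slope1: "D x * (y - x) \<le> h y - h x" for x y
    using sub[of x y] by simp
  have slope2: "h y - h x \<le> D y * (y - x)" for x y
    using sub[of y x] by (simp add: algebra_simps)
  have "mono D"
  proof (rule monoI)
    fix x y :: real assume "x \<le> y"
    show "D x \<le> D y"
    proof (cases "x = y")
      case False
      then have "0 < y - x" using \<open>x \<le> y\<close> by simp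
      then show ?thesis using order_trans[OF slope1[of x y] slope2[of y x]] by simp
    qed simp
  qed
  then have "countable {x. \<not> isCont D x}" by (rule mono_ctble_discont)
  moreover have "uncountable {a<..<b}" using assms(2) by (simp add: uncountable_open_interval)
  ultimately obtain x where x: "a < x" "x < b" "isCont D x"
    by (metis (mono_tags, lifting) countable_subset greaterThanLessThan_iff mem_Collect_eq subsetI)
  have "(h has_real_derivative D x) (at x)"
    unfolding has_field_derivative_iff
  proof (rule Lim_null_comparison[THEN LIM_zero_cancel])
    show "((\<lambda>y. \<bar>D y - D x\<bar>) \<longlongrightarrow> 0) (at x)"
      using x(3) by (intro tendsto_rabs_zero LIM_zero) (simp add: isCont_def)
    have "\<bar>(h y - h x) / (y - x) - D x\<bar> \<le> \<bar>D y - D x\<bar>" if "y \<noteq> x" for y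
    proof (cases "x < y")
      case True
      then have "D x \<le> (h y - h x) / (y - x)" "(h y - h x) / (y - x) \<le> D y"
        using slope1[of x y] slope2[of y x] by (auto simp: le_divide_eq divide_le_eq)
      then show ?thesis by linarith
    next
      case False
      then have "y < x" using that by simp
      then have "D y \<le> (h y - h x) / (y - x)" "(h y - h x) / (y - x) \<le> D x"
        using slope1[of x y] slope2[of y x] by (auto simp: neg_le_divide_eq neg_divide_le_eq)
      then show ?thesis by linarith
    qed
    then show "\<forall>\<^sub>F y in at x. norm ((h y - h x) / (y - x) - D x) \<le> \<bar>D y - D x\<bar>"
      unfolding eventually_at by (intro exI[of _ 1]) auto
  qed
  then show ?thesis using that x(1,2) slope2[of x a] by blast
qed

section \<open>The first-order transition\<close>

lemma derivative_ge_right_slope: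
  fixes h :: "real \<Rightarrow> real"
  assumes "(h has_real_derivative D) (at 0)" "\<And>s. 0 < s \<Longrightarrow> h 0 + c * s \<le> h s"
  shows "c \<le> D"
proof (rule tendsto_lowerbound)
  show "((\<lambda>s. (h s - h 0) / (s - 0)) \<longlongrightarrow> D) (at_right 0)"
    using assms(1) unfolding has_field_derivative_iff by (rule tendsto_within_subset) auto
  show "\<forall>\<^sub>F s in at_right 0. c \<le> (h s - h 0) / (s - 0)"
    unfolding eventually_at_right_field using assms(2) by (intro exI[of _ 1]) (auto simp: le_divide_eq algebra_simps)
qed simp

lemma derivative_le_left_slope:
  fixes h :: "real \<Rightarrow> real"
  assumes "(h has_real_derivative D) (at 0)" "\<And>s. 0 < s \<Longrightarrow> h 0 - c * s \<le> h (- s)"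
  shows "D \<le> c"
proof -
  have "((\<lambda>s. h (- s)) has_real_derivative D * (- 1)) (at 0)"
    by (rule DERIV_chain'[of uminus "-1" 0 UNIV h D]) (use assms(1) in \<open>auto intro!: derivative_eq_intros\<close>)
  then have "- c \<le> D * (- 1)" by (rule derivative_ge_right_slope) (use assms(2) in auto)
  then show ?thesis by simp
qed

text \<open>The union of all analytic regions containing \<open>C\<close> is connected, as they share \<open>C\<close>.\<close>

lemma analytic_region_subset_phase:
  assumes "analytic_region f C"
  shows "\<exists>U. phase f U \<and> C \<subseteq> U"
proof -
  define \<V> where "\<V> = {V. analytic_region f V \<and> C \<subseteq> V}"
  have C: "C \<in> \<V>" "C \<noteq> {}" using assms by (auto simp: \<V>_def analytic_region_def)
  have "connected (\<Union>\<V>)"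
  proof (rule connected_Union)
    show "\<Inter>\<V> \<noteq> {}" using C(2) by (force simp: \<V>_def)
  qed (auto simp: \<V>_def analytic_region_def)
  moreover have "open (\<Union>\<V>)" by (intro open_Union) (auto simp: \<V>_def analytic_region_def)
  ultimately have "analytic_region f (\<Union>\<V>)"
    unfolding analytic_region_def using C by (auto simp: \<V>_def analytic_region_def)
  moreover have "V = \<Union>\<V>" if "analytic_region f V" "\<Union>\<V> \<subseteq> V" for V
    using that C by (auto simp: \<V>_def)
  ultimately show ?thesis unfolding phase_def using C by blast
qed

lemma interior_or_frontier: "open U \<Longrightarrow> p \<in> closure U \<Longrightarrow> p \<notin> U \<Longrightarrow> p \<in> frontier U"
  by (simp add: frontier_def interior_open)

context
  fixes f :: "real \<times> real \<Rightarrow> real"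
  assumes f: "\<And>x y. 0 < x \<Longrightarrow> 0 < y \<Longrightarrow> f (x, y) = pressure x y"
begin

lemma has_partial_imp_log_derivative:
  assumes "has_partial [(1, 0)] f (x, y) d" "0 < x" "0 < y"
  shows "((\<lambda>s. pressure (exp s * x) y) has_real_derivative d * x) (at 0)"
proof -
  have "((\<lambda>t. f (x + t, y)) has_real_derivative d) (at (exp 0 * x - x))"
    using assms(1) unfolding has_partial_single_iff by simp
  moreover have "((\<lambda>s. exp s * x - x) has_real_derivative x) (at 0)"
    by (auto intro!: derivative_eq_intros)
  ultimately have "((\<lambda>s. f (x + (exp s * x - x), y)) has_real_derivative d * x) (at 0)"
    by (intro DERIV_chain'[where g = "\<lambda>t. f (x + t, y)"])
  then show ?thesis using assms by (simp add: f)
qed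

lemma log_derivative_imp_has_partial:
  assumes "((\<lambda>u. pressure (exp u) y) has_real_derivative D) (at u)" "0 < y"
  shows "has_partial [(1, 0)] f (exp u, y) (D / exp u)"
proof -
  have ev: "\<forall>\<^sub>F t in nhds 0. pressure (exp (ln (exp u + t))) y = f (exp u + t, y)"
    unfolding eventually_nhds_metric
    by (intro exI[of _ "exp u"]) (use assms(2) in \<open>auto simp: dist_real_def f\<close>)
  have "((\<lambda>t. ln (exp u + t)) has_real_derivative 1 / exp u) (at 0)"
    by (auto intro!: derivative_eq_intros)
  moreover have "((\<lambda>u. pressure (exp u) y) has_real_derivative D) (at (ln (exp u + 0)))"
    using assms(1) by simp
  ultimately have "((\<lambda>t. pressure (exp (ln (exp u + t))) y) has_real_derivative D * (1 / exp u)) (at 0)"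
    by (intro DERIV_chain'[where g = "\<lambda>u. pressure (exp u) y"])
  then show ?thesis
    unfolding has_partial_single_iff using DERIV_cong_ev[OF refl ev refl] by simp
qed

lemma partial_continuous_at_empty:
  assumes "0 < x" "0 < y"
  shows "partial_continuous_at [] f (x, y)"
proof -
  have "isCont (\<lambda>(x, y). pressure x y) (x, y)" using assms by (intro isCont_pressure) auto
  then have lim: "((\<lambda>(x, y). pressure x y) \<longlongrightarrow> (case (x, y) of (x, y) \<Rightarrow> pressure x y)) (nhds (x, y))"
    unfolding isCont_def tendsto_at_iff_tendsto_nhds .
  have ev: "\<forall>\<^sub>F q in nhds (x, y). (case q of (x, y) \<Rightarrow> pressure x y) = f q"
  proof -
    have "open ({0<..} \<times> {0<..} :: (real \<times> real) set)" by (intro open_Times) auto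
    then show ?thesis
      by (rule eventually_mono[OF eventually_nhds_in_open]) (use assms in \<open>auto simp: f\<close>)
  qed
  have "(f \<longlongrightarrow> f (x, y)) (nhds (x, y))"
    using lim assms unfolding tendsto_cong[OF ev] by (simp add: f)
  then show ?thesis
    by (simp add: partial_continuous_at_def partial_near_def tendsto_iff dist_real_def)
qed

text \<open>Fix a small activity \<open>\<rho>0\<close>. The relevant values of \<open>\<beta>\<close> are at most \<open>8 U\<close> with \<open>U = - ln \<rho>0\<close>, as
the fully occupied configuration beats the mean-field state from \<open>\<beta> = 4 U\<close> on: it contributes at least
\<open>- U + 4 U / 3\<close> to the pressure. The largest threshold \<open>\<epsilon>\<close> with \<open>2 \<beta> \<epsilon> \<le> 1\<close> for all these \<open>\<beta>\<close> is \<open>1 / (16 U)\<close>; it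
tends to zero only logarithmically in \<open>\<rho>0\<close>, so it stays far above the bound \<open>e \<rho>0\<close> for the
density of the mean-field state. The constant 128 makes \<open>16 e \<rho> \<beta> \<le> 1\<close> for all relevant \<open>\<beta>\<close>, which
serves both the mean-field estimates and the power series, and the assumption with the square root puts
\<open>\<beta> = 1\<close> into the low-density phase.\<close>

context
  fixes \<rho>0 U \<epsilon> :: real
  assumes \<rho>0: "0 < \<rho>0" and U_def: "U = - ln \<rho>0" and \<epsilon>_def: "\<epsilon> = 1 / (16 * U)"
    and U1: "1 \<le> U" and small: "128 * exp 1 * (U * \<rho>0) \<le> 1"
    and start: "sqrt (\<rho>0 * exp 1) + \<epsilon> / 2 * ln (\<rho>0 * exp 1) < 0"
    and final: "exp 1 * \<rho>0 < U / 3"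
begin

lemma eps_pos: "0 < \<epsilon>" "\<epsilon> \<le> 1 / 16"
  using U1 by (auto simp: \<epsilon>_def divide_le_eq)

lemma activity_times_beta:
  assumes "0 < \<rho>" "\<rho> \<le> \<rho>0" "0 < \<beta>" "\<beta> \<le> 8 * U"
  shows "16 * exp 1 * \<rho> * \<beta> \<le> 1"
proof -
  have "\<rho> * \<beta> \<le> \<rho>0 * (8 * U)" using assms \<rho>0 by (intro mult_mono) auto
  then have "16 * exp 1 * (\<rho> * \<beta>) \<le> 16 * exp 1 * (\<rho>0 * (8 * U))" by (intro mult_left_mono) auto
  also have "\<dots> = 128 * exp 1 * (U * \<rho>0)" by simp
  also have "\<dots> \<le> 1" by (rule small)
  finally show ?thesis by (simp only: mult.assoc)
qed

lemma activity_le: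
  assumes "0 < \<rho>" "\<rho> \<le> \<rho>0"
  shows "exp 1 * \<rho> \<le> \<epsilon> / 8"
proof -
  have "128 * (exp 1 * \<rho>) * U \<le> 128 * (exp 1 * \<rho>0) * U"
    using assms U1 by (intro mult_right_mono mult_left_mono) auto
  also have "\<dots> \<le> 1" using small by (simp add: mult_ac)
  finally show ?thesis using U1 by (simp add: \<epsilon>_def le_divide_eq mult_ac)
qed

lemma low_domain_near:
  assumes "0 < \<rho>" "\<rho> \<le> \<rho>0" "0 < \<beta>" "\<beta> \<le> 8 * U"
  shows "low_domain \<epsilon> \<rho> \<beta>"
proof -
  have "0 < exp 1 * \<rho> * \<beta>" using assms by simp
  moreover have "2 * \<beta> * \<epsilon> \<le> 1" using assms U1 by (simp add: \<epsilon>_def divide_le_eq)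
  ultimately show ?thesis
    unfolding low_domain_def
    using activity_le[OF assms(1,2)] activity_times_beta[OF assms] eps_pos assms by (auto simp: mult_ac)
qed

text \<open>Between the supremum of this set and \<open>8 U\<close> there is no low-density phase on the line \<open>\<rho> = \<rho>0\<close>, while
points of this phase accumulate at the supremum.\<close>

definition low_betas :: "real set" where
  "low_betas = {\<beta>. 1 \<le> \<beta> \<and> \<beta> < 8 * U \<and> low_phase \<rho>0 \<beta>}"

definition beta_c :: real where
  "beta_c = Sup low_betas"

lemma low_betas_bounds: "1 \<in> low_betas" "\<beta> \<in> low_betas \<Longrightarrow> 1 \<le> \<beta> \<and> \<beta> \<le> 4 * U"
proof -
  show "1 \<in> low_betas"
    unfolding low_betas_def using U1 \<rho>0 start by (auto intro!: low_phase_small[OF low_domain_near])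
  assume \<beta>: "\<beta> \<in> low_betas"
  show "1 \<le> \<beta> \<and> \<beta> \<le> 4 * U"
  proof (rule ccontr)
    assume "\<not> ?thesis"
    then have "4 * U < \<beta>" "\<beta> < 8 * U" "low_phase \<rho>0 \<beta>" using \<beta> by (auto simp: low_betas_def)
    then show False
      using not_low_phase_large[OF low_domain_near[of \<rho>0 \<beta>]] \<rho>0 U1 final by (auto simp: U_def)
  qed
qed

lemma bdd_low_betas: "bdd_above low_betas"
  using low_betas_bounds(2) by (intro bdd_aboveI[of _ "4 * U"]) auto

lemma beta_c_bounds: "1 \<le> beta_c" "beta_c \<le> 4 * U"
  unfolding beta_c_def using low_betas_bounds bdd_low_betas
  by (auto intro!: cSup_upper cSup_least)

lemma not_low_phase_above: "beta_c < \<beta> \<Longrightarrow> \<beta> < 8 * U \<Longrightarrow> \<not> low_phase \<rho>0 \<beta>"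
  using cSup_upper[OF _ bdd_low_betas, of \<beta>] beta_c_bounds by (auto simp: low_betas_def beta_c_def)

lemma low_phase_arbitrarily_close:
  assumes "0 < \<eta>"
  obtains \<beta> where "low_phase \<rho>0 \<beta>" "beta_c - \<eta> < \<beta>" "\<beta> \<le> beta_c" "1 \<le> \<beta>" "\<beta> < 8 * U"
proof -
  obtain \<beta> where "\<beta> \<in> low_betas" "beta_c - \<eta> < \<beta>"
    using less_cSup_iff[OF _ bdd_low_betas, of "beta_c - \<eta>"] low_betas_bounds(1) assms
    unfolding beta_c_def[symmetric] by auto
  moreover from this have "\<beta> \<le> beta_c" unfolding beta_c_def by (intro cSup_upper bdd_low_betas)
  ultimately show ?thesis using that by (auto simp: low_betas_def)
qed

text \<open>The cones below points of the low-density phase that approach \<open>beta_c\<close> exhaust the open cone below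
\<open>(\<rho>0, beta_c)\<close>. As \<open>ln (\<rho>0 / \<rho>) \<ge> (\<rho>0 - \<rho>) / \<rho>0\<close>, that cone contains a triangle in the coordinates
\<open>(\<rho>, \<beta>)\<close>.\<close>

lemma low_phase_below:
  assumes "0 < \<rho>" "\<rho> < \<rho>0" "0 < \<beta>" "\<beta> \<le> 8 * U" "4 * \<rho>0 * \<bar>\<beta> - beta_c\<bar> < \<epsilon> * (\<rho>0 - \<rho>)"
  shows "low_phase \<rho> \<beta>"
proof -
  define s where "s = ln \<rho>0 - ln \<rho>"
  have s: "0 < s" "\<rho> = exp (- s) * \<rho>0" using assms \<rho>0 by (auto simp: s_def exp_diff)
  have "ln (\<rho> / \<rho>0) \<le> \<rho> / \<rho>0 - 1" using assms \<rho>0 by (intro ln_le_minus_one) auto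
  then have "(\<rho>0 - \<rho>) / \<rho>0 \<le> s" using assms \<rho>0 by (simp add: s_def ln_div diff_divide_distrib)
  then have "\<epsilon> * ((\<rho>0 - \<rho>) / \<rho>0) \<le> \<epsilon> * s" using eps_pos by (intro mult_left_mono) auto
  moreover have "4 * \<bar>\<beta> - beta_c\<bar> < \<epsilon> * ((\<rho>0 - \<rho>) / \<rho>0)"
    using assms(5) \<rho>0 by (simp add: less_divide_eq mult_ac)
  ultimately have pos: "0 < \<epsilon> * s - 4 * \<bar>\<beta> - beta_c\<bar>" by linarith
  obtain \<beta>' where \<beta>': "low_phase \<rho>0 \<beta>'" "beta_c - (\<epsilon> * s - 4 * \<bar>\<beta> - beta_c\<bar>) / 4 < \<beta>'" "\<beta>' \<le> beta_c" "1 \<le> \<beta>'" "\<beta>' < 8 * U"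
    by (rule low_phase_arbitrarily_close[of "(\<epsilon> * s - 4 * \<bar>\<beta> - beta_c\<bar>) / 4"]) (use pos in auto)
  have "\<bar>\<beta> - \<beta>'\<bar> \<le> \<bar>\<beta> - beta_c\<bar> + (beta_c - \<beta>')" using \<beta>'(3) by (simp add: abs_if)
  then have "4 * \<bar>\<beta> - \<beta>'\<bar> < \<epsilon> * s" using \<beta>'(2) by (simp add: field_simps)
  then show ?thesis
    unfolding s(2) using \<beta>' \<rho>0 s assms
    by (intro low_phase_cone[OF low_domain_near _ low_domain_near]) (auto simp: mult_le_cancel_right1)
qed

definition low_cone :: "(real \<times> real) set" where
  "low_cone = {(x, y). 0 < x \<and> x < \<rho>0 \<and> 4 * \<rho>0 * \<bar>y - beta_c\<bar> < \<epsilon> * (\<rho>0 - x)}"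

text \<open>As an intersection of open half-planes the cone is open and convex.\<close>

lemma cone_eq: "low_cone = {z. (-1, 0) \<bullet> z < 0} \<inter> {z. (1, 0) \<bullet> z < \<rho>0}
    \<inter> {z. (\<epsilon>, 4 * \<rho>0) \<bullet> z < \<epsilon> * \<rho>0 + 4 * \<rho>0 * beta_c}
    \<inter> {z. (\<epsilon>, - (4 * \<rho>0)) \<bullet> z < \<epsilon> * \<rho>0 - 4 * \<rho>0 * beta_c}"
proof -
  have "4 * \<rho>0 * \<bar>y - beta_c\<bar> < \<epsilon> * (\<rho>0 - x) \<longleftrightarrow>
      \<epsilon> * x + 4 * \<rho>0 * y < \<epsilon> * \<rho>0 + 4 * \<rho>0 * beta_c \<and>
      \<epsilon> * x - 4 * \<rho>0 * y < \<epsilon> * \<rho>0 - 4 * \<rho>0 * beta_c" for x y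
  proof -
    have "4 * \<rho>0 * \<bar>y - beta_c\<bar> = \<bar>4 * \<rho>0 * y - 4 * \<rho>0 * beta_c\<bar>"
      using \<rho>0 by (simp add: abs_mult right_diff_distrib[symmetric])
    then show ?thesis by (auto simp: right_diff_distrib abs_less_iff)
  qed
  then show ?thesis by (auto simp: low_cone_def)
qed

lemma cone_subset:
  assumes "(x, y) \<in> low_cone"
  shows "0 < x" "x < \<rho>0" "0 < y" "y \<le> 8 * U" "low_phase x y"
proof -
  have *: "0 < x" "x < \<rho>0" "4 * \<rho>0 * \<bar>y - beta_c\<bar> < \<epsilon> * (\<rho>0 - x)" using assms by (auto simp: low_cone_def)
  have "\<epsilon> * (\<rho>0 - x) \<le> 1 / 16 * \<rho>0" using eps_pos * by (intro mult_mono) auto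
  moreover have "4 * \<rho>0 * \<bar>y - beta_c\<bar> = 4 * (\<bar>y - beta_c\<bar> * \<rho>0)" by simp
  ultimately have "\<bar>y - beta_c\<bar> * \<rho>0 < 1 * \<rho>0" using *(3) \<rho>0 by linarith
  then have "\<bar>y - beta_c\<bar> < 1" using \<rho>0 by (simp only: mult_less_cancel_right_pos)
  then show "0 < x" "x < \<rho>0" "0 < y" "y \<le> 8 * U" using * beta_c_bounds U1 by auto
  then show "low_phase x y" using * by (intro low_phase_below) auto
qed

lemma axis_in_cone: "0 < h \<Longrightarrow> h < \<rho>0 \<Longrightarrow> (\<rho>0 - h, beta_c) \<in> low_cone"
  using eps_pos by (simp add: low_cone_def)

lemma open_cone: "open low_cone"
  unfolding cone_eq by (intro open_Int open_halfspace_lt)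

lemma real_analytic_at_cone:
  assumes "p \<in> low_cone"
  shows "real_analytic_at f p"
proof -
  obtain x y where p: "p = (x, y)" by (cases p)
  obtain e where e: "0 < e" "ball (x, y) e \<subseteq> low_cone"
    using open_cone assms unfolding p open_contains_ball by blast
  note xy = cone_subset[OF assms[unfolded p]]
  define r where "r = min (e / 2) (min x y)"
  show ?thesis
    unfolding p
  proof (rule real_analytic_low_phase[where r = r, OF f])
    show "0 < r" "r \<le> x" "r \<le> y" using e xy by (auto simp: r_def)
    show "4 * exp 1 * x \<le> 1" using activity_le[of x] xy eps_pos by simp
    show "16 * exp 1 * x * y \<le> 1" using activity_times_beta[of x y] xy by simp
    fix x' y' assume "\<bar>x' - x\<bar> < r" "\<bar>y' - y\<bar> < r"
    moreover have "norm (x' - x, y' - y) \<le> \<bar>x' - x\<bar> + \<bar>y' - y\<bar>"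
      using norm_Pair_le[of "x' - x" "y' - y"] by simp
    ultimately have "dist (x', y') (x, y) < e" by (simp add: dist_norm r_def)
    then show "low_phase x' y'" using e cone_subset(5) by (auto simp: dist_commute)
  qed
qed

lemma analytic_region_cone: "analytic_region f low_cone"
  unfolding analytic_region_def
proof (intro conjI ballI real_analytic_at_cone)
  show "low_cone \<noteq> {}" using axis_in_cone[of "\<rho>0 / 2"] \<rho>0 by auto
  show "low_cone \<subseteq> param_space" using cone_subset by (auto simp: param_space_def)
  show "connected low_cone"
    unfolding cone_eq by (intro convex_connected convex_Int convex_halfspace_lt)
qed (rule open_cone)

lemma closure_cone: "(\<rho>0, beta_c) \<in> closure low_cone"
  unfolding closure_approachable
proof (intro allI impI)
  fix e :: real assume "0 < e"
  define h where "h = min (\<rho>0 / 2) (e / 2)"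
  have "0 < h" "h < \<rho>0" "h < e" using \<rho>0 \<open>0 < e\<close> by (auto simp: h_def)
  then show "\<exists>q\<in>low_cone. dist q (\<rho>0, beta_c) < e"
    using axis_in_cone[of h] by (intro bexI[of _ "(\<rho>0 - h, beta_c)"]) (auto simp: dist_Pair_Pair dist_real_def)
qed

lemma partial_cone_le:
  assumes "(x, y) \<in> low_cone" "has_partial [(1, 0)] f (x, y) d"
  shows "d \<le> exp 1"
proof -
  note xy = cone_subset[OF assms(1)]
  have "d * x \<le> exp 1 * x"
    using pressure_decrease_low_phase[OF low_domain_near xy(5)] xy
    by (intro derivative_le_left_slope[OF has_partial_imp_log_derivative[OF assms(2)]]) auto
  then show ?thesis using xy by simp
qed

text \<open>Across the transition the slope of the pressure in \<open>ln \<rho>\<close> jumps at the point itself: both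
  one-sided bounds pass to the limit along the line \<open>\<rho> = \<rho>0\<close> because the pressure is Lipschitz in
  \<open>\<beta>\<close>.\<close>

lemma not_analytic_at_transition: "\<not> real_analytic_at f (\<rho>0, beta_c)"
proof
  assume "real_analytic_at f (\<rho>0, beta_c)"
  then obtain d where d: "has_partial [(1, 0)] f (\<rho>0, beta_c) d"
    using real_analytic_imp_has_partial by blast
  have pos: "0 < beta_c" using beta_c_bounds by simp
  note der = has_partial_imp_log_derivative[OF d \<rho>0 pos]
  have lip: "\<bar>pressure x \<beta> - pressure x beta_c\<bar> \<le> \<bar>\<beta> - beta_c\<bar>" if "0 < x" "0 < \<beta>" for x \<beta>
    using abs_pressure_diff_le[of x x beta_c \<beta>] that pos by simp
  have "\<epsilon> \<le> d * \<rho>0"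
  proof (rule derivative_ge_right_slope[OF der])
    fix s :: real assume s: "0 < s"
    show "pressure (exp 0 * \<rho>0) beta_c + \<epsilon> * s \<le> pressure (exp s * \<rho>0) beta_c"
    proof (rule field_le_epsilon)
      fix e :: real assume "0 < e"
      define \<beta> where "\<beta> = beta_c + min (e / 2) 1"
      have \<beta>: "beta_c < \<beta>" "\<beta> < 8 * U" "0 < \<beta>" "2 * \<bar>\<beta> - beta_c\<bar> \<le> e"
        using \<open>0 < e\<close> beta_c_bounds U1 by (auto simp: \<beta>_def)
      have "pressure \<rho>0 \<beta> + \<epsilon> * s \<le> pressure (exp s * \<rho>0) \<beta>"
        using \<beta> \<rho>0 s not_low_phase_above[of \<beta>] by (intro pressure_growth_outside_low_phase low_domain_near) auto
      then show "pressure (exp 0 * \<rho>0) beta_c + \<epsilon> * s \<le> pressure (exp s * \<rho>0) beta_c + e"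
        using lip[of \<rho>0 \<beta>] lip[of "exp s * \<rho>0" \<beta>] \<beta> \<rho>0 by simp
    qed
  qed
  moreover have "d * \<rho>0 \<le> exp 1 * \<rho>0"
  proof (rule derivative_le_left_slope[OF der])
    fix s :: real assume s: "0 < s"
    show "pressure (exp 0 * \<rho>0) beta_c - exp 1 * \<rho>0 * s \<le> pressure (exp (- s) * \<rho>0) beta_c"
    proof (rule field_le_epsilon)
      fix e :: real assume "0 < e"
      obtain \<beta> where \<beta>: "low_phase \<rho>0 \<beta>" "beta_c - e / 2 < \<beta>" "\<beta> \<le> beta_c" "1 \<le> \<beta>" "\<beta> < 8 * U"
        by (rule low_phase_arbitrarily_close[of "e / 2"]) (use \<open>0 < e\<close> in auto)
      have "pressure \<rho>0 \<beta> - exp 1 * \<rho>0 * s \<le> pressure (exp (- s) * \<rho>0) \<beta>"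
        using \<beta> \<rho>0 s by (intro pressure_decrease_low_phase[OF low_domain_near]) auto
      then show "pressure (exp 0 * \<rho>0) beta_c - exp 1 * \<rho>0 * s \<le> pressure (exp (- s) * \<rho>0) beta_c + e"
        using lip[of \<rho>0 \<beta>] lip[of "exp (- s) * \<rho>0" \<beta>] \<beta> \<rho>0 by simp
    qed
  qed
  ultimately show False using activity_le[OF \<rho>0] eps_pos by simp
qed

text \<open>Just above \<open>beta_c\<close> the pressure grows at rate \<open>\<epsilon>\<close> in \<open>ln \<rho>\<close>; by convexity every derivative to the
right of \<open>\<rho>0\<close> is at least that large, and there are points where the derivative exists. As
\<open>\<epsilon> \<ge> 8 e \<rho>0\<close>, the derivative in \<open>\<rho>\<close> is at least \<open>2 e\<close> wherever moreover \<open>\<rho> < 2 \<rho>0\<close>.\<close>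

lemma steep_points_nearby:
  assumes "0 < \<eta>"
  obtains x y d where "\<rho>0 < x" "x < \<rho>0 + \<eta>" "x < 2 * \<rho>0" "beta_c < y" "y < beta_c + \<eta>"
    "has_partial [(1, 0)] f (x, y) d" "2 * exp 1 \<le> d"
proof -
  define k where "k = min \<eta> \<rho>0"
  define \<beta> where "\<beta> = beta_c + min (\<eta> / 2) 1"
  have k: "0 < k" "k \<le> \<eta>" "k \<le> \<rho>0" using assms \<rho>0 by (auto simp: k_def)
  have \<beta>: "beta_c < \<beta>" "\<beta> < beta_c + \<eta>" "\<beta> < 8 * U" "0 < \<beta>"
    using assms beta_c_bounds U1 by (auto simp: \<beta>_def)
  have "convex_on UNIV (\<lambda>u. pressure (exp u) \<beta>)" using \<beta> by (intro pressure_convex) auto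
  moreover have "ln \<rho>0 < ln (\<rho>0 + k)" using \<rho>0 k by simp
  ultimately obtain u D where u: "ln \<rho>0 < u" "u < ln (\<rho>0 + k)"
    and D: "((\<lambda>u. pressure (exp u) \<beta>) has_real_derivative D) (at u)"
    and slope: "pressure (exp u) \<beta> - pressure (exp (ln \<rho>0)) \<beta> \<le> D * (u - ln \<rho>0)"
    by (rule convex_differentiable_somewhere)
  have x: "\<rho>0 < exp u" "exp u < \<rho>0 + k" using u \<rho>0 k
    by (metis exp_less_mono exp_ln, metis add_pos_pos exp_less_mono exp_ln)
  have "pressure \<rho>0 \<beta> + \<epsilon> * (u - ln \<rho>0) \<le> pressure (exp (u - ln \<rho>0) * \<rho>0) \<beta>"
    using \<beta> \<rho>0 u not_low_phase_above[of \<beta>] by (intro pressure_growth_outside_low_phase low_domain_near) auto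
  then have "\<epsilon> * (u - ln \<rho>0) \<le> D * (u - ln \<rho>0)" using slope \<rho>0 by (simp add: exp_diff)
  then have "\<epsilon> \<le> D" using u by simp
  have "exp 1 * exp u \<le> exp 1 * (2 * \<rho>0)" using x k by (intro mult_left_mono) auto
  also have "\<dots> = 2 * (exp 1 * \<rho>0)" by simp
  finally have "2 * (exp 1 * exp u) \<le> D"
    using activity_le[OF \<rho>0] \<open>\<epsilon> \<le> D\<close> eps_pos by linarith
  then have "2 * exp 1 \<le> D / exp u" by (simp add: le_divide_eq mult.assoc)
  with that[OF _ _ _ \<beta>(1,2) log_derivative_imp_has_partial[OF D \<beta>(4)]] x k show ?thesis by auto
qed

lemma partial_discontinuous_at_transition:
  "partial_discontinuous_at [(1, 0)] f (\<rho>0, beta_c)"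
  unfolding partial_discontinuous_at_def
proof
  assume "\<exists>L. partial_near [(1, 0)] f (\<rho>0, beta_c) L"
  then obtain L where "partial_near [(1, 0)] f (\<rho>0, beta_c) L" ..
  then have "\<forall>\<^sub>F q in nhds (\<rho>0, beta_c). \<forall>d. has_partial [(1, 0)] f q d \<longrightarrow> \<bar>d - L\<bar> < 1 / 2"
    unfolding partial_near_def by (meson half_gt_zero zero_less_one)
  then obtain e where e: "0 < e"
    "\<And>q d. dist q (\<rho>0, beta_c) < e \<Longrightarrow> has_partial [(1, 0)] f q d \<Longrightarrow> \<bar>d - L\<bar> < 1 / 2"
    unfolding eventually_nhds_metric by blast
  define h where "h = min (\<rho>0 / 2) (e / 2)"
  have h: "0 < h" "h < \<rho>0" "h < e" using \<rho>0 e(1) by (auto simp: h_def)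
  obtain d where d: "has_partial [(1, 0)] f (\<rho>0 - h, beta_c) d"
    using real_analytic_imp_has_partial[OF real_analytic_at_cone[OF axis_in_cone[OF h(1,2)]]] by blast
  have "d \<le> exp 1" by (rule partial_cone_le[OF axis_in_cone[OF h(1,2)] d])
  moreover have "\<bar>d - L\<bar> < 1 / 2" using h by (intro e(2)[OF _ d]) (auto simp: dist_Pair_Pair dist_real_def)
  moreover obtain x y d' where x: "\<rho>0 < x" "x < \<rho>0 + e / 2" "beta_c < y" "y < beta_c + e / 2"
    and d': "has_partial [(1, 0)] f (x, y) d'" "2 * exp 1 \<le> d'"
    by (rule steep_points_nearby[of "e / 2"]) (use e(1) in auto)
  have "\<bar>d' - L\<bar> < 1 / 2"
  proof (rule e(2)[OF _ d'(1)])
    have "norm (x - \<rho>0, y - beta_c) \<le> \<bar>x - \<rho>0\<bar> + \<bar>y - beta_c\<bar>"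
      using norm_Pair_le[of "x - \<rho>0" "y - beta_c"] by simp
    then show "dist (x, y) (\<rho>0, beta_c) < e" using x by (simp add: dist_norm)
  qed
  moreover have "1 + 1 \<le> exp (1::real)" by (rule exp_ge_add_one_self)
  ultimately show False using d'(2) by linarith
qed

lemma phase_transition_at_beta_c: "0 < beta_c \<and> phase_transition 1 f (\<rho>0, beta_c)"
proof
  show pos: "0 < beta_c" using beta_c_bounds by simp
  obtain V where V: "phase f V" "low_cone \<subseteq> V"
    using analytic_region_subset_phase[OF analytic_region_cone] by blast
  have "(\<rho>0, beta_c) \<in> frontier V"
  proof (rule interior_or_frontier)
    show "open V" "(\<rho>0, beta_c) \<notin> V"
      using V(1) not_analytic_at_transition unfolding phase_def analytic_region_def by auto
    show "(\<rho>0, beta_c) \<in> closure V" using closure_cone closure_mono[OF V(2)] by blast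
  qed
  moreover have "\<forall>vs. set vs \<subseteq> Basis \<and> length vs < 1 \<longrightarrow> partial_continuous_at vs f (\<rho>0, beta_c)"
    using partial_continuous_at_empty[OF \<rho>0 pos] by simp
  moreover have "set [(1::real, 0::real)] \<subseteq> Basis" by (simp add: Basis_prod_def)
  ultimately show "phase_transition 1 f (\<rho>0, beta_c)"
    unfolding phase_transition_def
    using V(1) partial_discontinuous_at_transition \<rho>0 pos
    by (auto simp: param_space_def intro!: exI[of _ "[(1, 0)]"])
qed

end

end

lemma eventually_small_activity:
  "\<forall>\<^sub>F \<rho> in at_right (0::real). 1 \<le> - ln \<rho> \<and> 128 * exp 1 * (- ln \<rho> * \<rho>) \<le> 1 \<and>
     sqrt (\<rho> * exp 1) + 1 / (16 * (- ln \<rho>)) / 2 * ln (\<rho> * exp 1) < 0 \<and> exp 1 * \<rho> < - ln \<rho> / 3"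
  by (intro eventually_conj) real_asymp+

lemma phase_transition_small_density:
  assumes f: "\<And>x y. 0 < x \<Longrightarrow> 0 < y \<Longrightarrow> f (x, y) = pressure x y"
  shows "\<exists>\<rho>c>0. \<forall>\<rho>. 0 < \<rho> \<and> \<rho> < \<rho>c \<longrightarrow> (\<exists>\<beta>>0. phase_transition 1 f (\<rho>, \<beta>))"
proof -
  obtain \<rho>c where \<rho>c: "0 < \<rho>c" and small: "\<And>\<rho>. 0 < \<rho> \<Longrightarrow> \<rho> < \<rho>c \<Longrightarrow>
     1 \<le> - ln \<rho> \<and> 128 * exp 1 * (- ln \<rho> * \<rho>) \<le> 1 \<and>
     sqrt (\<rho> * exp 1) + 1 / (16 * (- ln \<rho>)) / 2 * ln (\<rho> * exp 1) < 0 \<and> exp 1 * \<rho> < - ln \<rho> / 3"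
    using eventually_small_activity unfolding eventually_at_right_field by blast
  show ?thesis
  proof (rule exI[of _ \<rho>c], intro conjI allI impI \<rho>c)
    fix \<rho> assume \<rho>: "0 < \<rho> \<and> \<rho> < \<rho>c"
    show "\<exists>\<beta>>0. phase_transition 1 f (\<rho>, \<beta>)"
      using phase_transition_at_beta_c[OF f, of \<rho> "- ln \<rho>" "1 / (16 * (- ln \<rho>))"] small[of \<rho>] \<rho> by blast
  qed
qed

theorem proposition16:
  fixes M :: "'a measure" and W :: "real \<Rightarrow> 'a \<Rightarrow> real" and x0 :: real
    and \<sigma> \<tau> :: "real \<Rightarrow> nat \<Rightarrow> real"
  assumes "standard_brownian_motion M W"
    and "x0 > 0"
    and "\<And>\<beta> n. \<beta> > 0 \<Longrightarrow> n \<ge> 1 \<Longrightarrow>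
           \<sigma> \<beta> n > 0 \<and> \<tau> \<beta> n > 0 \<and> 1/2 * (\<sigma> \<beta> n)\<^sup>2 * \<tau> \<beta> n * (real n)\<^sup>2 = \<beta>"
  shows "\<exists>\<rho>c>0. \<forall>\<rho>. 0 < \<rho> \<and> \<rho> < \<rho>c \<longrightarrow>
           (\<exists>\<beta>>0. phase_transition 1
              (\<lambda>(r, b). lyapunov_exponent M W x0 \<sigma> \<tau> r b) (\<rho>, \<beta>))"
  by (rule phase_transition_small_density)
    (simp add: lyapunov_exponent_eq_pressure[OF assms(1,2) _ _ assms(3)])

end
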